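(* Assume all fading coefficients (of all open-access tiers and of the closed-access tier) are i.i.d. unit-mean exponential random variables. Then the coverage probability under MARP connectivity is $$\mathbb{P}^{\mathrm{MARP}}=\sum_{k=1}^K\lambda_{ok}P_{ok}^{2/\varepsilon_k}\beta_k^{-2/\varepsilon_k}\int_0^\infty2\pi r\exp\Big(-\eta r^{\varepsilon_k}-\frac{\lambda_c\pi P_c^{2/\varepsilon_c}r^{2\varepsilon_k/\varepsilon_c}}{\mathrm{sinc}(\frac{2\pi}{\varepsilon_c})}-\sum_{l=1}^K\lambda_{ol}\pi P_{ol}^{2/\varepsilon_l}F(\beta_k,\varepsilon_l)\,r^{2\varepsilon_k/\varepsilon_l}\Big)dr,$$ where $F(\beta,\epsilon)=\frac{1}{\mathrm{sinc}(2\pi/\epsilon)}+\beta^{-2/\epsilon}\Big[1-{}_2F_1\big(1,\tfrac{2}{\epsilon};1+\tfrac{2}{\epsilon};-\beta^{-1}\big)\Big]$. If moreover $\eta=0$ and $\varepsilon_1=\cdots=\varepsilon_K=\varepsilon_c=\varepsilon$, then $$\mathbb{P}^{\mathrm{MARP}}=\sum_{k=1}^K\frac{\lambda_{ok}P_{ok}^{2/\varepsilon}\beta_k^{-2/\varepsilon}\,\mathrm{sinc}(\frac{2\pi}{\varepsilon})}{\lambda_cP_c^{2/\varepsilon}+\mathrm{sinc}(\frac{2\pi}{\varepsilon})\sum_{l=1}^K\lambda_{ol}P_{ol}^{2/\varepsilon}F(\beta_k,\varepsilon)}.$$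
   Context: Standing model (single closed tier). There are $K\ge1$ open-access tiers and one closed-access tier of base stations (BSs) in $\mathbb{R}^2$; the mobile station (MS) is at the origin. The BSs of open-access tier $k$ form a homogeneous Poisson point process (PPP) of intensity $\lambda_{ok}>0$ and the closed-access BSs a homogeneous PPP of intensity $\lambda_c\ge0$; all are mutually independent. Open tier-$k$ BSs have transmit power $P_{ok}>0$ and path-loss exponent $\varepsilon_k>2$; closed BSs have power $P_c>0$ and exponent $\varepsilon_c>2$. Fading coefficients are independent of the point processes. Let $R_{ki}$ ($i\ge1$, increasing) be distances of open tier-$k$ BSs with fadings $\Psi_{ki}$, and $R_{cn},\Psi_{cn}$ those of the closed tier. Noise $\eta\ge0$. $S_{ki}=P_{ok}\Psi_{ki}R_{ki}^{-\varepsilon_k}$, $I_o=\sum_k\sum_iS_{ki}$, $I_c=\sum_nP_c\Psi_{cn}R_{cn}^{-\varepsilon_c}$, $\mathrm{SINR}_{ki}=S_{ki}/(I_o-S_{ki}+I_c+\eta)$. SINR thresholds $\beta_k>0$. MARP (maximum average received power) connectivity: the serving BS is the nearest BS of tier $T=\arg\max_kP_{ok}\mathbb{E}[\Psi_k]R_{k1}^{-\varepsilon_k}$ (a.s. unique), and $\mathbb{P}^{\mathrm{MARP}}=\mathbb{P}(\mathrm{SINR}_{T,1}>\beta_T)$. $\mathrm{sinc}(x)=\sin(x)/x$; ${}_2F_1$ is the Gauss hypergeometric function. *)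

theory Defs
  imports "HOL-Probability.Probability"
begin

type_synonym pt = "real ^ 2"

definition pp_space :: "pt set measure" where
  "pp_space = sigma UNIV {{S. card (S \<inter> A) = n} | A n. A \<in> sets lborel \<and> bounded A}"

definition poisson_pp :: "'a measure \<Rightarrow> real \<Rightarrow> ('a \<Rightarrow> pt set) \<Rightarrow> bool" where
  "poisson_pp M lam N \<longleftrightarrow>
     N \<in> measurable M pp_space \<and>
     (\<forall>\<omega>\<in>space M. \<forall>A. bounded A \<longrightarrow> finite (N \<omega> \<inter> A)) \<and>
     (\<forall>A \<in> sets lborel. bounded A \<longrightarrow> (\<forall>n::nat.
        measure M {\<omega>\<in>space M. card (N \<omega> \<inter> A) = n} =
          (lam * measure lborel A) ^ n / fact n * exp (- (lam * measure lborel A)))) \<and>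
     (\<forall>(I::nat set) (A::nat \<Rightarrow> pt set). finite I \<longrightarrow>
        (\<forall>i\<in>I. A i \<in> sets lborel \<and> bounded (A i)) \<longrightarrow> disjoint_family_on A I \<longrightarrow>
        prob_space.indep_vars M (\<lambda>_. count_space UNIV) (\<lambda>i \<omega>. card (N \<omega> \<inter> A i)) I)"

text \<open>Fading attached to a point x of the configuration N \<omega>: the points are ordered by
  increasing distance (index 0 = nearest), and the point of rank i carries Psi \<omega> i.\<close>
definition fade :: "('a \<Rightarrow> nat \<Rightarrow> real) \<Rightarrow> ('a \<Rightarrow> pt set) \<Rightarrow> 'a \<Rightarrow> pt \<Rightarrow> real" where
  "fade Psi N \<omega> x = Psi \<omega> (card {y \<in> N \<omega>. norm y < norm x})"

definition sinc :: "real \<Rightarrow> real" where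
  "sinc x = (if x = 0 then 1 else sin x / x)"

text \<open>Gauss hypergeometric function 2F1(a,b;c;z) for real z < 1 and c > b > 0,
  via Euler's integral representation (the standard analytic continuation).\<close>
definition hyp2f1 :: "real \<Rightarrow> real \<Rightarrow> real \<Rightarrow> real \<Rightarrow> real" where
  "hyp2f1 a b c z = Gamma c / (Gamma b * Gamma (c - b)) *
     (LINT t:{0<..<1}|lborel. t powr (b - 1) * (1 - t) powr (c - b - 1) * (1 - z * t) powr (- a))"

definition Ffun :: "real \<Rightarrow> real \<Rightarrow> real" where
  "Ffun \<beta> \<epsilon> = 1 / sinc (2 * pi / \<epsilon>) +
     \<beta> powr (- 2 / \<epsilon>) * (1 - hyp2f1 1 (2 / \<epsilon>) (1 + 2 / \<epsilon>) (- 1 / \<beta>))"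

definition rx_power :: "real \<Rightarrow> real \<Rightarrow> real \<Rightarrow> pt \<Rightarrow> real" where
  "rx_power P \<epsilon> psi x = P * psi * norm x powr (- \<epsilon>)"

definition I_open :: "nat \<Rightarrow> (nat \<Rightarrow> 'a \<Rightarrow> pt set) \<Rightarrow> (nat \<Rightarrow> 'a \<Rightarrow> nat \<Rightarrow> real)
    \<Rightarrow> (nat \<Rightarrow> real) \<Rightarrow> (nat \<Rightarrow> real) \<Rightarrow> 'a \<Rightarrow> real" where
  "I_open K No Psi Po eps \<omega> =
     (\<Sum>k\<in>{1..K}. infsum (\<lambda>x. rx_power (Po k) (eps k) (fade (Psi k) (No k) \<omega> x) x) (No k \<omega>))"

definition I_closed :: "('a \<Rightarrow> pt set) \<Rightarrow> ('a \<Rightarrow> nat \<Rightarrow> real) \<Rightarrow> real \<Rightarrow> real \<Rightarrow> 'a \<Rightarrow> real" where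
  "I_closed Nc Psic Pc epsc \<omega> = infsum (\<lambda>x. rx_power Pc epsc (fade Psic Nc \<omega> x) x) (Nc \<omega>)"

text \<open>MARP coverage probability. mf k is the mean fading E[Psi_k] of open tier k.
  The MS is served by the nearest BS x of the tier k maximising P_ok E[Psi_k] R_k1^(-eps_k)
  (the maximiser is strict), and is covered if its SINR exceeds beta k.\<close>
definition marp_coverage ::
  "'a measure \<Rightarrow> nat \<Rightarrow> (nat \<Rightarrow> 'a \<Rightarrow> pt set) \<Rightarrow> (nat \<Rightarrow> 'a \<Rightarrow> nat \<Rightarrow> real) \<Rightarrow> (nat \<Rightarrow> real)
    \<Rightarrow> (nat \<Rightarrow> real) \<Rightarrow> (nat \<Rightarrow> real) \<Rightarrow> ('a \<Rightarrow> pt set) \<Rightarrow> ('a \<Rightarrow> nat \<Rightarrow> real) \<Rightarrow> real \<Rightarrow> real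
    \<Rightarrow> real \<Rightarrow> (nat \<Rightarrow> real) \<Rightarrow> real" where
  "marp_coverage M K No Psi Po eps mf Nc Psic Pc epsc \<eta> \<beta> =
     measure M {\<omega> \<in> space M. \<exists>k\<in>{1..K}. \<exists>x\<in>No k \<omega>.
        (\<forall>y\<in>No k \<omega>. norm x \<le> norm y) \<and>
        (\<forall>l\<in>{1..K}. \<forall>y\<in>No l \<omega>. (l, y) \<noteq> (k, x) \<longrightarrow>
            Po l * mf l * norm y powr (- eps l) < Po k * mf k * norm x powr (- eps k)) \<and>
        (let S = rx_power (Po k) (eps k) (fade (Psi k) (No k) \<omega> x) x in
           S / (I_open K No Psi Po eps \<omega> - S + I_closed Nc Psic Pc epsc \<omega> + \<eta>) > \<beta> k)}"

datatype src = OpenPts nat | ClosedPts | OpenFade nat nat | ClosedFade nat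

definition src_sigma :: "'a measure \<Rightarrow> (nat \<Rightarrow> 'a \<Rightarrow> pt set) \<Rightarrow> (nat \<Rightarrow> 'a \<Rightarrow> nat \<Rightarrow> real)
    \<Rightarrow> ('a \<Rightarrow> pt set) \<Rightarrow> ('a \<Rightarrow> nat \<Rightarrow> real) \<Rightarrow> src \<Rightarrow> 'a set set" where
  "src_sigma M No Psi Nc Psic s = (case s of
      OpenPts k \<Rightarrow> sets (vimage_algebra (space M) (No k) pp_space)
    | ClosedPts \<Rightarrow> sets (vimage_algebra (space M) Nc pp_space)
    | OpenFade k i \<Rightarrow> sets (vimage_algebra (space M) (\<lambda>\<omega>. Psi k \<omega> i) borel)
    | ClosedFade i \<Rightarrow> sets (vimage_algebra (space M) (\<lambda>\<omega>. Psic \<omega> i) borel))"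

definition src_index :: "nat \<Rightarrow> src set" where
  "src_index K = OpenPts ` {1..K} \<union> {ClosedPts} \<union> (\<lambda>(k, i). OpenFade k i) ` ({1..K} \<times> UNIV)
                  \<union> range ClosedFade"

end

theory Submission
  imports Defs
begin

text \<open>
  Given all positions, the exponential law of the serving fading turns the coverage event into the
  Laplace transform \<open>exp (- s (I + \<eta>))\<close> with \<open>s\<close> proportional to \<open>t powr \<epsilon>\<close>, where \<open>t\<close> is the distance
  of the serving station. Averaging over the other fadings gives a product of factors
  \<open>1 / (1 + s P r powr -\<epsilon>)\<close> over all other stations, and the requirement that tier \<open>k\<close> serves merely
  replaces the factors of the stations inside an exclusion disc by \<open>0\<close>. Hence each other tier
  contributes the generating functional of a Poisson process, \<open>exp (- \<lambda> \<integral> (1 - v))\<close>, and for the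
  serving tier one conditions on its nearest point: the points beyond it are again Poisson.
  The integrals are evaluated by Euler's reflection formula.

  The event has to be shown measurable exactly, not only up to null sets, as the measure need not be
  complete. It depends on each configuration only through the sorted sequence of the norms.
\<close>

section \<open>Radii of a locally finite configuration\<close>

text \<open>The hypotheses give only counts in bounded Borel sets. Conditioning on the nearest point
  therefore starts from the remark that the event of no point within \<open>b\<close> is itself a
  product, with factor \<open>0\<close> on a disc, so its joint expectation with a product over
  farther points is again a generating functional. Two almost sure facts have to be secured.
  Stations at equal distance would share a fading, as fadings are assigned by rank; and a divergent
  \<open>infsum\<close> has the value \<open>0\<close>, which would read as absence of interference.
  Areas are linear in the squared norm, so radial integrals are taken in the squared distance. There
  \<open>\<beta> powr (2 / \<epsilon>) * Ffun \<beta> \<epsilon>\<close> is \<open>1\<close> plus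
  the integral of \<open>\<beta> / (\<beta> + w powr (\<epsilon> / 2))\<close> over
  \<open>w > 1\<close>: the \<open>1\<close> is the empty exclusion disc and the integral the
  interference from outside, both in units of the squared radius of the disc. The variable
  \<open>r\<close> of the theorem is the serving distance divided by
  \<open>(P / \<beta>) powr (1 / \<epsilon>)\<close>, which makes the Laplace argument
  \<open>r powr \<epsilon>\<close>; the square of this constant gives the powers of \<open>P\<close>
  and \<open>\<beta>\<close> in front of each integral.\<close>

text \<open>The norms of the points of \<open>S\<close> in increasing order, with multiplicity; the value \<open>-1\<close> at \<open>i\<close>
  says that \<open>S\<close> has at most \<open>i\<close> points.\<close>

definition radii :: "pt set \<Rightarrow> nat \<Rightarrow> real" where
  "radii S i = (if \<exists>r. i < card (S \<inter> cball 0 r) then Inf {r. i < card (S \<inter> cball 0 r)} else -1)"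

definition locally_finite :: "pt set \<Rightarrow> bool" where
  "locally_finite S \<longleftrightarrow> (\<forall>A. bounded A \<longrightarrow> finite (S \<inter> A))"

lemma locally_finiteD: "locally_finite S \<Longrightarrow> bounded A \<Longrightarrow> finite (S \<inter> A)"
  by (simp add: locally_finite_def)

text \<open>Ties between norms are broken by an arbitrary injection of \<open>S\<close> into the naturals.\<close>

lemma radii_enum:
  assumes lf: "locally_finite S"
  obtains p :: "pt \<Rightarrow> nat" where
    "inj_on p S" "p ` S = {i. 0 \<le> radii S i}" "\<And>x. x \<in> S \<Longrightarrow> radii S (p x) = norm x"
    "\<And>x y. x \<in> S \<Longrightarrow> y \<in> S \<Longrightarrow> norm x < norm y \<Longrightarrow> p x < p y"
    "\<And>r. p ` (S \<inter> cball 0 r) = {..<card (S \<inter> cball 0 r)}"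
proof -
  have fin: "finite (S \<inter> cball 0 r)" for r
    using lf by (rule locally_finiteD) simp
  have "S \<subseteq> (\<Union>n::nat. S \<inter> cball 0 (real n))"
    by (auto simp: real_arch_simple)
  then have "countable S"
    by (rule countable_subset) (rule countable_UN, simp, rule countable_finite, rule fin)
  then obtain t :: "pt \<Rightarrow> nat" where t: "inj_on t S"
    by (rule countableE)
  \<comment> \<open>\<open>lt\<close> is a strict total order on \<open>S\<close> with finite
    initial segments, so counting predecessors numbers the points from \<open>0\<close> without
    gaps.\<close>
  define lt where "lt y x \<longleftrightarrow> norm y < norm x \<or> norm y = norm x \<and> t y < t x" for y x :: pt
  define p where "p x = card {y\<in>S. lt y x}" for x
  have fin': "finite {y\<in>S. lt y x}" for x
    by (rule finite_subset[OF _ fin[of "norm x"]]) (auto simp: lt_def)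
  have mono: "p y < p x" if "x \<in> S" "y \<in> S" "lt y x" for x y
    unfolding p_def by (rule psubset_card_mono[OF fin']) (use that in \<open>auto simp: lt_def\<close>)
  have total: "x = y \<or> lt x y \<or> lt y x" if "x \<in> S" "y \<in> S" for x y
    using inj_onD[OF t _ that] unfolding lt_def by (metis linorder_less_linear)
  have inj: "inj_on p S"
    by (rule inj_onI) (metis mono total less_irrefl)
  \<comment> \<open>A ball about the origin is downward closed for \<open>lt\<close>, so its points
    receive numbers below their cardinality; injectivity and equal cardinality make these all such
    numbers.\<close>
  have img: "p ` (S \<inter> cball 0 r) = {..<card (S \<inter> cball 0 r)}" for r
  proof (rule card_subset_eq)
    show "p ` (S \<inter> cball 0 r) \<subseteq> {..<card (S \<inter> cball 0 r)}"
    proof safe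
      fix x assume x: "x \<in> S" "x \<in> cball 0 r"
      have "{y\<in>S. lt y x} \<subseteq> S \<inter> cball 0 r" "x \<notin> {y\<in>S. lt y x}"
        using x by (auto simp: lt_def)
      then have "{y\<in>S. lt y x} \<subset> S \<inter> cball 0 r"
        using x by blast
      then show "p x < card (S \<inter> cball 0 r)"
        unfolding p_def by (rule psubset_card_mono[OF fin])
    qed
    show "card (p ` (S \<inter> cball 0 r)) = card {..<card (S \<inter> cball 0 r)}"
      by (simp add: card_image[OF inj_on_subset[OF inj Int_lower1]])
  qed simp
  have less_iff: "i < card (S \<inter> cball 0 r) \<longleftrightarrow> (\<exists>x\<in>S. norm x \<le> r \<and> p x = i)" for i r
    unfolding lessThan_iff[symmetric] img[symmetric] by auto
  have rad: "radii S (p x) = norm x" if "x \<in> S" for x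
  proof -
    \<comment> \<open>The index \<open>p x\<close> is counted exactly from radius
      \<open>norm x\<close> on, so the infimum in \<open>radii\<close> is attained.\<close>
    have "{r. p x < card (S \<inter> cball 0 r)} = {norm x..}"
      using that inj unfolding less_iff by (auto dest: inj_onD)
    moreover have "p x < card (S \<inter> cball 0 (norm x))"
      using that by (auto simp: less_iff)
    ultimately show ?thesis
      unfolding radii_def by auto
  qed
  have "p ` S = {i. 0 \<le> radii S i}"
  proof safe
    fix i assume i: "0 \<le> radii S i"
    then obtain r where "i < card (S \<inter> cball 0 r)"
      by (auto simp: radii_def split: if_splits)
    then show "i \<in> p ` S" by (auto simp: less_iff)
  qed (simp add: rad)
  moreover have "p x < p y" if "x \<in> S" "y \<in> S" "norm x < norm y" for x y
    using that mono[of y x] by (simp add: lt_def)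
  ultimately show ?thesis
    using that[OF inj] rad img by blast
qed

text \<open>This turns statements about radii into statements about counts in balls. The conjunct
  \<open>0 \<le> radii S i\<close> is essential: otherwise the default \<open>-1\<close> of a
  missing point would pass as a small radius.\<close>

lemma radii_le_iff:
  assumes "locally_finite S"
  shows "0 \<le> radii S i \<and> radii S i \<le> r \<longleftrightarrow> i < card (S \<inter> cball 0 r)"
proof -
  obtain p where p: "inj_on p S" "p ` S = {i. 0 \<le> radii S i}" "\<And>x. x \<in> S \<Longrightarrow> radii S (p x) = norm x"
    "\<And>r. p ` (S \<inter> cball 0 r) = {..<card (S \<inter> cball 0 r)}"
    using radii_enum[OF assms] by metis
  have "i < card (S \<inter> cball 0 r) \<longleftrightarrow> (\<exists>x\<in>S. norm x \<le> r \<and> p x = i)"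
    unfolding lessThan_iff[symmetric] p(4)[symmetric] by auto
  also have "\<dots> \<longleftrightarrow> (\<exists>x\<in>S. p x = i \<and> radii S i \<le> r)"
    using p(3) by auto
  also have "\<dots> \<longleftrightarrow> i \<in> p ` S \<and> radii S i \<le> r"
    by auto
  also have "\<dots> \<longleftrightarrow> 0 \<le> radii S i \<and> radii S i \<le> r"
    by (simp add: p(2))
  finally show ?thesis by blast
qed

text \<open>A ball holding more than \<open>j\<close> points also holds more than \<open>i\<close>.
  In particular the present indices form an initial segment.\<close>

lemma radii_mono:
  assumes lf: "locally_finite S" and "0 \<le> radii S j" "i \<le> j"
  shows "0 \<le> radii S i" "radii S i \<le> radii S j"
proof -
  have "j < card (S \<inter> cball 0 (radii S j))"
    using radii_le_iff[OF lf, of j "radii S j"] assms by simp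
  then have "i < card (S \<inter> cball 0 (radii S j))"
    using assms by simp
  then show "0 \<le> radii S i" "radii S i \<le> radii S j"
    using radii_le_iff[OF lf, of i "radii S j"] by simp_all
qed

text \<open>Balls of negative radius are empty, so every infimum in \<open>radii\<close> is
  nonnegative and \<open>-1\<close> is the only negative value.\<close>

lemma radii_absent: "radii S i < 0 \<longleftrightarrow> radii S i = -1" if "locally_finite S"
proof -
  have *: "0 \<le> Inf {r. i < card (S \<inter> cball 0 r)}" if ex: "\<exists>r. i < card (S \<inter> cball 0 r)"
  proof (rule cInf_greatest)
    fix r assume "r \<in> {r. i < card (S \<inter> cball 0 r)}"
    then show "0 \<le> r" by (cases "r < 0") auto
  qed (use ex in auto)
  show ?thesis
    using * by (cases "\<exists>r. i < card (S \<inter> cball 0 r)") (auto simp: radii_def simp del: not_less)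
qed

lemma prod_radii_cball:
  fixes v :: "real \<Rightarrow> 'c::comm_monoid_mult"
  assumes lf: "locally_finite S"
  shows "(\<Prod>x\<in>S \<inter> cball 0 r. v (norm x)) = (\<Prod>i<card (S \<inter> cball 0 r). v (radii S i))"
proof -
  obtain p where p: "inj_on p S" "\<And>x. x \<in> S \<Longrightarrow> radii S (p x) = norm x"
    "\<And>r. p ` (S \<inter> cball 0 r) = {..<card (S \<inter> cball 0 r)}"
    using radii_enum[OF lf] by metis
  have "inj_on p (S \<inter> cball 0 r)"
    using p(1) by (rule inj_on_subset) auto
  then show ?thesis
    by (simp add: p(3)[symmetric] prod.reindex p(2))
qed

text \<open>The unordered sum is invariant under the numbering of the points. For the rank a search
  over \<open>j < i\<close> suffices, because strictly nearer points have smaller numbers; this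
  finite count depends measurably on the radii.\<close>

lemma infsum_radii:
  assumes lf: "locally_finite S"
  shows "infsum (\<lambda>x. f (card {y \<in> S. norm y < norm x}) (norm x)) S =
    infsum (\<lambda>i. f (card {j\<in>{..<i}. radii S j < radii S i}) (radii S i)) {i. 0 \<le> radii S i}"
proof -
  obtain p where p: "inj_on p S" "p ` S = {i. 0 \<le> radii S i}" "\<And>x. x \<in> S \<Longrightarrow> radii S (p x) = norm x"
    "\<And>x y. x \<in> S \<Longrightarrow> y \<in> S \<Longrightarrow> norm x < norm y \<Longrightarrow> p x < p y"
    using radii_enum[OF lf] by metis
  have rank: "card {y \<in> S. norm y < norm x} = card {j\<in>{..<p x}. radii S j < radii S (p x)}"
    if x: "x \<in> S" for x
  proof -
    have "p ` {y \<in> S. norm y < norm x} = {j\<in>{..<p x}. radii S j < radii S (p x)}"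
    proof safe
      fix j assume j: "j < p x" "radii S j < radii S (p x)"
      have "0 \<le> radii S j"
        using radii_mono(1)[OF lf, of "p x" j] j p(3)[OF x] by simp
      then have "j \<in> p ` S"
        by (simp add: p(2))
      then obtain y where "y \<in> S" "p y = j"
        by blast
      then show "j \<in> p ` {y \<in> S. norm y < norm x}"
        using j x p(3) by auto
    next
      fix y assume y: "y \<in> S" "norm y < norm x"
      show "p y < p x" "radii S (p y) < radii S (p x)"
        using p(4)[OF y(1) x y(2)] y x by (simp_all add: p(3))
    qed
    moreover have "inj_on p {y \<in> S. norm y < norm x}"
      using p(1) by (rule inj_on_subset) auto
    ultimately show ?thesis
      using card_image[of p "{y \<in> S. norm y < norm x}"] by simp
  qed
  have "infsum (\<lambda>i. f (card {j\<in>{..<i}. radii S j < radii S i}) (radii S i)) (p ` S) =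
     infsum (\<lambda>x. f (card {j\<in>{..<p x}. radii S j < radii S (p x)}) (radii S (p x))) S"
    using p(1) by (subst infsum_reindex) (auto simp: o_def)
  also have "\<dots> = infsum (\<lambda>x. f (card {y \<in> S. norm y < norm x}) (norm x)) S"
  proof (rule infsum_cong)
    fix x assume x: "x \<in> S"
    show "f (card {j\<in>{..<p x}. radii S j < radii S (p x)}) (radii S (p x)) = f (card {y \<in> S. norm y < norm x}) (norm x)"
      using arg_cong2[OF rank[OF x] p(3)[OF x, symmetric], of f] by (rule sym)
  qed
  finally show ?thesis by (simp add: p(2))
qed

section \<open>Measurability of the radii with respect to the counting sigma-algebra\<close>

lemma space_pp_space [simp]: "space pp_space = UNIV"
  by (simp add: pp_space_def)

lemma sets_pp_space_card:
  assumes "A \<in> sets lborel" "bounded A"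
  shows "{S. card (S \<inter> A) = n} \<in> sets pp_space"
  unfolding pp_space_def by (rule sets_measure_of[THEN equalityD2, THEN subsetD]) (use assms in \<open>auto intro!: sigma_sets.Basic\<close>)

lemma measurable_card_pp:
  assumes "N \<in> measurable M pp_space" "A \<in> sets lborel" "bounded A"
  shows "(\<lambda>\<omega>. card (N \<omega> \<inter> A)) \<in> measurable M (count_space UNIV)"
proof -
  have "(\<lambda>S. card (S \<inter> A)) \<in> measurable pp_space (count_space (UNIV :: nat set))"
    by (subst measurable_count_space_eq2_countable) (auto simp: vimage_def intro: sets_pp_space_card[OF assms(2,3)])
  from measurable_compose[OF assms(1) this] show ?thesis .
qed

text \<open>Counts in balls are enough. The measure \<open>M\<close> is arbitrary because the fact
  is also applied to the sigma-algebra generated by a single configuration, which is where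
  independence is stated.\<close>

lemma measurable_radii:
  assumes N: "N \<in> measurable M pp_space" and lf: "\<And>\<omega>. \<omega> \<in> space M \<Longrightarrow> locally_finite (N \<omega>)"
  shows "(\<lambda>\<omega>. radii (N \<omega>) i) \<in> borel_measurable M"
proof (rule borel_measurable_iff_le[THEN iffD2], rule allI)
  fix a :: real
  have [measurable]: "Measurable.pred M (\<lambda>\<omega>. i < card (N \<omega> \<inter> cball 0 r))" for r
    by (rule measurable_compose[OF measurable_card_pp[OF N]]) auto
  \<comment> \<open>Either the point exists within distance \<open>a\<close>, or it is missing and
    has the value \<open>-1\<close>; whether it is missing can be decided from integer radii
    alone.\<close>
  have "radii (N \<omega>) i \<le> a \<longleftrightarrow> i < card (N \<omega> \<inter> cball 0 a) \<or> (-1 \<le> a \<and> (\<forall>n::nat. \<not> i < card (N \<omega> \<inter> cball 0 (real n))))"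
    if "\<omega> \<in> space M" for \<omega>
  proof (cases "0 \<le> radii (N \<omega>) i")
    case True
    moreover obtain n :: nat where "radii (N \<omega>) i \<le> real n"
      using real_arch_simple by blast
    ultimately show ?thesis
      using radii_le_iff[OF lf[OF that], of i, symmetric] by auto
  next
    case False
    then show ?thesis
      using radii_le_iff[OF lf[OF that], of i, symmetric] radii_absent[OF lf[OF that], of i] by auto
  qed
  then have "{\<omega> \<in> space M. radii (N \<omega>) i \<le> a} = {\<omega> \<in> space M. i < card (N \<omega> \<inter> cball 0 a) \<or> (-1 \<le> a \<and> (\<forall>n::nat. \<not> i < card (N \<omega> \<inter> cball 0 (real n))))}"
    by blast
  also have "\<dots> \<in> sets M" by measurable
  finally show "{\<omega> \<in> space M. radii (N \<omega>) i \<le> a} \<in> sets M" .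
qed

section \<open>The generating functional of a Poisson process\<close>

text \<open>A disc of squared radius \<open>a\<close> has area \<open>pi * a\<close>: in the plane
  the squared norm carries Lebesgue measure to a constant multiple of Lebesgue measure on the
  half-line. Agreement on the sets \<open>{..a}\<close>, an intersection-stable generator,
  suffices.\<close>

lemma distr_norm_squared_lborel:
  "distr (lborel :: pt measure) borel (\<lambda>x. (norm x)\<^sup>2) = density lborel (\<lambda>u. ennreal pi * indicator {0<..} u)"
proof (rule measure_eqI_generator_eq[where E="range (\<lambda>a::real. {..a})" and \<Omega>=UNIV and A="\<lambda>i::nat. {..real i}"])
  have ball: "emeasure (distr (lborel :: pt measure) borel (\<lambda>x. (norm x)\<^sup>2)) {..a} = ennreal (if a \<ge> 0 then pi * a else 0)" for a
  proof -
    have "(norm x)\<^sup>2 \<le> a \<longleftrightarrow> 0 \<le> a \<and> norm x \<le> sqrt a" for x :: pt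
      using sqrt_ge_absD[of "norm x" a] real_le_rsqrt[of "norm x" a] order_trans[OF zero_le_power2, of "norm x" a] by auto
    then have "(\<lambda>x::pt. (norm x)\<^sup>2) -` {..a} = (if a \<ge> 0 then cball 0 (sqrt a) else {})"
      by auto
    then show ?thesis
      by (auto simp: emeasure_distr emeasure_cball unit_ball_vol_numeral fact_numeral)
  qed
  have dens: "emeasure (density lborel (\<lambda>u. ennreal pi * indicator {0<..} u)) {..a} = ennreal (if a \<ge> 0 then pi * a else 0)" for a
  proof -
    have "emeasure (density lborel (\<lambda>u. ennreal pi * indicator {0<..} u)) {..a}
        = (\<integral>\<^sup>+u. ennreal pi * indicator {0<..a} u \<partial>lborel)"
      by (subst emeasure_density) (auto intro!: nn_integral_cong split: split_indicator)
    also have "\<dots> = ennreal (if a \<ge> 0 then pi * a else 0)"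
      by (auto simp: nn_integral_cmult_indicator ennreal_mult[symmetric])
    finally show ?thesis .
  qed
  show "Int_stable (range (\<lambda>a::real. {..a}))"
    by (rule Int_stableI_image) (rule bexI[of _ "min _ _"], auto)
  show "sets (distr (lborel :: pt measure) borel (\<lambda>x. (norm x)\<^sup>2)) = sigma_sets UNIV (range (\<lambda>a::real. {..a}))"
    by (simp add: borel_eq_atMost)
  show "sets (density lborel (\<lambda>u. ennreal pi * indicator {0<..} u)) = sigma_sets UNIV (range (\<lambda>a::real. {..a}))"
    by (simp add: borel_eq_atMost)
  show "(\<Union>i::nat. {..real i}) = UNIV"
    by (auto simp: real_arch_simple)
  show "emeasure (distr (lborel :: pt measure) borel (\<lambda>x. (norm x)\<^sup>2)) {..real i} \<noteq> \<infinity>" for i :: nat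
    by (simp add: ball)
  fix X assume "X \<in> range (\<lambda>a::real. {..a})"
  then show "emeasure (distr (lborel :: pt measure) borel (\<lambda>x. (norm x)\<^sup>2)) X = emeasure (density lborel (\<lambda>u. ennreal pi * indicator {0<..} u)) X"
    by (auto simp: ball dens)
qed auto

lemma integral_radial:
  fixes f :: "real \<Rightarrow> real"
  assumes [measurable]: "f \<in> borel_measurable borel"
  shows "(LINT x|(lborel :: pt measure). f ((norm x)\<^sup>2)) = pi * (LINT u:{0<..}|lborel. f u)"
proof -
  have "(LINT x|(lborel :: pt measure). f ((norm x)\<^sup>2)) = (LINT u|distr (lborel :: pt measure) borel (\<lambda>x. (norm x)\<^sup>2). f u)"
    by (subst integral_distr) auto
  also have "\<dots> = (LINT u|density lborel (\<lambda>u. ennreal (pi * indicator {0<..} u)). f u)"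
    unfolding distr_norm_squared_lborel by (intro arg_cong2[where f=lebesgue_integral] arg_cong2[where f=density] refl ext)
      (auto split: split_indicator)
  also have "\<dots> = (LINT u|lborel. pi * (indicator {0<..} u * f u))"
    by (subst integral_density) (simp_all add: mult.assoc)
  also have "\<dots> = pi * (LINT u:{0<..}|lborel. f u)"
    unfolding set_lebesgue_integral_def real_scaleR_def by (rule integral_mult_right_zero)
  finally show ?thesis .
qed

text \<open>The area depends only on the difference of the squared radii, so equidistant cuts of the
  squared norm give annuli of equal area.\<close>

lemma measure_annulus:
  assumes "0 \<le> a" "a \<le> b"
  shows "measure lborel {x::pt. a < (norm x)\<^sup>2 \<and> (norm x)\<^sup>2 \<le> b} = pi * (b - a)"
proof -
  have "measure lborel {x::pt. a < (norm x)\<^sup>2 \<and> (norm x)\<^sup>2 \<le> b} = (LINT x|(lborel :: pt measure). indicator {x. a < (norm x)\<^sup>2 \<and> (norm x)\<^sup>2 \<le> b} x)"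
    by simp
  also have "\<dots> = (LINT x|(lborel :: pt measure). indicator {a<..b} ((norm x)\<^sup>2))"
    by (intro Bochner_Integration.integral_cong) (auto split: split_indicator)
  also have "\<dots> = pi * (LINT u:{0<..}|lborel. indicator {a<..b} u)"
    by (rule integral_radial) simp
  also have "(LINT u:{0<..}|lborel. indicator {a<..b} u) = (LINT u|lborel. indicator {a<..b} u :: real)"
    unfolding set_lebesgue_integral_def
    by (intro Bochner_Integration.integral_cong) (use assms in \<open>auto split: split_indicator\<close>)
  finally show ?thesis using assms by simp
qed

lemma bounded_annulus: "bounded {x::pt. a < (norm x)\<^sup>2 \<and> (norm x)\<^sup>2 \<le> b}"
proof (rule bounded_subset[OF bounded_cball])
  show "{x::pt. a < (norm x)\<^sup>2 \<and> (norm x)\<^sup>2 \<le> b} \<subseteq> cball 0 (sqrt b)"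
    by (auto intro: real_le_rsqrt)
qed

context prob_space
begin

lemma poisson_pp_locally_finite:
  assumes "poisson_pp M lam N" "\<omega> \<in> space M"
  shows "locally_finite (N \<omega>)"
  using assms by (auto simp: poisson_pp_def locally_finite_def)

lemma poisson_pp_measurable: "poisson_pp M lam N \<Longrightarrow> N \<in> measurable M pp_space"
  by (simp add: poisson_pp_def)

lemma poisson_pp_prob:
  assumes "poisson_pp M lam N" "A \<in> sets lborel" "bounded A"
  shows "\<P>(\<omega> in M. card (N \<omega> \<inter> A) = n) =
          (lam * measure lborel A) ^ n / fact n * exp (- (lam * measure lborel A))"
  using assms by (simp add: poisson_pp_def)

lemma poisson_pp_measurable_card:
  assumes "poisson_pp M lam N" "A \<in> sets lborel" "bounded A"
  shows "(\<lambda>\<omega>. card (N \<omega> \<inter> A)) \<in> measurable M (count_space UNIV)"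
  using measurable_card_pp assms by (auto simp: poisson_pp_def)

lemma poisson_pp_measurable_radii:
  assumes "poisson_pp M lam N"
  shows "(\<lambda>\<omega>. radii (N \<omega>) i) \<in> borel_measurable M"
  using assms by (intro measurable_radii poisson_pp_measurable poisson_pp_locally_finite)

text \<open>The exponential series at \<open>c * x\<close>, multiplied by \<open>exp (- x)\<close>.
  The sum over the values of the count is taken in \<open>ennreal\<close>, where it may be exchanged
  with the integral without prior integrability.\<close>

lemma poisson_pp_pgf:
  assumes pp: "poisson_pp M lam N" and A: "A \<in> sets lborel" "bounded A" and lam: "0 \<le> lam" and c: "0 \<le> c"
  shows "expectation (\<lambda>\<omega>. c ^ card (N \<omega> \<inter> A)) = exp (- (lam * measure lborel A * (1 - c)))"
proof -
  define x where "x = lam * measure lborel A"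
  have x: "0 \<le> x" using lam by (simp add: x_def)
  note [measurable] = poisson_pp_measurable_card[OF pp A]
  have sums: "(\<lambda>n. c ^ n * (x ^ n / fact n * exp (- x))) sums exp (- (x * (1 - c)))"
  proof -
    have "(\<lambda>n. (c * x) ^ n /\<^sub>R fact n * exp (- x)) sums (exp (c * x) * exp (- x))"
      by (intro sums_mult2 exp_converges)
    then show ?thesis
      by (simp add: power_mult_distrib divide_inverse algebra_simps flip: exp_add)
  qed
  have "(\<integral>\<^sup>+\<omega>. ennreal (c ^ card (N \<omega> \<inter> A)) \<partial>M) = (\<integral>\<^sup>+\<omega>. (\<Sum>n. ennreal (c ^ n) * indicator {\<omega>\<in>space M. card (N \<omega> \<inter> A) = n} \<omega>) \<partial>M)"
  proof (rule nn_integral_cong)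
    fix \<omega> assume w: "\<omega> \<in> space M"
    have "(\<lambda>n. ennreal (c ^ n) * indicator {\<omega>\<in>space M. card (N \<omega> \<inter> A) = n} \<omega>) = (\<lambda>n. if n = card (N \<omega> \<inter> A) then ennreal (c ^ n) else 0)"
      using w by (auto split: split_indicator)
    then show "ennreal (c ^ card (N \<omega> \<inter> A)) = (\<Sum>n. ennreal (c ^ n) * indicator {\<omega>\<in>space M. card (N \<omega> \<inter> A) = n} \<omega>)"
      using sums_unique[OF sums_single[of "card (N \<omega> \<inter> A)" "\<lambda>n. ennreal (c ^ n)"]] by simp
  qed
  also have "\<dots> = (\<Sum>n. ennreal (c ^ n) * emeasure M {\<omega>\<in>space M. card (N \<omega> \<inter> A) = n})"
    by (subst nn_integral_suminf) (auto simp: nn_integral_cmult_indicator)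
  also have "\<dots> = (\<Sum>n. ennreal (c ^ n * (x ^ n / fact n * exp (- x))))"
    using c x by (simp add: emeasure_eq_measure poisson_pp_prob[OF pp A] x_def ennreal_mult[symmetric] mult_ac)
  also have "\<dots> = ennreal (exp (- (x * (1 - c))))"
    using sums x c by (subst suminf_ennreal2) (auto simp: sums_iff)
  finally have "expectation (\<lambda>\<omega>. c ^ card (N \<omega> \<inter> A)) = exp (- (x * (1 - c)))"
    using c by (intro integral_eq_nn_integral[THEN trans]) auto
  then show ?thesis by (simp add: x_def)
qed

lemma poisson_pp_pgf_prod:
  fixes A :: "nat \<Rightarrow> pt set"
  assumes pp: "poisson_pp M lam N" and I: "finite I" "\<And>i. i \<in> I \<Longrightarrow> A i \<in> sets lborel" "\<And>i. i \<in> I \<Longrightarrow> bounded (A i)"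
    "disjoint_family_on A I" and lam: "0 \<le> lam" and c: "\<And>i. i \<in> I \<Longrightarrow> 0 \<le> c i" "\<And>i. i \<in> I \<Longrightarrow> c i \<le> 1"
  shows "expectation (\<lambda>\<omega>. \<Prod>i\<in>I. c i ^ card (N \<omega> \<inter> A i)) = exp (- lam * (\<Sum>i\<in>I. measure lborel (A i) * (1 - c i)))"
proof -
  have "indep_vars (\<lambda>_. count_space UNIV) (\<lambda>i \<omega>. card (N \<omega> \<inter> A i)) I"
    using pp I by (auto simp: poisson_pp_def)
  then have ind: "indep_vars (\<lambda>_. borel) (\<lambda>i \<omega>. c i ^ card (N \<omega> \<inter> A i)) I"
    by (rule indep_vars_compose2) auto
  have rv: "integrable M (\<lambda>\<omega>. c i ^ card (N \<omega> \<inter> A i))" if i: "i \<in> I" for i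
  proof (rule integrable_const_bound[where B=1])
    note [measurable] = poisson_pp_measurable_card[OF pp I(2,3)[OF i]]
    show "(\<lambda>\<omega>. c i ^ card (N \<omega> \<inter> A i)) \<in> borel_measurable M" by measurable
  qed (use c i in \<open>auto simp: power_le_one\<close>)
  have "expectation (\<lambda>\<omega>. \<Prod>i\<in>I. c i ^ card (N \<omega> \<inter> A i)) = (\<Prod>i\<in>I. expectation (\<lambda>\<omega>. c i ^ card (N \<omega> \<inter> A i)))"
    by (rule indep_vars_lebesgue_integral[OF I(1) ind rv])
  also have "\<dots> = (\<Prod>i\<in>I. exp (- (lam * measure lborel (A i) * (1 - c i))))"
    by (intro prod.cong refl poisson_pp_pgf[OF pp]) (use I lam c in auto)
  also have "\<dots> = exp (- lam * (\<Sum>i\<in>I. measure lborel (A i) * (1 - c i)))"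
    using I(1) by (simp add: exp_sum[symmetric] sum_distrib_left sum_negf algebra_simps)
  finally show ?thesis .
qed

text \<open>The level sets of \<open>v\<close> cut \<open>D\<close> into finitely many disjoint
  bounded sets on which the factor is constant, so the product over points becomes a product of
  powers of independent counts.\<close>

lemma poisson_pp_pgfl_simple:
  fixes v :: "pt \<Rightarrow> real"
  assumes pp: "poisson_pp M lam N" and D: "D \<in> sets lborel" "bounded D" and lam: "0 \<le> lam"
    and v: "simple_function borel v" "\<And>x. 0 \<le> v x" "\<And>x. v x \<le> 1"
  shows "(\<lambda>\<omega>. \<Prod>x\<in>N \<omega> \<inter> D. v x) \<in> borel_measurable M" (is ?m)
    and "expectation (\<lambda>\<omega>. \<Prod>x\<in>N \<omega> \<inter> D. v x) = exp (- lam * (LINT x:D|lborel. 1 - v x))" (is ?e)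
proof -
  have fin: "finite (range v)"
    using v(1) by (simp add: simple_function_def)
  from ex_bij_betw_nat_finite[OF this] obtain c where c: "bij_betw c {0..<card (range v)} (range v)" ..
  define I where "I = {0..<card (range v)}"
  define A where "A i = D \<inter> v -` {c i}" for i
  have cI: "c i = c j \<Longrightarrow> i = j" if "i \<in> I" "j \<in> I" for i j
    using c that by (auto simp: bij_betw_def I_def dest: inj_onD)
  have vc: "v x \<in> c ` I" for x
    using c by (auto simp: bij_betw_def I_def)
  have [measurable]: "v \<in> borel_measurable borel"
    using v(1) by (rule borel_measurable_simple_function)
  have A: "A i \<in> sets lborel" "bounded (A i)" for i
    unfolding A_def using D by (auto intro: bounded_subset)
  have disj: "disjoint_family_on A I"
    using cI by (auto simp: disjoint_family_on_def A_def)
  have c01: "0 \<le> c i" "c i \<le> 1" if "i \<in> I" for i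
  proof -
    have "c i \<in> range v" using c that by (auto simp: bij_betw_def I_def)
    then show "0 \<le> c i" "c i \<le> 1" using v by auto
  qed
  have eq: "(\<Prod>x\<in>N \<omega> \<inter> D. v x) = (\<Prod>i\<in>I. c i ^ card (N \<omega> \<inter> A i))" if "\<omega> \<in> space M" for \<omega>
  proof -
    have f: "finite (N \<omega> \<inter> D)"
      using poisson_pp_locally_finite[OF pp that] D(2) by (rule locally_finiteD)
    have "(\<Prod>x\<in>N \<omega> \<inter> D. v x) = (\<Prod>x\<in>(\<Union>i\<in>I. N \<omega> \<inter> A i). v x)"
      using vc by (intro prod.cong) (auto simp: A_def image_iff)
    also have "\<dots> = (\<Prod>i\<in>I. \<Prod>x\<in>N \<omega> \<inter> A i. v x)"
      using disj by (intro prod.UNION_disjoint)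
        (auto simp: I_def A_def disjoint_family_on_def intro: finite_subset[OF _ f])
    also have "\<dots> = (\<Prod>i\<in>I. c i ^ card (N \<omega> \<inter> A i))"
      by (intro prod.cong refl) (simp add: A_def)
    finally show ?thesis .
  qed
  note [measurable] = poisson_pp_measurable_card[OF pp A]
  have "(\<lambda>\<omega>. \<Prod>i\<in>I. c i ^ card (N \<omega> \<inter> A i)) \<in> borel_measurable M"
    by measurable
  then show ?m
    by (subst measurable_cong[OF eq]) auto
  have "expectation (\<lambda>\<omega>. \<Prod>x\<in>N \<omega> \<inter> D. v x) = expectation (\<lambda>\<omega>. \<Prod>i\<in>I. c i ^ card (N \<omega> \<inter> A i))"
    by (rule Bochner_Integration.integral_cong[OF refl eq])
  also have "\<dots> = exp (- lam * (\<Sum>i\<in>I. measure lborel (A i) * (1 - c i)))"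
    by (rule poisson_pp_pgf_prod[OF pp _ A disj lam c01]) (auto simp: I_def)
  also have "(\<Sum>i\<in>I. measure lborel (A i) * (1 - c i)) = (LINT x|lborel. (\<Sum>i\<in>I. indicator (A i) x *\<^sub>R (1 - c i)))"
    using A by (subst Bochner_Integration.integral_sum)
      (auto simp: emeasure_bounded_finite[simplified] intro!: integrable_mult_left integrable_real_indicator)
  also have "\<dots> = (LINT x:D|lborel. 1 - v x)"
    unfolding set_lebesgue_integral_def
  proof (intro Bochner_Integration.integral_cong refl)
    fix x
    obtain j where j: "j \<in> I" "v x = c j" using vc[of x] by auto
    have "(\<Sum>i\<in>I. indicator (A i) x *\<^sub>R (1 - c i)) = (\<Sum>i\<in>I. if i = j then indicator D x *\<^sub>R (1 - c i) else 0)"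
      by (intro sum.cong refl) (use j cI in \<open>auto simp: A_def split: split_indicator\<close>)
    then show "(\<Sum>i\<in>I. indicator (A i) x *\<^sub>R (1 - c i)) = indicator D x *\<^sub>R (1 - v x)"
      using j by (simp add: I_def)
  qed
  finally show ?e .
qed

text \<open>Simple functions converging pointwise to \<open>v\<close> carry the formula over, by
  dominated convergence in the expectation and in the exponent; boundedness of \<open>D\<close>
  supplies the integrable bound in the exponent.\<close>

lemma poisson_pp_pgfl:
  fixes v :: "pt \<Rightarrow> real"
  assumes pp: "poisson_pp M lam N" and D: "D \<in> sets lborel" "bounded D" and lam: "0 \<le> lam"
    and v: "v \<in> borel_measurable borel" "\<And>x. 0 \<le> v x" "\<And>x. v x \<le> 1"
  shows "(\<lambda>\<omega>. \<Prod>x\<in>N \<omega> \<inter> D. v x) \<in> borel_measurable M" (is ?m)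
    and "expectation (\<lambda>\<omega>. \<Prod>x\<in>N \<omega> \<inter> D. v x) = exp (- lam * (LINT x:D|lborel. 1 - v x))" (is ?e)
proof -
  obtain F where F: "\<And>i. simple_function borel (F i)" "\<And>x. (\<lambda>i. F i x) \<longlonglongrightarrow> v x"
    using borel_measurable_implies_sequence_metric[OF v(1), of 0] by auto
  \<comment> \<open>The approximants need not stay in \<open>[0, 1]\<close>. Clamping puts them
    there and keeps the limit, since \<open>v\<close> takes its values in this interval.\<close>
  define G where "G i x = max 0 (min 1 (F i x))" for i x
  have G: "simple_function borel (G i)" "0 \<le> G i x" "G i x \<le> 1" for i x
    unfolding G_def by (auto intro!: F(1) simple_function_compose1[of borel "F i" "\<lambda>y. max 0 (min 1 y)"])
  have [measurable]: "G i \<in> borel_measurable borel" for i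
    using G(1) by (rule borel_measurable_simple_function)
  have "(\<lambda>i. max 0 (min 1 (F i x))) \<longlonglongrightarrow> max 0 (min 1 (v x))" for x
    by (intro tendsto_intros F)
  moreover have "max 0 (min 1 (v x)) = v x" for x
    using v(2,3)[of x] by simp
  ultimately have Gv: "(\<lambda>i. G i x) \<longlonglongrightarrow> v x" for x
    unfolding G_def by metis
  have lim: "(\<lambda>i. \<Prod>x\<in>N \<omega> \<inter> D. G i x) \<longlonglongrightarrow> (\<Prod>x\<in>N \<omega> \<inter> D. v x)" for \<omega>
    by (intro tendsto_prod Gv)
  show m: ?m
    by (rule borel_measurable_LIMSEQ_real[OF lim]) (rule poisson_pp_pgfl_simple(1)[OF pp D lam G])
  have "(\<lambda>i. expectation (\<lambda>\<omega>. \<Prod>x\<in>N \<omega> \<inter> D. G i x)) \<longlonglongrightarrow> expectation (\<lambda>\<omega>. \<Prod>x\<in>N \<omega> \<inter> D. v x)"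
    by (rule integral_dominated_convergence[where w="\<lambda>_. 1"])
      (use lim m G in \<open>auto intro!: poisson_pp_pgfl_simple(1)[OF pp D lam] prod_le_1 simp: prod_nonneg abs_of_nonneg\<close>)
  moreover have "(\<lambda>i. LINT x:D|lborel. 1 - G i x) \<longlonglongrightarrow> (LINT x:D|lborel. 1 - v x)"
    unfolding set_lebesgue_integral_def
  proof (rule integral_dominated_convergence[where w="indicator D"])
    show "integrable lborel (indicator D :: pt \<Rightarrow> real)"
      using D by (intro integrable_real_indicator) (auto simp: emeasure_bounded_finite[simplified])
    show "AE x in lborel. (\<lambda>i. indicator D x *\<^sub>R (1 - G i x)) \<longlonglongrightarrow> indicator D x *\<^sub>R (1 - v x)"
      by (intro AE_I2 tendsto_intros Gv)
    show "AE x in lborel. norm (indicator D x *\<^sub>R (1 - G i x)) \<le> indicator D x" for i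
      using G(2,3) by (auto split: split_indicator)
  qed (use D v(1) in auto)
  then have "(\<lambda>i. exp (- lam * (LINT x:D|lborel. 1 - G i x))) \<longlonglongrightarrow> exp (- lam * (LINT x:D|lborel. 1 - v x))"
    by (intro tendsto_intros)
  moreover have "expectation (\<lambda>\<omega>. \<Prod>x\<in>N \<omega> \<inter> D. G i x) = exp (- lam * (LINT x:D|lborel. 1 - G i x))" for i
    by (rule poisson_pp_pgfl_simple(2)[OF pp D lam G])
  ultimately show ?e
    by (simp add: LIMSEQ_unique)
qed

end

section \<open>Infinite products along the radii\<close>

definition pfactor :: "(real \<Rightarrow> real) \<Rightarrow> real \<Rightarrow> real" where
  "pfactor w y = (if y < 0 then 1 else w y)"

text \<open>Through \<open>pfactor\<close> a missing point has the neutral factor, so finite and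
  infinite configurations are treated alike. A plain limit of partial products is taken because the
  value \<open>0\<close> must be allowed: it encodes a violated exclusion.\<close>

definition rprod :: "(real \<Rightarrow> real) \<Rightarrow> (nat \<Rightarrow> real) \<Rightarrow> real" where
  "rprod w R = lim (\<lambda>n. \<Prod>i<n. pfactor w (R i))"

lemma LIMSEQ_prod_01:
  fixes f :: "nat \<Rightarrow> real"
  assumes "\<And>i. 0 \<le> f i" "\<And>i. f i \<le> 1"
  shows "(\<lambda>n. \<Prod>i<n. f i) \<longlonglongrightarrow> lim (\<lambda>n. \<Prod>i<n. f i)"
    and "0 \<le> lim (\<lambda>n. \<Prod>i<n. f i)" "lim (\<lambda>n. \<Prod>i<n. f i) \<le> (\<Prod>i<n. f i)"
    and "(\<Prod>i<n. f i) \<le> 1"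
proof -
  have nn: "0 \<le> (\<Prod>i<n. f i)" for n
    using assms(1) by (simp add: prod_nonneg)
  have dec: "decseq (\<lambda>n. \<Prod>i<n. f i)"
    by (rule decseq_SucI) (use assms nn in \<open>simp add: mult_left_le\<close>)
  then have "convergent (\<lambda>n. \<Prod>i<n. f i)"
    using nn by (intro Bseq_monoseq_convergent decseq_bounded decseq_imp_monoseq) auto
  then show lim: "(\<lambda>n. \<Prod>i<n. f i) \<longlonglongrightarrow> lim (\<lambda>n. \<Prod>i<n. f i)"
    by (simp add: convergent_LIMSEQ_iff)
  show "0 \<le> lim (\<lambda>n. \<Prod>i<n. f i)"
    by (rule LIMSEQ_le_const[OF lim]) (use nn in auto)
  show "lim (\<lambda>n. \<Prod>i<n. f i) \<le> (\<Prod>i<n. f i)"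
    by (rule decseq_ge[OF dec lim])
  show "(\<Prod>i<n. f i) \<le> 1"
    using assms by (intro prod_le_1) auto
qed

lemma
  assumes "\<And>y. 0 \<le> w y" "\<And>y. w y \<le> 1"
  shows rprod_LIMSEQ: "(\<lambda>n. \<Prod>i<n. pfactor w (R i)) \<longlonglongrightarrow> rprod w R"
    and rprod_nonneg: "0 \<le> rprod w R"
    and rprod_le_prod: "rprod w R \<le> (\<Prod>i<n. pfactor w (R i))"
    and rprod_le_1: "rprod w R \<le> 1"
proof -
  have *: "0 \<le> pfactor w (R i)" "pfactor w (R i) \<le> 1" for i
    using assms by (auto simp: pfactor_def)
  note L = LIMSEQ_prod_01[of "\<lambda>i. pfactor w (R i)", OF *]
  show "(\<lambda>n. \<Prod>i<n. pfactor w (R i)) \<longlonglongrightarrow> rprod w R" "0 \<le> rprod w R"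
    "rprod w R \<le> (\<Prod>i<n. pfactor w (R i))"
    unfolding rprod_def using L by auto
  show "rprod w R \<le> 1"
    unfolding rprod_def using order_trans[OF L(3)[of 0]] by simp
qed

text \<open>The products over balls are partial products \<open>P (c m)\<close> of a decreasing
  sequence, whether \<open>S\<close> is finite or not. They stay above the limit and eventually fall
  below each \<open>P n\<close>: once the ball holds every present point of index below
  \<open>n\<close>, the remaining indices below \<open>n\<close> are absent and contribute
  \<open>1\<close>.\<close>

lemma rprod_cball_LIMSEQ:
  assumes lf: "locally_finite S" and w: "\<And>y. 0 \<le> w y" "\<And>y. w y \<le> 1"
  shows "(\<lambda>m::nat. \<Prod>x\<in>S \<inter> cball 0 (real m). w (norm x)) \<longlonglongrightarrow> rprod w (radii S)"
proof -
  define c where "c m = card (S \<inter> cball 0 (real m))" for m :: nat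
  define P where "P n = (\<Prod>i<n. pfactor w (radii S i))" for n
  have present: "\<not> radii S i < 0" if "i < card (S \<inter> cball 0 r)" for i r
    using radii_le_iff[OF lf, of i r] that by simp
  have eq: "(\<Prod>x\<in>S \<inter> cball 0 (real m). w (norm x)) = P (c m)" for m
    unfolding prod_radii_cball[OF lf] P_def c_def
    by (intro prod.cong refl) (use present in \<open>auto simp: pfactor_def\<close>)
  have f: "0 \<le> pfactor w (radii S i)" "pfactor w (radii S i) \<le> 1" for i
    using w by (auto simp: pfactor_def)
  have P: "P \<longlonglongrightarrow> rprod w (radii S)" "rprod w (radii S) \<le> P n" for n
    unfolding P_def using rprod_LIMSEQ[OF w] rprod_le_prod[OF w] by auto
  have bound: "\<exists>m0. \<forall>m\<ge>m0. P (c m) \<le> P n" for n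
  proof -
    obtain b where b: "\<And>i. i < n \<Longrightarrow> radii S i \<le> b"
      using bdd_above_finite[of "radii S ` {..<n}"] by (auto simp: bdd_above_def)
    obtain m0 :: nat where m0: "b \<le> real m0"
      using real_arch_simple by blast
    have "P (c m) \<le> P n" if "m \<ge> m0" for m
    proof -
      have i: "i < c m" if "i < n" "0 \<le> radii S i" for i
        using radii_le_iff[OF lf, of i "real m"] b[OF that(1)] that m0 \<open>m \<ge> m0\<close> by (simp add: c_def)
      \<comment> \<open>Both prefixes are compared with the longer one: extending \<open>n\<close>
        can only decrease the product, while extending \<open>c m\<close> adds factors of absent
        points only.\<close>
      have "P (max n (c m)) = P n * (\<Prod>i\<in>{n..<max n (c m)}. pfactor w (radii S i))"
        unfolding P_def using prod.atLeastLessThan_concat[of 0 n "max n (c m)" "\<lambda>i. pfactor w (radii S i)"]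
        by (simp add: lessThan_atLeast0)
      also have "\<dots> \<le> P n * 1"
        using f by (intro mult_left_mono prod_le_1) (auto simp: P_def intro!: prod_nonneg)
      also have "P (max n (c m)) = P (c m)"
        unfolding P_def
      proof (rule prod.mono_neutral_right)
        show "\<forall>i\<in>{..<max n (c m)} - {..<c m}. pfactor w (radii S i) = 1"
        proof
          fix j assume "j \<in> {..<max n (c m)} - {..<c m}"
          then show "pfactor w (radii S j) = 1"
            using i[of j] by (auto simp: pfactor_def less_max_iff_disj)
        qed
      qed auto
      finally show ?thesis by simp
    qed
    then show ?thesis by blast
  qed
  show ?thesis
    unfolding eq
  proof (rule decreasing_tendsto)
    show "\<forall>\<^sub>F m in sequentially. rprod w (radii S) \<le> P (c m)"
      using P(2) by simp
    fix x assume "rprod w (radii S) < x"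
    then have "\<forall>\<^sub>F n in sequentially. P n < x"
      using P(1) by (rule order_tendstoD(2)[rotated])
    then obtain n where n: "P n < x"
      by (auto simp: eventually_sequentially)
    then show "\<forall>\<^sub>F m in sequentially. P (c m) < x"
      using bound[of n] by (auto simp: eventually_sequentially intro: le_less_trans)
  qed
qed

context prob_space
begin

text \<open>Growing balls exhaust the plane, and integrability of \<open>1 - w\<close> allows the
  limit in the exponent. The argument \<open>sqrt u\<close> appears because \<open>u\<close> is the
  squared distance.\<close>

lemma poisson_pp_pgfl_radial:
  assumes pp: "poisson_pp M lam N" and lam: "0 \<le> lam"
    and w: "w \<in> borel_measurable borel" "\<And>y. 0 \<le> w y" "\<And>y. w y \<le> 1"
    and int: "set_integrable lborel {0<..} (\<lambda>u. 1 - w (sqrt u))"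
  shows "(\<lambda>\<omega>. rprod w (radii (N \<omega>))) \<in> borel_measurable M" (is ?m)
    and "expectation (\<lambda>\<omega>. rprod w (radii (N \<omega>))) = exp (- (lam * pi * (LINT u:{0<..}|lborel. 1 - w (sqrt u))))" (is ?e)
proof -
  note [measurable] = w(1)
  have mw: "(\<lambda>x::pt. w (norm x)) \<in> borel_measurable borel"
    by measurable
  note pgfl = poisson_pp_pgfl[OF pp _ _ lam mw w(2,3), of "cball 0 (real m)" for m]
  have lim: "(\<lambda>m::nat. \<Prod>x\<in>N \<omega> \<inter> cball 0 (real m). w (norm x)) \<longlonglongrightarrow> rprod w (radii (N \<omega>))" if "\<omega> \<in> space M" for \<omega>
    using poisson_pp_locally_finite[OF pp that] w(2,3) by (rule rprod_cball_LIMSEQ)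
  show m: ?m
    by (rule borel_measurable_LIMSEQ_real[OF lim]) (auto intro!: pgfl)
  have "(\<lambda>m. expectation (\<lambda>\<omega>. \<Prod>x\<in>N \<omega> \<inter> cball 0 (real m). w (norm x))) \<longlonglongrightarrow> expectation (\<lambda>\<omega>. rprod w (radii (N \<omega>)))"
    by (rule integral_dominated_convergence[where w="\<lambda>_. 1"])
      (use m w in \<open>auto intro!: pgfl(1) prod_le_1 AE_I2 lim simp: prod_nonneg abs_of_nonneg\<close>)
  also have "(\<lambda>m. expectation (\<lambda>\<omega>. \<Prod>x\<in>N \<omega> \<inter> cball 0 (real m). w (norm x))) =
     (\<lambda>m. exp (- (lam * pi * (LINT u:{0<..}|lborel. indicator {..(real m)\<^sup>2} u * (1 - w (sqrt u))))))"
  proof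
    fix m :: nat
    have iff: "x \<in> cball 0 (real m) \<longleftrightarrow> (norm x)\<^sup>2 \<le> (real m)\<^sup>2" for x :: pt
      by (simp add: power_mono_iff)
    have "(LINT x:cball 0 (real m)|(lborel :: pt measure). 1 - w (norm x))
       = (LINT x|(lborel :: pt measure). indicator {..(real m)\<^sup>2} ((norm x)\<^sup>2) * (1 - w (sqrt ((norm x)\<^sup>2))))"
      unfolding set_lebesgue_integral_def
      by (intro Bochner_Integration.integral_cong refl) (simp add: indicator_def iff del: mem_cball)
    also have "\<dots> = pi * (LINT u:{0<..}|lborel. indicator {..(real m)\<^sup>2} u * (1 - w (sqrt u)))"
      by (rule integral_radial[where f="\<lambda>u. indicator {..(real m)\<^sup>2} u * (1 - w (sqrt u))"]) measurable
    finally show "expectation (\<lambda>\<omega>. \<Prod>x\<in>N \<omega> \<inter> cball 0 (real m). w (norm x)) =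
      exp (- (lam * pi * (LINT u:{0<..}|lborel. indicator {..(real m)\<^sup>2} u * (1 - w (sqrt u)))))"
      by (simp add: pgfl(2))
  qed
  finally have 1: "(\<lambda>m. exp (- (lam * pi * (LINT u:{0<..}|lborel. indicator {..(real m)\<^sup>2} u * (1 - w (sqrt u)))))) \<longlonglongrightarrow> expectation (\<lambda>\<omega>. rprod w (radii (N \<omega>)))" .
  have "(\<lambda>m. (LINT u:{0<..}|lborel. indicator {..(real m)\<^sup>2} u * (1 - w (sqrt u)))) \<longlonglongrightarrow> (LINT u:{0<..}|lborel. 1 - w (sqrt u))"
    unfolding set_lebesgue_integral_def
  proof (rule integral_dominated_convergence[where w="\<lambda>u. indicator {0<..} u *\<^sub>R (1 - w (sqrt u))"])
    show "AE u in lborel. (\<lambda>m::nat. indicator {0<..} u *\<^sub>R (indicator {..(real m)\<^sup>2} u * (1 - w (sqrt u)))) \<longlonglongrightarrow> indicator {0<..} u *\<^sub>R (1 - w (sqrt u))"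
    proof (rule AE_I2)
      fix u :: real
      \<comment> \<open>The bound \<open>1\<close> makes squaring harmless:
        \<open>u \<le> real m \<le> (real m)\<^sup>2\<close>.\<close>
      obtain m0 :: nat where m0: "max 1 u \<le> real m0"
        using real_arch_simple by blast
      have "u \<le> (real m)\<^sup>2" if "m \<ge> m0" for m
      proof -
        have "u \<le> real m" "1 \<le> real m" using m0 that by auto
        then show ?thesis
          using mult_mono[of 1 "real m" u "real m"] by (cases "u \<ge> 0") (auto simp: power2_eq_square intro: order_trans[OF _ mult_nonneg_nonneg])
      qed
      then have "\<forall>\<^sub>F m in sequentially. indicator {0<..} u *\<^sub>R (indicator {..(real m)\<^sup>2} u * (1 - w (sqrt u))) = indicator {0<..} u *\<^sub>R (1 - w (sqrt u))"
        unfolding eventually_sequentially by (intro exI[of _ m0] allI impI) simp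
      then show "(\<lambda>m::nat. indicator {0<..} u *\<^sub>R (indicator {..(real m)\<^sup>2} u * (1 - w (sqrt u)))) \<longlonglongrightarrow> indicator {0<..} u *\<^sub>R (1 - w (sqrt u))"
        by (rule tendsto_eventually)
    qed
    show "integrable lborel (\<lambda>u. indicator {0<..} u *\<^sub>R (1 - w (sqrt u)))"
      using int by (simp add: set_integrable_def)
  qed (use w in \<open>auto split: split_indicator\<close>)
  then have "(\<lambda>m. exp (- (lam * pi * (LINT u:{0<..}|lborel. indicator {..(real m)\<^sup>2} u * (1 - w (sqrt u)))))) \<longlonglongrightarrow> exp (- (lam * pi * (LINT u:{0<..}|lborel. 1 - w (sqrt u))))"
    by (intro tendsto_intros)
  with 1 show ?e
    by (rule LIMSEQ_unique)
qed

section \<open>Almost sure properties of the radii: presence, positivity, distinctness\<close>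

lemma AE_poisson_pp_present:
  assumes pp: "poisson_pp M lam N" and lam: "0 < lam"
  shows "AE \<omega> in M. \<forall>i. 0 \<le> radii (N \<omega>) i"
proof (subst AE_all_countable, rule allI)
  fix i
  note [measurable] = poisson_pp_measurable_radii[OF pp] poisson_pp_measurable_card[OF pp]
  \<comment> \<open>\<open>x m\<close> is the mean count in the disc of radius \<open>m\<close>. As
    it tends to infinity, having at most \<open>i\<close> points there has vanishing probability,
    since the exponential beats every power.\<close>
  define x where "x m = lam * (pi * (real m)\<^sup>2)" for m :: nat
  have "\<P>(\<omega> in M. radii (N \<omega>) i < 0) \<le> (\<Sum>n\<le>i. x m ^ n / fact n * exp (- x m))" for m
  proof -
    have meas: "measure lborel (cball 0 (real m) :: pt set) = pi * (real m)\<^sup>2"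
      by (simp add: content_cball unit_ball_vol_numeral fact_numeral)
    have "\<P>(\<omega> in M. radii (N \<omega>) i < 0) \<le> \<P>(\<omega> in M. \<exists>n\<in>{..i}. card (N \<omega> \<inter> cball 0 (real m)) = n)"
    proof (rule finite_measure_mono)
      show "{\<omega> \<in> space M. radii (N \<omega>) i < 0} \<subseteq> {\<omega> \<in> space M. \<exists>n\<in>{..i}. card (N \<omega> \<inter> cball 0 (real m)) = n}"
        using radii_le_iff[OF poisson_pp_locally_finite[OF pp], of _ i "real m"] by (auto simp: not_less[symmetric])
    qed measurable
    also have "\<dots> = measure M (\<Union>n\<in>{..i}. {\<omega> \<in> space M. card (N \<omega> \<inter> cball 0 (real m)) = n})"
      by (intro arg_cong[where f="measure M"]) auto
    also have "\<dots> \<le> (\<Sum>n\<le>i. \<P>(\<omega> in M. card (N \<omega> \<inter> cball 0 (real m)) = n))"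
      by (rule finite_measure_subadditive_finite) auto
    also have "\<dots> = (\<Sum>n\<le>i. x m ^ n / fact n * exp (- x m))"
      by (subst poisson_pp_prob[OF pp]) (auto simp: x_def meas)
    finally show ?thesis .
  qed
  moreover have "(\<lambda>m. \<Sum>n\<le>i. x m ^ n / fact n * exp (- x m)) \<longlonglongrightarrow> (\<Sum>n\<le>i. 0 / fact n)"
  proof (rule tendsto_sum)
    fix n
    have "filterlim x at_top sequentially"
      unfolding x_def
      by (intro filterlim_tendsto_pos_mult_at_top[OF tendsto_const lam] filterlim_tendsto_pos_mult_at_top[OF tendsto_const pi_gt_zero]
        filterlim_pow_at_top filterlim_real_sequentially) simp
    from filterlim_compose[OF tendsto_power_div_exp_0 this, of n]
    have "(\<lambda>m. (x m ^ n / exp (x m)) / fact n) \<longlonglongrightarrow> 0 / fact n"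
      by (intro tendsto_divide tendsto_const) auto
    then show "(\<lambda>m. x m ^ n / fact n * exp (- x m)) \<longlonglongrightarrow> 0 / fact n"
      by (simp add: exp_minus divide_inverse mult_ac)
  qed
  ultimately have "\<P>(\<omega> in M. radii (N \<omega>) i < 0) \<le> (\<Sum>n\<le>i. 0 / fact n)"
    by (intro LIMSEQ_le_const) auto
  then have "\<P>(\<omega> in M. radii (N \<omega>) i < 0) = 0"
    by (simp add: measure_le_0_iff)
  then have "AE \<omega> in M. \<not> radii (N \<omega>) i < 0"
    by (subst (asm) prob_eq_0) auto
  then show "AE \<omega> in M. 0 \<le> radii (N \<omega>) i"
    by eventually_elim simp
qed

text \<open>The singleton \<open>{0}\<close> has area zero, hence almost surely count zero, and it
  is the ball of radius \<open>0\<close>.\<close>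

lemma AE_poisson_pp_nonzero:
  assumes pp: "poisson_pp M lam N"
  shows "AE \<omega> in M. \<forall>i. radii (N \<omega>) i \<noteq> 0"
proof -
  note [measurable] = poisson_pp_measurable_card[OF pp]
  have "\<P>(\<omega> in M. card (N \<omega> \<inter> {0}) = 0) = 1"
    by (subst poisson_pp_prob[OF pp]) auto
  then have "AE \<omega> in M. card (N \<omega> \<inter> {0}) = 0"
    by (subst (asm) prob_eq_1, measurable)
  moreover have "AE \<omega> in M. \<omega> \<in> space M" by simp
  ultimately show ?thesis
  proof eventually_elim
    fix \<omega> assume w: "card (N \<omega> \<inter> {0}) = 0" "\<omega> \<in> space M"
    have "cball 0 0 = {0::pt}" by auto
    then show "\<forall>i. radii (N \<omega>) i \<noteq> 0"
      using radii_le_iff[OF poisson_pp_locally_finite[OF pp w(2)], of _ 0] w(1) by (metis less_nat_zero_code order_refl)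
  qed
qed

text \<open>A disc is cut into \<open>n\<close> annuli of equal area. Two neighbouring radii that
  agree put two points into one annulus, which has probability at most \<open>(C / n)^2\<close> for
  each annulus, and \<open>n * (C / n)^2\<close> tends to \<open>0\<close>.\<close>

lemma AE_poisson_pp_distinct:
  assumes pp: "poisson_pp M lam N" and lam: "0 \<le> lam"
  shows "AE \<omega> in M. \<forall>i. 0 < radii (N \<omega>) i \<longrightarrow> radii (N \<omega>) i \<noteq> radii (N \<omega>) (Suc i)"
proof -
  note [measurable] = poisson_pp_measurable_radii[OF pp] poisson_pp_measurable_card[OF pp]
  define T where "T m = {\<omega>\<in>space M. \<exists>i. 0 < radii (N \<omega>) i \<and> radii (N \<omega>) i = radii (N \<omega>) (Suc i) \<and> radii (N \<omega>) i \<le> real m}" for m :: nat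
  have T[measurable]: "T m \<in> sets M" for m
    unfolding T_def by measurable
  have "prob (T m) = 0" for m
  proof -
    define A where "A n j = {x::pt. real j * (real m)\<^sup>2 / real n < (norm x)\<^sup>2 \<and> (norm x)\<^sup>2 \<le> real (Suc j) * (real m)\<^sup>2 / real n}" for n j
    have A[measurable]: "A n j \<in> sets lborel" "bounded (A n j)" for n j
      unfolding A_def by (measurable, rule bounded_annulus)
    \<comment> \<open>The mean number of points in the disc of radius \<open>m\<close>.\<close>
    define C where "C = lam * pi * (real m)\<^sup>2"
    have C: "lam * measure lborel (A n j) = C / real n" if "n > 0" for n j
      unfolding A_def using that
      by (subst measure_annulus) (auto simp: C_def field_simps add_divide_distrib[symmetric])
    have cov: "T m \<subseteq> (\<Union>j\<in>{..<n}. {\<omega>\<in>space M. 2 \<le> card (N \<omega> \<inter> A n j)})" if n: "n > 0" for n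
    proof
      fix \<omega> assume "\<omega> \<in> T m"
      then obtain i where w: "\<omega> \<in> space M" and i: "0 < radii (N \<omega>) i" "radii (N \<omega>) i = radii (N \<omega>) (Suc i)" "radii (N \<omega>) i \<le> real m"
        by (auto simp: T_def)
      note lf = poisson_pp_locally_finite[OF pp w]
      obtain p where p: "inj_on p (N \<omega>)" "p ` N \<omega> = {i. 0 \<le> radii (N \<omega>) i}" "\<And>x. x \<in> N \<omega> \<Longrightarrow> radii (N \<omega>) (p x) = norm x"
        using radii_enum[OF lf] by metis
      have "i \<in> p ` N \<omega>" "Suc i \<in> p ` N \<omega>"
        unfolding p(2) using i by auto
      then obtain x y where xy: "x \<in> N \<omega>" "p x = i" "y \<in> N \<omega>" "p y = Suc i"
        by (metis imageE)
      define r where "r = radii (N \<omega>) i"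
      have nr: "norm x = r" "norm y = r" "0 < r" "r \<le> real m" "x \<noteq> y"
        using p(3)[OF xy(1)] p(3)[OF xy(3)] xy i by (auto simp: r_def)
      have m: "0 < real m" using nr by linarith
      \<comment> \<open>\<open>z\<close> is the squared radius in units of the width of one annulus.
        The annuli are open inside and closed outside, so the point at \<open>z\<close> lies in
        number \<open>\<lceil>z\<rceil> - 1\<close>.\<close>
      define z where "z = real n * r\<^sup>2 / (real m)\<^sup>2"
      have z: "0 < z" "z \<le> real n"
      proof -
        show "0 < z" using n nr m by (simp add: z_def)
        have "r\<^sup>2 \<le> (real m)\<^sup>2" using nr by (simp add: power_mono)
        then show "z \<le> real n" using m n by (simp add: z_def field_simps)
      qed
      define j where "j = nat (\<lceil>z\<rceil> - 1)"
      have "1 \<le> \<lceil>z\<rceil>" "\<lceil>z\<rceil> \<le> int n" using z by (auto simp: ceiling_le_iff)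
      then have j: "real j = of_int \<lceil>z\<rceil> - 1" "j < n"
        using n unfolding j_def by linarith+
      then have zj: "real j < z" "z \<le> real (Suc j)"
        by linarith+
      have "r\<^sup>2 = z * (real m)\<^sup>2 / real n"
        using n m by (simp add: z_def)
      then have "real j * (real m)\<^sup>2 / real n < r\<^sup>2" "r\<^sup>2 \<le> real (Suc j) * (real m)\<^sup>2 / real n"
        using zj n m by (auto intro!: divide_strict_right_mono divide_right_mono mult_strict_right_mono mult_right_mono)
      then have "{x, y} \<subseteq> N \<omega> \<inter> A n j"
        using xy nr by (auto simp: A_def)
      then have "card {x, y} \<le> card (N \<omega> \<inter> A n j)"
        using locally_finiteD[OF lf A(2)] by (rule card_mono[rotated])
      then have "2 \<le> card (N \<omega> \<inter> A n j)"
        using nr by simp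
      then show "\<omega> \<in> (\<Union>j\<in>{..<n}. {\<omega>\<in>space M. 2 \<le> card (N \<omega> \<inter> A n j)})"
        using j w by blast
    qed
    have two: "\<P>(\<omega> in M. 2 \<le> card (N \<omega> \<inter> A n j)) \<le> (C / real n)\<^sup>2" if n: "n > 0" for n j
    proof -
      define y where "y = C / real n"
      have y: "0 \<le> y" using lam by (simp add: y_def C_def)
      define Z where "Z k = {\<omega>\<in>space M. card (N \<omega> \<inter> A n j) = k}" for k
      have Z: "Z k \<in> sets M" for k
        unfolding Z_def by measurable
      have "{\<omega>\<in>space M. 2 \<le> card (N \<omega> \<inter> A n j)} = space M - (Z 0 \<union> Z 1)"
        unfolding Z_def by (auto simp: not_le less_2_cases_iff)
      then have "\<P>(\<omega> in M. 2 \<le> card (N \<omega> \<inter> A n j)) = 1 - prob (Z 0 \<union> Z 1)"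
        using Z by (simp add: prob_compl sets.Un)
      also have "prob (Z 0 \<union> Z 1) = prob (Z 0) + prob (Z 1)"
        by (rule finite_measure_Union[OF Z Z]) (auto simp: Z_def)
      also have "\<dots> = \<P>(\<omega> in M. card (N \<omega> \<inter> A n j) = 0) + \<P>(\<omega> in M. card (N \<omega> \<inter> A n j) = 1)"
        by (simp only: Z_def)
      also have "\<dots> = (1 + y) * exp (- y)"
        by (simp only: poisson_pp_prob[OF pp A]) (simp add: C[OF n] y_def algebra_simps)
      \<comment> \<open>The bound \<open>exp (- y) \<ge> 1 - y\<close> leaves
        \<open>1 - (1 + y) * (1 - y)\<close>, which is \<open>y^2\<close>.\<close>
      also have "1 - (1 + y) * exp (- y) \<le> 1 - (1 + y) * (1 - y)"
        using y exp_ge_add_one_self[of "- y"] by (intro diff_left_mono mult_left_mono) auto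
      finally show ?thesis
        by (simp add: y_def power2_eq_square algebra_simps)
    qed
    have "prob (T m) \<le> C\<^sup>2 * (1 / real n)" if n: "n > 0" for n
    proof -
      have "prob (T m) \<le> measure M (\<Union>j\<in>{..<n}. {\<omega>\<in>space M. 2 \<le> card (N \<omega> \<inter> A n j)})"
        by (rule finite_measure_mono[OF cov[OF n]]) auto
      also have "\<dots> \<le> (\<Sum>j<n. \<P>(\<omega> in M. 2 \<le> card (N \<omega> \<inter> A n j)))"
        by (rule finite_measure_subadditive_finite) auto
      also have "\<dots> \<le> (\<Sum>j<n. (C / real n)\<^sup>2)"
        by (intro sum_mono two n)
      also have "\<dots> = C\<^sup>2 * (1 / real n)"
        using n by (simp add: power2_eq_square field_simps)
      finally show ?thesis .
    qed
    moreover have "(\<lambda>n. C\<^sup>2 * (1 / real n)) \<longlonglongrightarrow> C\<^sup>2 * 0"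
      by (intro tendsto_intros lim_1_over_n)
    ultimately have "prob (T m) \<le> C\<^sup>2 * 0"
      by (intro LIMSEQ_le_const) (auto intro!: exI[of _ 1])
    then show ?thesis by (simp add: measure_le_0_iff)
  qed
  then have "AE \<omega> in M. \<forall>m. \<omega> \<notin> T m"
    by (subst AE_all_countable) (auto simp: prob_eq_0[symmetric] T)
  moreover have "AE \<omega> in M. \<omega> \<in> space M" by simp
  ultimately show ?thesis
  proof eventually_elim
    fix \<omega> assume w: "\<forall>m. \<omega> \<notin> T m" "\<omega> \<in> space M"
    show "\<forall>i. 0 < radii (N \<omega>) i \<longrightarrow> radii (N \<omega>) i \<noteq> radii (N \<omega>) (Suc i)"
    proof (intro allI impI notI)
      fix i assume i: "0 < radii (N \<omega>) i" "radii (N \<omega>) i = radii (N \<omega>) (Suc i)"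
      obtain m :: nat where "radii (N \<omega>) i \<le> real m"
        using real_arch_simple by blast
      then have "\<omega> \<in> T m" using i w by (auto simp: T_def)
      then show False using w by auto
    qed
  qed
qed

end

section \<open>Integrals\<close>

text \<open>Change of variables for absolutely integrable functions, carried over to
  \<open>lborel\<close>. The equality of the integrals is unconditional: if one side is not
  integrable, neither is the other, and both integrals are \<open>0\<close> by convention.\<close>

lemma lborel_substitution:
  fixes f g g' :: "real \<Rightarrow> real"
  assumes S: "S \<in> sets borel" "g ` S \<in> sets borel"
    and meas: "f \<in> borel_measurable borel" "g \<in> borel_measurable borel" "g' \<in> borel_measurable borel"
    and der: "\<And>x. x \<in> S \<Longrightarrow> (g has_real_derivative g' x) (at x)" and inj: "inj_on g S"
  shows "set_integrable lborel S (\<lambda>x. \<bar>g' x\<bar> * f (g x)) \<longleftrightarrow> set_integrable lborel (g ` S) f"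
    and "(LINT x:S|lborel. \<bar>g' x\<bar> * f (g x)) = (LINT u:g ` S|lborel. f u)"
proof -
  note [measurable] = S meas
  have leb: "set_integrable lebesgue T h \<longleftrightarrow> set_integrable lborel T h"
    if [measurable]: "T \<in> sets borel" "h \<in> borel_measurable borel" for T and h :: "real \<Rightarrow> real"
    unfolding set_integrable_def by (rule integrable_completion) measurable
  have m: "(\<lambda>x. \<bar>g' x\<bar> * f (g x)) \<in> borel_measurable borel" by measurable
  \<comment> \<open>An equivalence for every candidate value \<open>b\<close>, from which both the
    transfer of integrability and the equality of values follow.\<close>
  have *: "set_integrable lborel S (\<lambda>x. \<bar>g' x\<bar> * f (g x)) \<and> integral S (\<lambda>x. \<bar>g' x\<bar> * f (g x)) = b
     \<longleftrightarrow> set_integrable lborel (g ` S) f \<and> integral (g ` S) f = b" for b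
    using has_absolute_integral_change_of_variables_1'[of S g g' f b] S der inj
    by (auto simp: leb[OF S(1) m] leb[OF S(2) meas(1)] has_field_derivative_at_within)
  show iff: "set_integrable lborel S (\<lambda>x. \<bar>g' x\<bar> * f (g x)) \<longleftrightarrow> set_integrable lborel (g ` S) f"
    using * by blast
  show "(LINT x:S|lborel. \<bar>g' x\<bar> * f (g x)) = (LINT u:g ` S|lborel. f u)"
  proof (cases "set_integrable lborel (g ` S) f")
    case True
    then show ?thesis
      using * iff by (simp add: set_borel_integral_eq_integral(2))
  next
    case False
    then show ?thesis
      using iff by (simp add: set_lebesgue_integral_def set_integrable_def not_integrable_integral_eq)
  qed
qed

lemma integral_exponential_density:
  assumes A: "0 < (A::real)"
  shows "(LINT u|lborel. exponential_density A u) = 1"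
proof -
  interpret E: prob_space "density lborel (exponential_density A)"
    using A by (rule prob_space_exponential_density)
  have "(\<integral>\<^sup>+x. ennreal (exponential_density A x) \<partial>lborel) = 1"
    using E.emeasure_space_1 by (simp add: emeasure_density)
  then show ?thesis
    using A by (intro integral_eq_nn_integral[THEN trans]) (auto simp: exponential_density_nonneg)
qed

lemma lborel_integral_square_substitution:
  fixes F :: "real \<Rightarrow> real"
  assumes [measurable]: "F \<in> borel_measurable borel"
  shows "(LINT t:{0<..}|lborel. \<bar>2 * t\<bar> * F (t\<^sup>2)) = (LINT v:{0<..}|lborel. F v)"
proof -
  have img: "(\<lambda>t::real. t\<^sup>2) ` {0<..} = {0<..}"
  proof safe
    fix y :: real assume "0 < y"
    then show "y \<in> (\<lambda>t. t\<^sup>2) ` {0<..}" by (intro image_eqI[of _ _ "sqrt y"]) auto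
  qed auto
  have "inj_on (\<lambda>t::real. t\<^sup>2) {0<..}"
    by (auto simp: inj_on_def power2_eq_iff)
  moreover have "((\<lambda>t::real. t\<^sup>2) has_real_derivative 2 * t) (at t)" for t
    by (auto intro!: derivative_eq_intros)
  ultimately show ?thesis
    using lborel_substitution(2)[of "{0<..}" "\<lambda>t. t\<^sup>2" F "\<lambda>t. 2 * t"] unfolding img by simp
qed

lemma Gamma_reflection_real:
  fixes x :: real
  shows "Gamma x * Gamma (1 - x) = pi / sin (pi * x)"
proof -
  have "complex_of_real (Gamma x * Gamma (1 - x)) = complex_of_real (pi / sin (pi * x))"
    using Gamma_reflection_complex[of "complex_of_real x"]
    by (simp flip: Gamma_complex_of_real sin_of_real)
  then show ?thesis
    by (simp only: of_real_eq_iff)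
qed

text \<open>The substitution \<open>y = x / (1 - x)\<close> maps the unit interval onto the
  half-line and yields the Beta integral with parameters \<open>a\<close> and \<open>1 - a\<close>.
  Its value is \<open>Gamma a * Gamma (1 - a)\<close>, to which reflection applies.\<close>

lemma integral_powr_over_1_plus:
  assumes a: "0 < a" "a < (1::real)"
  shows "set_integrable lborel {0<..} (\<lambda>y. y powr (a - 1) / (1 + y))"
    and "(LINT y:{0<..}|lborel. y powr (a - 1) / (1 + y)) = pi / sin (pi * a)"
proof -
  define g where "g x = x / (1 - x)" for x :: real
  define g' where "g' x = 1 / (1 - x)\<^sup>2" for x :: real
  have img: "g ` {0<..<1} = {0<..}"
  proof safe
    fix y :: real assume "0 < y"
    then show "y \<in> g ` {0<..<1}"
      by (intro image_eqI[of _ _ "y / (1 + y)"]) (auto simp: g_def field_simps)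
  qed (auto simp: g_def)
  have inj: "inj_on g {0<..<1}"
    by (auto simp: inj_on_def g_def field_simps)
  have der: "(g has_real_derivative g' x) (at x)" if "x \<in> {0<..<1}" for x
    unfolding g_def g'_def using that
    by (auto intro!: derivative_eq_intros simp: power2_eq_square field_simps)
  have eq: "\<bar>g' x\<bar> * (g x powr (a - 1) / (1 + g x)) = x powr (a - 1) * (1 - x) powr ((1 - a) - 1)" if x: "x \<in> {0<..<1}" for x
  proof -
    have 1: "1 + g x = 1 / (1 - x)" using x by (simp add: g_def field_simps)
    have 2: "g x powr (a - 1) = x powr (a - 1) / (1 - x) powr (a - 1)"
      using x by (simp add: g_def powr_divide)
    have "(1 - x) powr (a - 1) * (1 - x) powr (1 - a - 1) = (1 - x) powr - 1"
      unfolding powr_add[symmetric] by simp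
    then have 3: "(1 - x) powr (a - 1) * (1 - x) powr (1 - a - 1) = inverse (1 - x)"
      using x by (simp add: powr_minus)
    have "\<bar>g' x\<bar> * (c / (1 / (1 - x))) = c * inverse (1 - x)" for c
      using x by (simp add: g'_def power2_eq_square divide_inverse)
    then have "\<bar>g' x\<bar> * (g x powr (a - 1) / (1 + g x)) = x powr (a - 1) / (1 - x) powr (a - 1) * inverse (1 - x)"
      unfolding 1 2 .
    also have "\<dots> = x powr (a - 1) * (1 - x) powr ((1 - a) - 1)"
      unfolding 3[symmetric] using x by simp
    finally show ?thesis .
  qed
  have B: "((\<lambda>t. t powr (a - 1) * (1 - t) powr ((1 - a) - 1)) has_integral Beta a (1 - a)) {0<..<1}"
    using has_integral_Beta_real[of a "1 - a"] a by (simp add: has_integral_Icc_iff_Ioo)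
  have Bi: "set_integrable lborel {0<..<1} (\<lambda>t. t powr (a - 1) * (1 - t) powr ((1 - a) - 1))"
  proof -
    have "(\<lambda>t. t powr (a - 1) * (1 - t) powr ((1 - a) - 1)) absolutely_integrable_on {0<..<1}"
      using B by (intro nonnegative_absolutely_integrable_1) (auto simp: integrable_on_def)
    then show ?thesis
      unfolding set_integrable_def by (subst (asm) integrable_completion) auto
  qed
  have [measurable]: "g \<in> borel_measurable borel" "g' \<in> borel_measurable borel"
    unfolding g_def g'_def by measurable
  have cong: "set_integrable lborel {0<..<1} (\<lambda>x. \<bar>g' x\<bar> * (g x powr (a - 1) / (1 + g x)))"
    using Bi by (simp only: set_integrable_cong[OF refl refl eq])
  note sub = lborel_substitution[of "{0<..<1}" g "\<lambda>y. y powr (a - 1) / (1 + y)" g', unfolded img, OF _ _ _ _ _ der inj]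
  show "set_integrable lborel {0<..} (\<lambda>y. y powr (a - 1) / (1 + y))"
    using sub(1) cong by simp
  have "(LINT y:{0<..}|lborel. y powr (a - 1) / (1 + y)) = (LINT x:{0<..<1}|lborel. \<bar>g' x\<bar> * (g x powr (a - 1) / (1 + g x)))"
    using sub(2) by simp
  also have "\<dots> = (LINT x:{0<..<1}|lborel. x powr (a - 1) * (1 - x) powr ((1 - a) - 1))"
    by (intro set_lebesgue_integral_cong allI impI eq) auto
  also have "\<dots> = Beta a (1 - a)"
    using set_borel_integral_eq_integral(2)[OF Bi] B by (simp add: integral_unique)
  also have "\<dots> = pi / sin (pi * a)"
    by (simp add: Beta_def Gamma_reflection_real)
  finally show "(LINT y:{0<..}|lborel. y powr (a - 1) / (1 + y)) = pi / sin (pi * a)" .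
qed

lemma powr_image_pos: "p > 0 \<Longrightarrow> (\<lambda>x::real. x powr p) ` {0<..} = {0<..}"
proof safe
  fix y :: real assume "p > 0" "0 < y"
  then show "y \<in> (\<lambda>x. x powr p) ` {0<..}"
    by (intro image_eqI[of _ _ "y powr (1 / p)"]) (auto simp: powr_powr)
qed auto

lemma powr_image_unit: "p > 0 \<Longrightarrow> (\<lambda>x::real. x powr p) ` {0<..<1} = {0<..<1}"
proof safe
  fix y :: real assume "p > 0" "y \<in> {0<..<1}"
  then show "y \<in> (\<lambda>x. x powr p) ` {0<..<1}"
    by (intro image_eqI[of _ _ "y powr (1 / p)"]) (use powr_less_mono2[of "1 / p" y 1] in \<open>auto simp: powr_powr\<close>)
next
  fix x :: real assume "p > 0" "x \<in> {0<..<1}"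
  then show "x powr p \<in> {0<..<1}"
    using powr_less_mono2[of p x 1] by simp
qed

lemma inj_on_powr: "p > 0 \<Longrightarrow> inj_on (\<lambda>x::real. x powr p) {0<..}"
  by (rule inj_on_inverseI[where g="\<lambda>y. y powr (1 / p)"]) (simp add: powr_powr)

text \<open>Substituting \<open>y = w powr p / b\<close> reduces to the previous integral with
  \<open>a = 1 / p\<close>, and the scaling produces \<open>b powr (1 / p)\<close>. The condition
  \<open>1 < p\<close> becomes path-loss exponent above \<open>2\<close> when \<open>p\<close> is
  half the exponent.\<close>

lemma integral_rational_powr:
  assumes p: "1 < p" and b: "0 < (b::real)"
  shows "set_integrable lborel {0<..} (\<lambda>w. b / (b + w powr p))"
    and "(LINT w:{0<..}|lborel. b / (b + w powr p)) = b powr (1 / p) * (pi / p) / sin (pi / p)"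
proof -
  define g where "g w = w powr p / b" for w :: real
  define g' where "g' w = p * w powr (p - 1) / b" for w :: real
  define f where "f y = b powr (1 / p) / p * (y powr (1 / p - 1) / (1 + y))" for y :: real
  have [measurable]: "g \<in> borel_measurable borel" "g' \<in> borel_measurable borel" "f \<in> borel_measurable borel"
    unfolding g_def g'_def f_def by measurable
  have "g ` {0<..} = (\<lambda>y. y / b) ` ((\<lambda>x. x powr p) ` {0<..})"
    by (auto simp: g_def)
  also have "\<dots> = {0<..}"
    using p b by (subst powr_image_pos) (auto intro!: image_eqI[of _ _ "_ * b"])
  finally have img: "g ` {0<..} = {0<..}" .
  have inj: "inj_on g {0<..}"
    using inj_on_powr[of p] p b by (auto simp: g_def inj_on_def)
  have der: "(g has_real_derivative g' x) (at x)" if "x \<in> {0<..}" for x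
    unfolding g_def g'_def using that b by (auto intro!: derivative_eq_intros)
  have eq: "\<bar>g' w\<bar> * f (g w) = b / (b + w powr p)" if w: "w \<in> {0<..}" for w
  proof -
    have 1: "(w powr p / b) powr (1 / p - 1) = w powr (1 - p) * b powr (1 - 1 / p)"
    proof -
      have "(w powr p / b) powr (1 / p - 1) = w powr (p * (1 / p - 1)) / b powr (1 / p - 1)"
        using w b by (simp add: powr_divide powr_powr)
      also have "p * (1 / p - 1) = 1 - p" using p by (simp add: field_simps)
      also have "w powr (1 - p) / b powr (1 / p - 1) = w powr (1 - p) * b powr (1 - 1 / p)"
        by (simp add: powr_minus_divide[symmetric] divide_inverse powr_minus[symmetric])
      finally show ?thesis .
    qed
    have 2: "w powr (p - 1) * w powr (1 - p) = 1" "b powr (1 / p) * b powr (1 - 1 / p) = b"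
      using w b by (simp_all add: powr_add[symmetric])
    have "\<bar>g' w\<bar> * f (g w) = (w powr (p - 1) * w powr (1 - p)) * (b powr (1 / p) * b powr (1 - 1 / p)) / (b * (1 + w powr p / b))"
      using w p b by (simp add: g'_def f_def g_def 1 abs_mult)
    also have "\<dots> = b / (b + w powr p)"
      unfolding 2 using b by (simp add: distrib_left)
    finally show ?thesis .
  qed
  have p1: "0 < 1 / p" "1 / p < 1" using p by auto
  note int = integral_powr_over_1_plus[OF p1]
  note sub = lborel_substitution[of "{0<..}" g f g', unfolded img, OF _ _ _ _ _ der inj]
  have "set_integrable lborel {0<..} f"
    unfolding f_def using int(1) by (rule set_integrable_mult_right)
  then have "set_integrable lborel {0<..} (\<lambda>w. \<bar>g' w\<bar> * f (g w))"
    using sub(1) by simp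
  then show "set_integrable lborel {0<..} (\<lambda>w. b / (b + w powr p))"
    by (rule set_integrable_cong[THEN iffD1, rotated -1]) (auto simp: eq)
  have "(LINT w:{0<..}|lborel. b / (b + w powr p)) = (LINT w:{0<..}|lborel. \<bar>g' w\<bar> * f (g w))"
    by (rule set_lebesgue_integral_cong) (auto simp: eq)
  also have "\<dots> = (LINT y:{0<..}|lborel. f y)"
    using sub(2) by simp
  also have "\<dots> = b powr (1 / p) / p * (pi / sin (pi * (1 / p)))"
    unfolding f_def set_integral_mult_right int(2) ..
  finally show "(LINT w:{0<..}|lborel. b / (b + w powr p)) = b powr (1 / p) * (pi / p) / sin (pi / p)"
    by simp
qed

text \<open>For these parameters Euler's kernel simplifies: the difference of the last two is
  \<open>1\<close>, which trivialises the power of \<open>1 - t\<close>, and the Gamma quotient is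
  \<open>1 / p\<close>. Substituting \<open>t = w powr p\<close> cancels the remaining power of
  \<open>t\<close>.\<close>

lemma hyp2f1_eq_integral:
  assumes p: "1 < p" and b: "0 < (b::real)"
  shows "hyp2f1 1 (1 / p) (1 + 1 / p) (- 1 / b) = (LINT w:{0<..<1}|lborel. b / (b + w powr p))"
proof -
  define f where "f t = (1 / p) * (t powr (1 / p - 1) * (1 - t) powr 0 * (1 - (- 1 / b) * t) powr - 1)" for t :: real
  define g' where "g' w = p * w powr (p - 1)" for w :: real
  have [measurable]: "g' \<in> borel_measurable borel" "f \<in> borel_measurable borel"
    unfolding g'_def f_def by measurable
  have inj: "inj_on (\<lambda>x::real. x powr p) {0<..<1}"
    using p by (intro inj_on_subset[OF inj_on_powr]) auto
  have der: "((\<lambda>x. x powr p) has_real_derivative g' x) (at x)" if "x \<in> {0<..<1}" for x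
    unfolding g'_def using that by (auto intro!: derivative_eq_intros)
  have img: "(\<lambda>x::real. x powr p) ` {0<..<1} = {0<..<1}"
    using p by (intro powr_image_unit) simp
  have eq: "\<bar>g' w\<bar> * f (w powr p) = b / (b + w powr p)" if w: "w \<in> {0<..<1}" for w
  proof -
    have wp: "0 < w powr p" "w powr p < 1" using w p powr_less_mono2[of p w 1] by auto
    have "p * (1 / p - 1) = 1 - p" using p by (simp add: field_simps)
    then have 1: "(w powr p) powr (1 / p - 1) = w powr (1 - p)"
      by (simp only: powr_powr)
    have 2: "w powr (p - 1) * w powr (1 - p) = 1"
      using w by (simp add: powr_add[symmetric])
    have 3: "(1 - (- 1 / b) * w powr p) powr - 1 = b / (b + w powr p)"
      using wp b by (subst powr_minus) (auto simp: field_simps)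
    have "\<bar>g' w\<bar> * f (w powr p) = (w powr (p - 1) * w powr (1 - p)) * (b / (b + w powr p))"
      unfolding f_def 1 3 using w p wp by (simp add: g'_def abs_mult)
    then show ?thesis unfolding 2 by simp
  qed
  have "1 / p \<notin> \<int>\<^sub>\<le>\<^sub>0"
    using p nonpos_Ints_nonpos[of "1 / p"] by force
  then have G: "Gamma (1 + 1 / p) = 1 / p * Gamma (1 / p)" "Gamma (1 / p) > 0"
    using p Gamma_plus1[of "1 / p"] by (auto simp: add.commute intro!: Gamma_real_pos)
  have "hyp2f1 1 (1 / p) (1 + 1 / p) (- 1 / b) = (LINT t:{0<..<1}|lborel. f t)"
    unfolding hyp2f1_def f_def set_integral_mult_right using G by simp
  also have "\<dots> = (LINT w:{0<..<1}|lborel. \<bar>g' w\<bar> * f (w powr p))"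
    using lborel_substitution(2)[of "{0<..<1}" "\<lambda>x. x powr p" f g', unfolded img, OF _ _ _ _ _ der inj] by simp
  also have "\<dots> = (LINT w:{0<..<1}|lborel. b / (b + w powr p))"
    by (rule set_lebesgue_integral_cong) (auto simp: eq)
  finally show ?thesis .
qed

lemma sinc_pos: "0 < x \<Longrightarrow> x < pi \<Longrightarrow> 0 < sinc x"
  by (simp add: sinc_def sin_gt_zero)

lemma integral_rational_powr_sinc:
  assumes e: "2 < e" and b: "0 < (b::real)"
  shows "(LINT w:{0<..}|lborel. b / (b + w powr (e / 2))) = b powr (2 / e) / sinc (2 * pi / e)"
  using integral_rational_powr(2)[of "e / 2" b] assms by (simp add: sinc_def mult.commute)

text \<open>The half-line is split at \<open>1\<close>: the whole integral is the sinc term and the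
  part below \<open>1\<close> the hypergeometric one, so their difference is the tail beyond
  \<open>1\<close>.\<close>

lemma Ffun_eq_integral:
  assumes e: "2 < e" and b: "0 < (b::real)"
  shows "b powr (2 / e) * Ffun b e = 1 + (LINT w:{1<..}|lborel. b / (b + w powr (e / 2)))"
proof -
  have int: "set_integrable lborel {0<..} (\<lambda>w. b / (b + w powr (e / 2)))"
    using assms by (intro integral_rational_powr(1)) auto
  have "(LINT w:{0<..}|lborel. b / (b + w powr (e / 2))) = (LINT w:{0<..<1} \<union> {1<..}|lborel. b / (b + w powr (e / 2)))"
  proof (rule set_integral_cong_set)
    show "AE x in lborel. (x \<in> {0<..<1} \<union> {1<..}) = (x \<in> {0::real<..})"
      using AE_lborel_singleton[of 1] by eventually_elim auto
  qed (auto simp: set_borel_measurable_def)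
  also have "\<dots> = (LINT w:{0<..<1}|lborel. b / (b + w powr (e / 2))) + (LINT w:{1<..}|lborel. b / (b + w powr (e / 2)))"
    by (rule set_integral_Un) (auto intro: set_integrable_subset[OF int])
  also have "(LINT w:{0<..<1}|lborel. b / (b + w powr (e / 2))) = hyp2f1 1 (2 / e) (1 + 2 / e) (- 1 / b)"
    using hyp2f1_eq_integral[of "e / 2" b] assms by simp
  finally have *: "(LINT w:{1<..}|lborel. b / (b + w powr (e / 2))) = b powr (2 / e) / sinc (2 * pi / e) - hyp2f1 1 (2 / e) (1 + 2 / e) (- 1 / b)"
    using integral_rational_powr_sinc[OF assms] by simp
  have "b powr (2 / e) * b powr (- 2 / e) = 1"
    using b by (simp add: powr_add[symmetric])
  then have "b powr (2 / e) * Ffun b e = b powr (2 / e) / sinc (2 * pi / e) + (1 - hyp2f1 1 (2 / e) (1 + 2 / e) (- 1 / b))"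
    unfolding Ffun_def distrib_left mult.assoc[symmetric] by simp
  then show ?thesis unfolding * by simp
qed

section \<open>Conditioning on the nearest point\<close>

text \<open>The weight of the points given the nearest one at distance \<open>a\<close>. Power-law
  path loss depends on the ratio \<open>y / a\<close> only, so one function \<open>H\<close> serves
  all \<open>a\<close>. Points within \<open>a\<close>, in particular the nearest itself, have
  weight \<open>1\<close>.\<close>

definition beyond :: "(real \<Rightarrow> real) \<Rightarrow> real \<Rightarrow> real \<Rightarrow> real" where
  "beyond H a y = (if y \<le> a then 1 else H (y / a))"

lemma rprod_eq_finite:
  assumes "\<And>i. i \<ge> n \<Longrightarrow> pfactor w (R i) = 1"
  shows "rprod w R = (\<Prod>i<n. pfactor w (R i))"
  unfolding rprod_def
proof (rule limI, rule tendsto_eventually)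
  have "(\<Prod>i<m. pfactor w (R i)) = (\<Prod>i<n. pfactor w (R i))" if "m \<ge> n" for m
    using that assms by (intro prod.mono_neutral_right) auto
  then show "\<forall>\<^sub>F m in sequentially. (\<Prod>i<m. pfactor w (R i)) = (\<Prod>i<n. pfactor w (R i))"
    unfolding eventually_sequentially by blast
qed

lemma rprod_mono:
  assumes "\<And>y. 0 \<le> w y" "\<And>y. w y \<le> w' y" "\<And>y. w' y \<le> 1"
  shows "rprod w R \<le> rprod w' R"
proof (rule LIMSEQ_le)
  show "(\<lambda>n. \<Prod>i<n. pfactor w (R i)) \<longlonglongrightarrow> rprod w R" "(\<lambda>n. \<Prod>i<n. pfactor w' (R i)) \<longlonglongrightarrow> rprod w' R"
    by (rule rprod_LIMSEQ; meson assms order_trans)+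
  show "\<exists>N. \<forall>n::nat. n \<ge> N \<longrightarrow> (\<Prod>i<n. pfactor w (R i)) \<le> (\<Prod>i<n. pfactor w' (R i))"
    using assms by (auto intro!: exI prod_mono simp: pfactor_def)
qed

text \<open>Truncation and number of factors are two limits, exchanged by monotonicity: the
  truncated product lies above the full one and below its own first \<open>n\<close> factors, and
  these finitely many eventually agree with those of \<open>w\<close>.\<close>

lemma rprod_truncation_LIMSEQ:
  assumes w: "\<And>y. 0 \<le> w y" "\<And>m y. w y \<le> W m y" "\<And>m y. W m y \<le> 1"
    and ev: "\<And>y. \<forall>\<^sub>F m in sequentially. W m y = w y"
  shows "(\<lambda>m::nat. rprod (W m) R) \<longlonglongrightarrow> rprod w R"
proof (rule decreasing_tendsto)
  have w1: "w y \<le> 1" and W0: "0 \<le> W m y" for m y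
    using w by (meson order_trans)+
  show "\<forall>\<^sub>F m in sequentially. rprod w R \<le> rprod (W m) R"
    using w by (intro always_eventually allI rprod_mono)
  fix x assume "rprod w R < x"
  with rprod_LIMSEQ[of w R, OF w(1) w1] have "\<forall>\<^sub>F n in sequentially. (\<Prod>i<n. pfactor w (R i)) < x"
    by (rule order_tendstoD(2))
  then obtain n where n: "(\<Prod>i<n. pfactor w (R i)) < x"
    by (auto simp: eventually_sequentially)
  have "\<forall>\<^sub>F m in sequentially. \<forall>i\<in>{..<n}. W m (R i) = w (R i)"
    by (intro eventually_ball_finite ballI ev) simp
  then show "\<forall>\<^sub>F m in sequentially. rprod (W m) R < x"
  proof eventually_elim
    fix m assume "\<forall>i\<in>{..<n}. W m (R i) = w (R i)"
    then have "(\<Prod>i<n. pfactor (W m) (R i)) = (\<Prod>i<n. pfactor w (R i))"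
      by (intro prod.cong) (auto simp: pfactor_def)
    then show "rprod (W m) R < x"
      using rprod_le_prod[of "W m" R n, OF W0 w(3)] n by simp
  qed
qed

text \<open>The substitution \<open>u = a^2 * x\<close> rescales the tail to \<open>{1<..}\<close>.
  The disc of radius \<open>b\<close>, where the weight vanishes, contributes \<open>b^2\<close>;
  the ring between \<open>b\<close> and \<open>a\<close> has weight \<open>1\<close> and contributes
  nothing.\<close>

lemma integral_beyond:
  assumes [measurable]: "H \<in> borel_measurable borel"
    and int: "set_integrable lborel {1<..} (\<lambda>u. 1 - H (sqrt u))"
    and ab: "0 \<le> b" "b \<le> a" "0 < a"
  defines "w \<equiv> \<lambda>y. if y \<le> b then 0 else beyond H a y"
  shows "set_integrable lborel {0<..} (\<lambda>u. 1 - w (sqrt u))"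
    and "(LINT u:{0<..}|lborel. 1 - w (sqrt u)) = b\<^sup>2 + a\<^sup>2 * (LINT u:{1<..}|lborel. 1 - H (sqrt u))"
proof -
  define f where "f u = 1 - H (sqrt (u / a\<^sup>2))" for u
  have [measurable]: "f \<in> borel_measurable borel" unfolding f_def by measurable
  have img: "(\<lambda>x. a\<^sup>2 * x) ` {1<..} = {a\<^sup>2<..}"
    using ab by (auto intro!: image_eqI[of _ _ "_ / a\<^sup>2"] simp: field_simps)
  have "((\<lambda>x. a\<^sup>2 * x) has_real_derivative a\<^sup>2) (at x)" for x
    by (auto intro!: derivative_eq_intros)
  then have sub: "set_integrable lborel {1<..} (\<lambda>x. a\<^sup>2 * f (a\<^sup>2 * x)) \<longleftrightarrow> set_integrable lborel {a\<^sup>2<..} f"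
    "(LINT x:{1<..}|lborel. a\<^sup>2 * f (a\<^sup>2 * x)) = (LINT u:{a\<^sup>2<..}|lborel. f u)"
    using lborel_substitution[of "{1<..}" "\<lambda>x. a\<^sup>2 * x" f "\<lambda>_. a\<^sup>2"] ab unfolding img by (auto simp: inj_on_def)
  have ff: "f (a\<^sup>2 * x) = 1 - H (sqrt x)" for x
    using ab by (simp add: f_def)
  have fi: "set_integrable lborel {a\<^sup>2<..} f"
    unfolding sub(1)[symmetric] ff using int by (rule set_integrable_mult_right)
  have fv: "(LINT u:{a\<^sup>2<..}|lborel. f u) = a\<^sup>2 * (LINT u:{1<..}|lborel. 1 - H (sqrt u))"
    unfolding sub(2)[symmetric] ff by simp
  have eq: "indicator {0<..} u *\<^sub>R (1 - w (sqrt u)) = indicator {0<..b\<^sup>2} u + indicator {a\<^sup>2<..} u *\<^sub>R f u" for u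
  proof -
    have "sqrt u \<le> b \<longleftrightarrow> u \<le> b\<^sup>2" "sqrt u \<le> a \<longleftrightarrow> u \<le> a\<^sup>2" "b\<^sup>2 \<le> a\<^sup>2" if "u > 0"
      using ab that by (auto simp: real_sqrt_le_iff' power_mono)
    moreover have "sqrt (u / a\<^sup>2) = sqrt u / a"
      using ab by (simp add: real_sqrt_divide)
    moreover have "0 < u" if "a\<^sup>2 < u"
      using zero_le_power2[of a] that by linarith
    ultimately show ?thesis
      by (auto simp: w_def f_def beyond_def indicator_def)
  qed
  have i1: "integrable lborel (indicator {0<..b\<^sup>2} :: real \<Rightarrow> real)"
    by (rule integrable_real_indicator) auto
  show "set_integrable lborel {0<..} (\<lambda>u. 1 - w (sqrt u))"
    unfolding set_integrable_def eq using i1 fi by (auto simp: set_integrable_def)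
  show "(LINT u:{0<..}|lborel. 1 - w (sqrt u)) = b\<^sup>2 + a\<^sup>2 * (LINT u:{1<..}|lborel. 1 - H (sqrt u))"
    unfolding set_lebesgue_integral_def eq
    by (subst Bochner_Integration.integral_add)
      (use i1 fi fv in \<open>auto simp: set_integrable_def set_lebesgue_integral_def\<close>)
qed

context prob_space
begin

lemma expectation_eq_partition:
  fixes f f' :: "'a \<Rightarrow> real" and J :: "'a \<Rightarrow> nat"
  assumes [measurable]: "J \<in> measurable M (count_space UNIV)" and int: "integrable M f" "integrable M f'"
    and eq: "\<And>j. (LINT \<omega>:{\<omega>\<in>space M. J \<omega> = j}|M. f \<omega>) = (LINT \<omega>:{\<omega>\<in>space M. J \<omega> = j}|M. f' \<omega>)"
  shows "expectation f = expectation f'"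
proof -
  have *: "expectation h = (\<Sum>j. LINT \<omega>:{\<omega>\<in>space M. J \<omega> = j}|M. h \<omega>)" if h: "integrable M h" for h :: "'a \<Rightarrow> real"
  proof -
    have U: "(\<Union>j. {\<omega>\<in>space M. J \<omega> = j}) = space M" by auto
    have "(LINT \<omega>:(\<Union>j. {\<omega>\<in>space M. J \<omega> = j})|M. h \<omega>) = (\<Sum>j. LINT \<omega>:{\<omega>\<in>space M. J \<omega> = j}|M. h \<omega>)"
      by (rule lebesgue_integral_countable_add) (auto simp: U set_integrable_def intro!: integrable_mult_indicator[of _ M h, unfolded real_scaleR_def] h)
    then show ?thesis by (simp add: U set_integral_space[OF h])
  qed
  show ?thesis by (simp add: *[OF int(1)] *[OF int(2)] eq)
qed

text \<open>With almost surely present points, the indicator of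
  \<open>b < radii (N \<omega>) 0\<close> is a product with factor \<open>0\<close> on the disc of
  radius \<open>b\<close>. Multiplied by the product beyond \<open>a\<close> it is a single product
  \<open>rprod w\<close>, to which the generating functional applies.\<close>

lemma first_point_window:
  assumes pp: "poisson_pp M lam N" and lam: "0 < lam"
    and H: "H \<in> borel_measurable borel" "\<And>u. 0 \<le> H u" "\<And>u. H u \<le> 1"
    and int: "set_integrable lborel {1<..} (\<lambda>u. 1 - H (sqrt u))"
    and ab: "0 \<le> b" "b \<le> a" "0 < a"
  shows "expectation (\<lambda>\<omega>. indicator {\<omega>. b < radii (N \<omega>) 0} \<omega> * rprod (beyond H a) (radii (N \<omega>))) =
    exp (- (lam * pi * (b\<^sup>2 + a\<^sup>2 * (LINT u:{1<..}|lborel. 1 - H (sqrt u)))))"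
proof -
  note [measurable] = H(1) poisson_pp_measurable_radii[OF pp]
  define w where "w y = (if y \<le> b then 0 else beyond H a y)" for y
  have w: "w \<in> borel_measurable borel" "0 \<le> w y" "w y \<le> 1" for y
    unfolding w_def beyond_def using H by (measurable, auto)
  have B: "0 \<le> beyond H a y" "beyond H a y \<le> 1" for y
    using H by (auto simp: beyond_def)
  have "expectation (\<lambda>\<omega>. indicator {\<omega>. b < radii (N \<omega>) 0} \<omega> * rprod (beyond H a) (radii (N \<omega>))) =
    expectation (\<lambda>\<omega>. rprod w (radii (N \<omega>)))"
  proof (rule integral_cong_AE)
    have "AE \<omega> in M. \<omega> \<in> space M" by simp
    with AE_poisson_pp_present[OF pp lam]
    show "AE \<omega> in M. indicator {\<omega>. b < radii (N \<omega>) 0} \<omega> * rprod (beyond H a) (radii (N \<omega>)) = rprod w (radii (N \<omega>))"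
    proof eventually_elim
      fix \<omega> assume R: "\<forall>i. 0 \<le> radii (N \<omega>) i" "\<omega> \<in> space M"
      show "indicator {\<omega>. b < radii (N \<omega>) 0} \<omega> * rprod (beyond H a) (radii (N \<omega>)) = rprod w (radii (N \<omega>))"
      proof (cases "b < radii (N \<omega>) 0")
        case True
        have "b < radii (N \<omega>) i" for i
          using radii_mono(2)[OF poisson_pp_locally_finite[OF pp R(2)], of i 0] R True by simp
        then have "pfactor w (radii (N \<omega>) i) = pfactor (beyond H a) (radii (N \<omega>) i)" for i
          by (simp add: pfactor_def w_def not_le[symmetric])
        then show ?thesis
          using True by (simp add: rprod_def)
      next
        case False
        have "rprod w (radii (N \<omega>)) \<le> (\<Prod>i<(1::nat). pfactor w (radii (N \<omega>) i))"
          by (rule rprod_le_prod[OF w(2,3)])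
        also have "\<dots> = 0"
          using False R(1)[THEN spec, of 0] by (simp add: pfactor_def w_def)
        finally show ?thesis
          using rprod_nonneg[of w "radii (N \<omega>)", OF w(2,3)] False by simp
      qed
    qed
    show "(\<lambda>\<omega>. indicator {\<omega>. b < radii (N \<omega>) 0} \<omega> * rprod (beyond H a) (radii (N \<omega>))) \<in> borel_measurable M"
      unfolding rprod_def pfactor_def beyond_def indicator_def mem_Collect_eq by measurable
    show "(\<lambda>\<omega>. rprod w (radii (N \<omega>))) \<in> borel_measurable M"
      unfolding rprod_def pfactor_def using w(1) by measurable
  qed
  also have "\<dots> = exp (- (lam * pi * (LINT u:{0<..}|lborel. 1 - w (sqrt u))))"
    using lam integral_beyond(1)[OF H(1) int ab] by (intro poisson_pp_pgfl_radial[OF pp _ w]) (auto simp: w_def)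
  also have "(LINT u:{0<..}|lborel. 1 - w (sqrt u)) = b\<^sup>2 + a\<^sup>2 * (LINT u:{1<..}|lborel. 1 - H (sqrt u))"
    using integral_beyond(2)[OF H(1) int ab] by (simp add: w_def)
  finally show ?thesis .
qed

text \<open>The constant \<open>H = 1\<close> leaves only the void probability of a disc.\<close>

lemma expectation_first_gt:
  assumes pp: "poisson_pp M lam N" and lam: "0 < lam" and b: "0 \<le> b"
  shows "expectation (\<lambda>\<omega>. indicator {\<omega>. b < radii (N \<omega>) 0} \<omega>) = exp (- (lam * pi * b\<^sup>2))"
proof -
  have "rprod (beyond (\<lambda>_. 1) a) R = 1" for a R
    using rprod_eq_finite[of 0 "beyond (\<lambda>_. 1) a" R] by (simp add: pfactor_def beyond_def)
  then show ?thesis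
    using first_point_window[OF pp lam, of "\<lambda>_. 1" b "b + 1"] b by (simp add: set_integrable_def)
qed

text \<open>Replacing the nearest distance \<open>R0\<close> by its upward rounding \<open>a\<close> to a grid makes \<open>a\<close> a discrete
  variable that is independent of the points beyond it, so the conditional expectation is explicit;
  the truncation of \<open>H\<close> beyond \<open>r\<close> makes all products finite, hence continuous in \<open>a\<close>.\<close>

lemma first_point_truncated:
  assumes pp: "poisson_pp M lam N" and lam: "0 < lam"
    and H: "H \<in> borel_measurable borel" "\<And>u. 0 \<le> H u" "\<And>u. H u \<le> 1"
    and Hlim: "\<And>u. 1 < u \<Longrightarrow> (H \<longlongrightarrow> H u) (at_left u)" and r: "\<And>u. r < u \<Longrightarrow> H u = 1"
    and int: "set_integrable lborel {1<..} (\<lambda>u. 1 - H (sqrt u))"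
    and g: "g \<in> borel_measurable borel" "\<And>t. 0 \<le> g t" "\<And>t. g t \<le> 1" "\<And>t. 0 < t \<Longrightarrow> isCont g t"
  shows "expectation (\<lambda>\<omega>. g (radii (N \<omega>) 0) * rprod (beyond H (radii (N \<omega>) 0)) (radii (N \<omega>))) =
    expectation (\<lambda>\<omega>. g (radii (N \<omega>) 0) * exp (- (lam * pi * ((radii (N \<omega>) 0)\<^sup>2 * (LINT u:{1<..}|lborel. 1 - H (sqrt u))))))"
proof -
  note [measurable] = H(1) g(1) poisson_pp_measurable_radii[OF pp]
  define c where "c = (LINT u:{1<..}|lborel. 1 - H (sqrt u))"
  have c: "0 \<le> c"
    unfolding c_def set_lebesgue_integral_def by (rule integral_nonneg_AE) (use H in auto)
  define R where "R \<omega> = radii (N \<omega>)" for \<omega>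
  have [measurable]: "(\<lambda>\<omega>. R \<omega> i) \<in> borel_measurable M" for i
    unfolding R_def by measurable
  \<comment> \<open>The number of the grid cell of mesh \<open>1 / (n + 1)\<close> containing the
    nearest distance. Cells are closed on the right, and \<open>a n\<close> is the right
    end.\<close>
  define J where "J n \<omega> = nat \<lceil>real (Suc n) * R \<omega> 0\<rceil>" for n \<omega>
  have [measurable]: "J n \<in> measurable M (count_space UNIV)" for n
    unfolding J_def by measurable
  define a where "a n \<omega> = real (J n \<omega>) / real (Suc n)" for n \<omega>
  have [measurable]: "a n \<in> borel_measurable M" for n
    unfolding a_def by measurable
  have B: "0 \<le> beyond H t y" "beyond H t y \<le> 1" for t y
    using H by (auto simp: beyond_def)
  define X where "X t \<omega> = rprod (beyond H t) (R \<omega>)" for t \<omega>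
  have X01: "0 \<le> X t \<omega>" "X t \<omega> \<le> 1" for t \<omega>
    unfolding X_def using rprod_nonneg[OF B] rprod_le_1[OF B] by auto
  have Xm: "(\<lambda>\<omega>. X (t \<omega>) \<omega>) \<in> borel_measurable M" if [measurable]: "t \<in> borel_measurable M" for t
    unfolding X_def rprod_def pfactor_def beyond_def by measurable
  have [measurable]: "(\<lambda>\<omega>. X (a n \<omega>) \<omega>) \<in> borel_measurable M" "(\<lambda>\<omega>. X (R \<omega> 0) \<omega>) \<in> borel_measurable M" "X t \<in> borel_measurable M" for n t
    by (rule Xm; measurable)+
  define E where "E t = exp (- (lam * pi * (t\<^sup>2 * c)))" for t
  have E01: "0 \<le> E t" "E t \<le> 1" for t
    using lam c by (auto simp: E_def)
  have [measurable]: "E \<in> borel_measurable borel" unfolding E_def by measurable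
  have good: "AE \<omega> in M. \<omega> \<in> space M \<and> 0 < R \<omega> 0 \<and> (\<forall>i. 0 \<le> R \<omega> i)"
    using AE_space AE_poisson_pp_present[OF pp lam] AE_poisson_pp_nonzero[OF pp]
  proof eventually_elim
    fix \<omega> assume "\<omega> \<in> space M" "\<forall>i. 0 \<le> radii (N \<omega>) i" "\<forall>i. radii (N \<omega>) i \<noteq> 0"
    then show "\<omega> \<in> space M \<and> 0 < R \<omega> 0 \<and> (\<forall>i. 0 \<le> R \<omega> i)"
      unfolding R_def by (metis order_le_less)
  qed
  have step: "expectation (\<lambda>\<omega>. g (a n \<omega>) * X (a n \<omega>) \<omega>) = expectation (\<lambda>\<omega>. g (a n \<omega>) * E (a n \<omega>))" for n
  proof (rule expectation_eq_partition[where J="J n"])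
    show "J n \<in> measurable M (count_space UNIV)" by measurable
    show "integrable M (\<lambda>\<omega>. g (a n \<omega>) * X (a n \<omega>) \<omega>)"
      by (rule integrable_const_bound[where B=1]) (use g X01 in \<open>auto intro!: mult_le_one simp: abs_mult\<close>)
    show "integrable M (\<lambda>\<omega>. g (a n \<omega>) * E (a n \<omega>))"
      by (rule integrable_const_bound[where B=1]) (use g E01 in \<open>auto intro!: mult_le_one simp: abs_mult\<close>)
    fix j
    show "(LINT \<omega>:{\<omega> \<in> space M. J n \<omega> = j}|M. g (a n \<omega>) * X (a n \<omega>) \<omega>) =
        (LINT \<omega>:{\<omega> \<in> space M. J n \<omega> = j}|M. g (a n \<omega>) * E (a n \<omega>))"
    proof (cases j)
      \<comment> \<open>Cell \<open>0\<close> would require a nearest distance of at most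
        \<open>0\<close>, a null event.\<close>
      case 0
      have "AE \<omega> in M. indicator {\<omega> \<in> space M. J n \<omega> = j} \<omega> = (0::real)"
        using good
      proof eventually_elim
        fix \<omega> assume "\<omega> \<in> space M \<and> 0 < R \<omega> 0 \<and> (\<forall>i. 0 \<le> R \<omega> i)"
        then have "0 < real (Suc n) * R \<omega> 0"
          by (intro mult_pos_pos) auto
        then show "indicator {\<omega> \<in> space M. J n \<omega> = j} \<omega> = (0::real)"
          by (auto simp: 0 J_def indicator_def simp del: of_nat_Suc)
      qed
      then show ?thesis
        unfolding set_lebesgue_integral_def
        by (intro integral_cong_AE) (auto elim!: eventually_mono)
    next
      case (Suc i)
      define t where "t = real j / real (Suc n)"
      define s where "s = real i / real (Suc n)"
      have st: "0 \<le> s" "s \<le> t" "0 < t"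
        by (auto simp: s_def t_def Suc divide_right_mono)
      \<comment> \<open>A cell is the difference of two tail events, and the joint expectation with
        each of them is known.\<close>
      have ind: "indicator {\<omega> \<in> space M. J n \<omega> = j} \<omega> = indicator {\<omega>. s < R \<omega> 0} \<omega> - (indicator {\<omega>. t < R \<omega> 0} \<omega> :: real)"
        if w: "\<omega> \<in> space M \<and> 0 < R \<omega> 0 \<and> (\<forall>i. 0 \<le> R \<omega> i)" for \<omega>
      proof -
        have "J n \<omega> = j \<longleftrightarrow> \<lceil>real (Suc n) * R \<omega> 0\<rceil> = int j"
          using w by (auto simp: J_def Suc)
        also have "\<dots> \<longleftrightarrow> real j - 1 < real (Suc n) * R \<omega> 0 \<and> real (Suc n) * R \<omega> 0 \<le> real j"
          by (simp add: ceiling_eq_iff)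
        also have "\<dots> \<longleftrightarrow> s < R \<omega> 0 \<and> R \<omega> 0 \<le> t"
          by (simp add: s_def t_def Suc field_simps)
        finally show ?thesis
          using w st by (auto simp: indicator_def)
      qed
      \<comment> \<open>Stated for a general \<open>Y\<close>, so that the random product
        \<open>X\<close> and its claimed conditional mean \<open>E\<close> go through the same
        computation.\<close>
      have gen: "(LINT \<omega>:{\<omega> \<in> space M. J n \<omega> = j}|M. g (a n \<omega>) * Y (a n \<omega>) \<omega>) =
          g t * (expectation (\<lambda>\<omega>. indicator {\<omega>. s < R \<omega> 0} \<omega> * Y t \<omega>) - expectation (\<lambda>\<omega>. indicator {\<omega>. t < R \<omega> 0} \<omega> * Y t \<omega>))"
        if Y[measurable]: "(\<lambda>\<omega>. Y (a n \<omega>) \<omega>) \<in> borel_measurable M" "Y t \<in> borel_measurable M" and Y01: "\<And>t \<omega>. 0 \<le> Y t \<omega>" "\<And>t \<omega>. Y t \<omega> \<le> 1" for Y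
      proof -
        have i: "integrable M (\<lambda>\<omega>. indicator {\<omega>. q < R \<omega> 0} \<omega> * Y t \<omega>)" for q
        proof (rule integrable_const_bound[where B=1])
          have "(\<lambda>\<omega>. (if q < R \<omega> 0 then 1 else 0) * Y t \<omega>) \<in> borel_measurable M" by measurable
          then show "(\<lambda>\<omega>. indicator {\<omega>. q < R \<omega> 0} \<omega> * Y t \<omega>) \<in> borel_measurable M"
            by (simp add: indicator_def)
        qed (use Y01 in \<open>auto split: split_indicator\<close>)
        have "(LINT \<omega>:{\<omega> \<in> space M. J n \<omega> = j}|M. g (a n \<omega>) * Y (a n \<omega>) \<omega>) =
          expectation (\<lambda>\<omega>. g t * (indicator {\<omega>. s < R \<omega> 0} \<omega> * Y t \<omega> - indicator {\<omega>. t < R \<omega> 0} \<omega> * Y t \<omega>))"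
          unfolding set_lebesgue_integral_def
        proof (rule integral_cong_AE)
          show "AE \<omega> in M. indicator {\<omega> \<in> space M. J n \<omega> = j} \<omega> *\<^sub>R (g (a n \<omega>) * Y (a n \<omega>) \<omega>) =
            g t * (indicator {\<omega>. s < R \<omega> 0} \<omega> * Y t \<omega> - indicator {\<omega>. t < R \<omega> 0} \<omega> * Y t \<omega>)"
            using good
          proof eventually_elim
            fix \<omega> assume w: "\<omega> \<in> space M \<and> 0 < R \<omega> 0 \<and> (\<forall>i. 0 \<le> R \<omega> i)"
            have "indicator {\<omega> \<in> space M. J n \<omega> = j} \<omega> *\<^sub>R (g (a n \<omega>) * Y (a n \<omega>) \<omega>) =
              g t * (indicator {\<omega> \<in> space M. J n \<omega> = j} \<omega> * Y t \<omega>)"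
              by (auto simp: a_def t_def split: split_indicator)
            then show "indicator {\<omega> \<in> space M. J n \<omega> = j} \<omega> *\<^sub>R (g (a n \<omega>) * Y (a n \<omega>) \<omega>) =
              g t * (indicator {\<omega>. s < R \<omega> 0} \<omega> * Y t \<omega> - indicator {\<omega>. t < R \<omega> 0} \<omega> * Y t \<omega>)"
              unfolding ind[OF w] by (simp only: left_diff_distrib)
          qed
          show "(\<lambda>\<omega>. g t * (indicator {\<omega>. s < R \<omega> 0} \<omega> * Y t \<omega> - indicator {\<omega>. t < R \<omega> 0} \<omega> * Y t \<omega>)) \<in> borel_measurable M"
            using i by (intro borel_measurable_times borel_measurable_diff borel_measurable_integrable) auto
        qed measurable
        then show ?thesis
          using i by simp
      qed
      \<comment> \<open>Used at the two ends \<open>q = s\<close> and \<open>q = t\<close> of the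
        cell; neither exceeds \<open>t\<close>, as the product beyond \<open>t\<close>
        demands.\<close>
      have win: "expectation (\<lambda>\<omega>. indicator {\<omega>. q < R \<omega> 0} \<omega> * X t \<omega>) = exp (- (lam * pi * (q\<^sup>2 + t\<^sup>2 * c)))" if "0 \<le> q" "q \<le> t" for q
        unfolding R_def X_def c_def using that st by (intro first_point_window[OF pp lam H int]) auto
      have win': "expectation (\<lambda>\<omega>. indicator {\<omega>. q < R \<omega> 0} \<omega> * E t) = exp (- (lam * pi * (q\<^sup>2 + t\<^sup>2 * c)))" if "0 \<le> q" for q
      proof -
        have "expectation (\<lambda>\<omega>. indicator {\<omega>. q < R \<omega> 0} \<omega> * E t) = exp (- (lam * pi * q\<^sup>2)) * E t"
          using expectation_first_gt[OF pp lam that] unfolding R_def by simp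
        then show ?thesis
          by (simp add: E_def exp_add[symmetric] algebra_simps)
      qed
      show ?thesis
        using gen[of X] gen[of "\<lambda>t _. E t"] X01 E01 st win[of s] win[of t] win'[of s] win'[of t] by simp
    qed
  qed
  have conv: "(\<lambda>n. a n \<omega>) \<longlonglongrightarrow> R \<omega> 0" "\<And>n. R \<omega> 0 \<le> a n \<omega>" "\<And>n. a n \<omega> \<le> R \<omega> 0 + 1"
    if w: "0 < R \<omega> 0" for \<omega>
  proof -
    have aa: "R \<omega> 0 \<le> a n \<omega>" "a n \<omega> \<le> R \<omega> 0 + 1 / real (Suc n)" for n
    proof -
      have "0 \<le> \<lceil>real (Suc n) * R \<omega> 0\<rceil>" using w by (simp add: le_ceiling_iff del: of_nat_Suc) (smt (verit) mult_nonneg_nonneg of_nat_0_le_iff)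
      then have "real (J n \<omega>) = of_int \<lceil>real (Suc n) * R \<omega> 0\<rceil>"
        unfolding J_def by simp
      then have "real (Suc n) * R \<omega> 0 \<le> real (J n \<omega>)" "real (J n \<omega>) \<le> real (Suc n) * R \<omega> 0 + 1"
        by linarith+
      moreover have "R \<omega> 0 + 1 / real (Suc n) = (real (Suc n) * R \<omega> 0 + 1) / real (Suc n)"
        by (simp add: add_divide_distrib del: of_nat_Suc)
      ultimately show "R \<omega> 0 \<le> a n \<omega>" "a n \<omega> \<le> R \<omega> 0 + 1 / real (Suc n)"
        unfolding a_def by (simp_all add: pos_le_divide_eq mult.commute divide_right_mono del: of_nat_Suc)
    qed
    show "R \<omega> 0 \<le> a n \<omega>" for n by (rule aa)
    show "a n \<omega> \<le> R \<omega> 0 + 1" for n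
      using aa(2)[of n] by (rule order_trans) simp
    have lim: "(\<lambda>n. R \<omega> 0 + 1 / real (Suc n)) \<longlonglongrightarrow> R \<omega> 0"
      using tendsto_add[OF tendsto_const LIMSEQ_Suc[OF lim_1_over_n], of "R \<omega> 0"] by simp
    show "(\<lambda>n. a n \<omega>) \<longlonglongrightarrow> R \<omega> 0"
      using tendsto_const lim by (rule tendsto_sandwich[rotated 2]) (intro always_eventually allI aa)+
  qed
  have Xconv: "(\<lambda>n. X (a n \<omega>) \<omega>) \<longlonglongrightarrow> X (R \<omega> 0) \<omega>"
    if w: "\<omega> \<in> space M \<and> 0 < R \<omega> 0 \<and> (\<forall>i. 0 \<le> R \<omega> i)" for \<omega>
  proof -
    note cv = conv[of \<omega>]
    have lf: "locally_finite (N \<omega>)"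
      using w by (intro poisson_pp_locally_finite[OF pp]) auto
    define r' where "r' = max r 1"
    \<comment> \<open>Since \<open>a n\<close> never exceeds the nearest distance by more than
      \<open>1\<close>, all points of weight different from \<open>1\<close> lie in this ball, and
      one number \<open>m\<close> of factors works for all \<open>n\<close>.\<close>
    define m where "m = card (N \<omega> \<inter> cball 0 (r' * (R \<omega> 0 + 1)))"
    have big: "r' * (R \<omega> 0 + 1) < R \<omega> i" if "i \<ge> m" for i
      using radii_le_iff[OF lf, of i "r' * (R \<omega> 0 + 1)"] w that by (simp add: R_def m_def)
    have fin: "X t \<omega> = (\<Prod>i<m. pfactor (beyond H t) (R \<omega> i))" if t: "0 < t" "t \<le> R \<omega> 0 + 1" for t
      unfolding X_def
    proof (rule rprod_eq_finite)
      fix i assume i: "m \<le> i"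
      have "r * t \<le> r' * (R \<omega> 0 + 1)"
        using t w by (intro mult_mono) (auto simp: r'_def)
      then have "r * t < R \<omega> i" using big[OF i] by linarith
      then have "H (R \<omega> i / t) = 1"
        using t by (intro r) (simp add: field_simps)
      then show "pfactor (beyond H t) (R \<omega> i) = 1"
        by (simp add: pfactor_def beyond_def)
    qed
    have "(\<lambda>n. \<Prod>i<m. pfactor (beyond H (a n \<omega>)) (R \<omega> i)) \<longlonglongrightarrow> (\<Prod>i<m. pfactor (beyond H (R \<omega> 0)) (R \<omega> i))"
    proof (rule tendsto_prod)
      fix i
      have apos: "0 < a n \<omega>" for n
        using cv(2)[of n] w by linarith
      show "(\<lambda>n. pfactor (beyond H (a n \<omega>)) (R \<omega> i)) \<longlonglongrightarrow> pfactor (beyond H (R \<omega> 0)) (R \<omega> i)"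
      \<comment> \<open>Here rounding upwards matters: a point not beyond the nearest distance stays
        within \<open>a n\<close>, and for any other point the ratio approaches its limit from the
        left, where \<open>H\<close> has the right limit value.\<close>
      proof (cases "R \<omega> i \<le> R \<omega> 0")
        case True
        then have "R \<omega> i \<le> a n \<omega>" for n
          using cv(2)[of n] w by linarith
        then show ?thesis using True by (simp add: pfactor_def beyond_def)
      next
        case False
        define u where "u = R \<omega> i / R \<omega> 0"
        have u: "1 < u" using False w by (simp add: u_def)
        have "(\<lambda>n. R \<omega> i / a n \<omega>) \<longlonglongrightarrow> u"
          unfolding u_def using w cv(1) by (intro tendsto_intros) auto
        moreover have "R \<omega> i / a n \<omega> \<le> u" for n
          unfolding u_def using w cv(2)[of n] apos[of n] by (intro divide_left_mono) auto
        moreover have "{..u} - {u} = {..<u} - {u}" by auto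
        then have "(H \<longlongrightarrow> H u) (at u within {..u})"
          using Hlim[OF u] by (simp add: at_within_def)
        ultimately have "(\<lambda>n. H (R \<omega> i / a n \<omega>)) \<longlonglongrightarrow> H u"
          by (intro continuous_within_tendsto_compose[of u "{..u}" H]) (auto simp: continuous_within)
        moreover have "\<forall>\<^sub>F n in sequentially. a n \<omega> < R \<omega> i"
          using cv(1) w False by (intro order_tendstoD(2)) auto
        then have "\<forall>\<^sub>F n in sequentially. H (R \<omega> i / a n \<omega>) = pfactor (beyond H (a n \<omega>)) (R \<omega> i)"
          by eventually_elim (use w in \<open>auto simp: pfactor_def beyond_def not_less[symmetric]\<close>)
        moreover have "pfactor (beyond H (R \<omega> 0)) (R \<omega> i) = H u"
          using False w by (simp add: pfactor_def beyond_def u_def not_less[symmetric])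
        ultimately show ?thesis
          by (simp add: tendsto_cong)
      qed
    qed
    moreover have "X (a n \<omega>) \<omega> = (\<Prod>i<m. pfactor (beyond H (a n \<omega>)) (R \<omega> i))" for n
      using cv(2,3)[of n] w by (intro fin) auto
    moreover have "X (R \<omega> 0) \<omega> = (\<Prod>i<m. pfactor (beyond H (R \<omega> 0)) (R \<omega> i))"
      using w by (intro fin) auto
    ultimately show ?thesis by simp
  qed
  have gconv: "(\<lambda>n. g (a n \<omega>)) \<longlonglongrightarrow> g (R \<omega> 0)" if "0 < R \<omega> 0" for \<omega>
    using g(4)[OF that] conv(1)[OF that] by (rule isCont_tendsto_compose)
  have "(\<lambda>n. expectation (\<lambda>\<omega>. g (a n \<omega>) * X (a n \<omega>) \<omega>)) \<longlonglongrightarrow> expectation (\<lambda>\<omega>. g (R \<omega> 0) * X (R \<omega> 0) \<omega>)"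
  proof (rule integral_dominated_convergence[where w="\<lambda>_. 1"])
    show "AE \<omega> in M. (\<lambda>n. g (a n \<omega>) * X (a n \<omega>) \<omega>) \<longlonglongrightarrow> g (R \<omega> 0) * X (R \<omega> 0) \<omega>"
      using good by eventually_elim (intro tendsto_mult gconv Xconv; simp)
    show "AE \<omega> in M. norm (g (a n \<omega>) * X (a n \<omega>) \<omega>) \<le> 1" for n
      using g X01 by (intro AE_I2) (auto intro!: mult_le_one simp: abs_mult)
  qed auto
  moreover have "(\<lambda>n. expectation (\<lambda>\<omega>. g (a n \<omega>) * E (a n \<omega>))) \<longlonglongrightarrow> expectation (\<lambda>\<omega>. g (R \<omega> 0) * E (R \<omega> 0))"
  proof (rule integral_dominated_convergence[where w="\<lambda>_. 1"])
    show "AE \<omega> in M. (\<lambda>n. g (a n \<omega>) * E (a n \<omega>)) \<longlonglongrightarrow> g (R \<omega> 0) * E (R \<omega> 0)"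
      using good unfolding E_def by eventually_elim (intro tendsto_intros gconv conv; simp)
    show "AE \<omega> in M. norm (g (a n \<omega>) * E (a n \<omega>)) \<le> 1" for n
      using g E01 by (intro AE_I2) (auto intro!: mult_le_one simp: abs_mult)
  qed auto
  ultimately have "expectation (\<lambda>\<omega>. g (R \<omega> 0) * X (R \<omega> 0) \<omega>) = expectation (\<lambda>\<omega>. g (R \<omega> 0) * E (R \<omega> 0))"
    unfolding step by (rule LIMSEQ_unique)
  then show ?thesis
    by (simp add: R_def X_def E_def c_def)
qed

text \<open>The void probability of the disc with squared radius \<open>a\<close> is
  \<open>exp (- lam * pi * a)\<close>, an exponential tail in \<open>a\<close>.\<close>

lemma distributed_first_squared:
  assumes pp: "poisson_pp M lam N" and lam: "0 < lam"
  shows "distributed M lborel (\<lambda>\<omega>. (radii (N \<omega>) 0)\<^sup>2) (exponential_density (lam * pi))"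
  unfolding exponential_distributed_iff[OF mult_pos_pos[OF lam pi_gt_zero]]
proof (intro conjI allI impI)
  note [measurable] = poisson_pp_measurable_radii[OF pp]
  show "(\<lambda>\<omega>. (radii (N \<omega>) 0)\<^sup>2) \<in> borel_measurable M" by measurable
  fix a :: real assume a: "0 \<le> a"
  have "\<P>(\<omega> in M. (radii (N \<omega>) 0)\<^sup>2 \<le> a) = \<P>(\<omega> in M. \<not> sqrt a < radii (N \<omega>) 0)"
  proof (rule prob_eq_AE)
    show "AE \<omega> in M. ((radii (N \<omega>) 0)\<^sup>2 \<le> a) = (\<not> sqrt a < radii (N \<omega>) 0)"
      using AE_poisson_pp_present[OF pp lam]
    proof eventually_elim
      fix \<omega> assume "\<forall>i. 0 \<le> radii (N \<omega>) i"
      then show "((radii (N \<omega>) 0)\<^sup>2 \<le> a) = (\<not> sqrt a < radii (N \<omega>) 0)"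
        using sqrt_ge_absD[of "radii (N \<omega>) 0" a] real_le_rsqrt[of "radii (N \<omega>) 0" a] by (auto simp: not_less)
    qed
  qed measurable
  also have "\<dots> = 1 - \<P>(\<omega> in M. sqrt a < radii (N \<omega>) 0)"
    by (rule prob_neg) measurable
  also have "\<P>(\<omega> in M. sqrt a < radii (N \<omega>) 0) = expectation (\<lambda>\<omega>. indicator {\<omega>\<in>space M. sqrt a < radii (N \<omega>) 0} \<omega>)"
    by simp
  also have "\<dots> = expectation (\<lambda>\<omega>. indicator {\<omega>. sqrt a < radii (N \<omega>) 0} \<omega>)"
    by (intro Bochner_Integration.integral_cong) (auto simp: indicator_def)
  also have "\<dots> = exp (- a * (lam * pi))"
    using expectation_first_gt[OF pp lam, of "sqrt a"] a by (simp add: mult_ac)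
  finally show "\<P>(\<omega> in M. (radii (N \<omega>) 0)\<^sup>2 \<le> a) = 1 - exp (- a * (lam * pi))" .
qed

text \<open>The exponential law of the squared distance, rewritten by \<open>v = t^2\<close>; the
  Jacobian gives the factor \<open>2 * t\<close>.\<close>

lemma expectation_first:
  fixes f :: "real \<Rightarrow> real"
  assumes pp: "poisson_pp M lam N" and lam: "0 < lam" and [measurable]: "f \<in> borel_measurable borel"
  shows "expectation (\<lambda>\<omega>. f (radii (N \<omega>) 0)) = (LINT t:{0<..}|lborel. 2 * lam * pi * t * exp (- (lam * pi * t\<^sup>2)) * f t)"
proof -
  note [measurable] = poisson_pp_measurable_radii[OF pp]
  define l where "l = lam * pi"
  have l: "0 < l" using lam by (simp add: l_def)
  define F where "F v = l * exp (- v * l) * f (sqrt v)" for v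
  have [measurable]: "F \<in> borel_measurable borel" unfolding F_def by measurable
  have "expectation (\<lambda>\<omega>. f (radii (N \<omega>) 0)) = expectation (\<lambda>\<omega>. f (sqrt ((radii (N \<omega>) 0)\<^sup>2)))"
    using AE_poisson_pp_present[OF pp lam] by (intro integral_cong_AE) (measurable, auto elim!: eventually_mono)
  also have "\<dots> = (LINT v|lborel. exponential_density l v * f (sqrt v))"
    using distributed_first_squared[OF pp lam] l unfolding l_def[symmetric]
    by (intro distributed_integral[symmetric]) (auto simp: exponential_density_nonneg)
  also have "\<dots> = (LINT v:{0<..}|lborel. F v)"
    unfolding set_lebesgue_integral_def
  proof (rule integral_cong_AE)
    show "AE v in lborel. exponential_density l v * f (sqrt v) = indicator {0<..} v *\<^sub>R F v"
      using AE_lborel_singleton[of 0] by eventually_elim (auto simp: exponential_density_def F_def indicator_def)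
  qed measurable
  also have "\<dots> = (LINT t:{0<..}|lborel. \<bar>2 * t\<bar> * F (t\<^sup>2))"
    by (rule lborel_integral_square_substitution[symmetric]) measurable
  also have "\<dots> = (LINT t:{0<..}|lborel. 2 * lam * pi * t * exp (- (lam * pi * t\<^sup>2)) * f t)"
    by (rule set_lebesgue_integral_cong) (auto simp: F_def l_def mult_ac)
  finally show ?thesis .
qed

text \<open>The truncation of \<open>H\<close> is removed by dominated convergence. In the result
  \<open>2 * lam * pi * t * exp (- (lam * pi * t\<^sup>2))\<close> is the density of the nearest
  distance, and the last exponential is the generating functional of the points beyond it.\<close>

lemma first_point:
  assumes pp: "poisson_pp M lam N" and lam: "0 < lam"
    and H: "H \<in> borel_measurable borel" "\<And>u. 0 \<le> H u" "\<And>u. H u \<le> 1"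
    and cont: "\<And>u. 1 < u \<Longrightarrow> isCont H u"
    and int: "set_integrable lborel {1<..} (\<lambda>u. 1 - H (sqrt u))"
    and g: "g \<in> borel_measurable borel" "\<And>t. 0 \<le> g t" "\<And>t. g t \<le> 1" "\<And>t. 0 < t \<Longrightarrow> isCont g t"
  shows "expectation (\<lambda>\<omega>. g (radii (N \<omega>) 0) * rprod (beyond H (radii (N \<omega>) 0)) (radii (N \<omega>))) =
    (LINT t:{0<..}|lborel. 2 * lam * pi * t * exp (- (lam * pi * t\<^sup>2)) *
       (g t * exp (- (lam * pi * (t\<^sup>2 * (LINT u:{1<..}|lborel. 1 - H (sqrt u)))))))"
proof -
  note [measurable] = H(1) g(1) poisson_pp_measurable_radii[OF pp]
  \<comment> \<open>The cut is closed at \<open>real m\<close>, which makes \<open>T m\<close> left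
    continuous there as well.\<close>
  define T where "T m u = (if u \<le> real m then H u else 1)" for m u
  define c where "c m = (LINT u:{1<..}|lborel. 1 - T m (sqrt u))" for m
  define c' where "c' = (LINT u:{1<..}|lborel. 1 - H (sqrt u))"
  define R where "R \<omega> = radii (N \<omega>) 0" for \<omega>
  have [measurable]: "R \<in> borel_measurable M"
    unfolding R_def by measurable
  have T: "T m \<in> borel_measurable borel" "0 \<le> T m u" "T m u \<le> 1" "H u \<le> T m u" for m u
    unfolding T_def using H by (measurable, auto)
  note [measurable] = T(1)
  have Tlim: "(T m \<longlongrightarrow> T m u) (at_left u)" if u: "1 < u" for m u
  proof (cases "u \<le> real m")
    case True
    have "(H \<longlongrightarrow> T m u) (at_left u)"
      using cont[OF u] True by (simp add: T_def isCont_def filterlim_at_split)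
    moreover have "\<forall>\<^sub>F x in at_left u. H x = T m x"
      using True by (auto simp: eventually_at_filter T_def)
    ultimately show ?thesis by (rule Lim_transform_eventually)
  next
    case False
    then have "\<forall>\<^sub>F x in at_left u. T m x = T m u"
      by (intro eventually_at_leftI[of "real m"]) (auto simp: T_def)
    then show ?thesis by (rule tendsto_eventually)
  qed
  have Tint: "set_integrable lborel {1<..} (\<lambda>u. 1 - T m (sqrt u))" for m
    using int by (rule set_integrable_bound) (use T(3,4) H(3) in \<open>auto simp: set_borel_measurable_def\<close>)
  have c: "c \<longlonglongrightarrow> c'"
    unfolding c_def c'_def set_lebesgue_integral_def
  proof (rule integral_dominated_convergence[where w="\<lambda>u. indicator {1<..} u *\<^sub>R (1 - H (sqrt u))"])
    show "AE u in lborel. (\<lambda>m. indicator {1<..} u *\<^sub>R (1 - T m (sqrt u))) \<longlonglongrightarrow> indicator {1<..} u *\<^sub>R (1 - H (sqrt u))"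
    proof (rule AE_I2)
      fix u :: real
      obtain m0 :: nat where "sqrt u \<le> real m0"
        using real_arch_simple by blast
      then have "\<forall>\<^sub>F m in sequentially. indicator {1<..} u *\<^sub>R (1 - T m (sqrt u)) = indicator {1<..} u *\<^sub>R (1 - H (sqrt u))"
        unfolding eventually_sequentially by (intro exI[of _ m0]) (auto simp: T_def)
      then show "(\<lambda>m. indicator {1<..} u *\<^sub>R (1 - T m (sqrt u))) \<longlonglongrightarrow> indicator {1<..} u *\<^sub>R (1 - H (sqrt u))"
        by (rule tendsto_eventually)
    qed
    show "integrable lborel (\<lambda>u. indicator {1<..} u *\<^sub>R (1 - H (sqrt u)))"
      using int by (simp add: set_integrable_def)
    show "AE u in lborel. norm (indicator {1<..} u *\<^sub>R (1 - T m (sqrt u))) \<le> indicator {1<..} u *\<^sub>R (1 - H (sqrt u))" for m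
      using T(3,4) by (intro AE_I2) (auto simp: indicator_def)
  qed auto
  have c0: "0 \<le> c m" for m
    unfolding c_def set_lebesgue_integral_def by (rule integral_nonneg_AE) (use T in auto)
  have B: "0 \<le> beyond H t y" "beyond H t y \<le> beyond (T m) t y" "0 \<le> beyond (T m) t y" "beyond (T m) t y \<le> 1" for m t y
    using H T by (auto simp: beyond_def)
  have P: "0 \<le> rprod (beyond (T m) t) S" "rprod (beyond (T m) t) S \<le> 1" for m t S
    using rprod_nonneg[of "beyond (T m) t" S] rprod_le_1[of "beyond (T m) t" S] B by auto
  have meas: "(\<lambda>\<omega>. rprod (beyond F (R \<omega>)) (radii (N \<omega>))) \<in> borel_measurable M" if [measurable]: "F \<in> borel_measurable borel" for F
    unfolding rprod_def pfactor_def beyond_def by measurable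
  have lim: "(\<lambda>m. rprod (beyond (T m) t) S) \<longlonglongrightarrow> rprod (beyond H t) S" for t S
  proof (rule rprod_truncation_LIMSEQ[OF B(1,2,4)])
    fix y
    obtain m0 :: nat where "y / t \<le> real m0"
      using real_arch_simple by blast
    then show "\<forall>\<^sub>F m in sequentially. beyond (T m) t y = beyond H t y"
      unfolding eventually_sequentially by (intro exI[of _ m0]) (auto simp: T_def beyond_def)
  qed
  have step: "expectation (\<lambda>\<omega>. g (R \<omega>) * rprod (beyond (T m) (R \<omega>)) (radii (N \<omega>))) =
      expectation (\<lambda>\<omega>. g (R \<omega>) * exp (- (lam * pi * ((R \<omega>)\<^sup>2 * c m))))" for m
    unfolding R_def c_def
    by (rule first_point_truncated[OF pp lam T(1-3) Tlim _ Tint g, where r="real m"]) (auto simp: T_def)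
  have "(\<lambda>m. expectation (\<lambda>\<omega>. g (R \<omega>) * rprod (beyond (T m) (R \<omega>)) (radii (N \<omega>)))) \<longlonglongrightarrow>
      expectation (\<lambda>\<omega>. g (R \<omega>) * rprod (beyond H (R \<omega>)) (radii (N \<omega>)))"
  proof (rule integral_dominated_convergence[where w="\<lambda>_. 1"])
    show "AE \<omega> in M. (\<lambda>m. g (R \<omega>) * rprod (beyond (T m) (R \<omega>)) (radii (N \<omega>))) \<longlonglongrightarrow> g (R \<omega>) * rprod (beyond H (R \<omega>)) (radii (N \<omega>))"
      by (intro AE_I2 tendsto_intros lim)
    show "AE \<omega> in M. norm (g (R \<omega>) * rprod (beyond (T m) (R \<omega>)) (radii (N \<omega>))) \<le> 1" for m
      using g P by (intro AE_I2) (auto intro!: mult_le_one simp: abs_mult)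
  qed (use meas H T in auto)
  moreover have "(\<lambda>m. expectation (\<lambda>\<omega>. g (R \<omega>) * exp (- (lam * pi * ((R \<omega>)\<^sup>2 * c m))))) \<longlonglongrightarrow>
      expectation (\<lambda>\<omega>. g (R \<omega>) * exp (- (lam * pi * ((R \<omega>)\<^sup>2 * c'))))"
  proof (rule integral_dominated_convergence[where w="\<lambda>_. 1"])
    show "AE \<omega> in M. (\<lambda>m. g (R \<omega>) * exp (- (lam * pi * ((R \<omega>)\<^sup>2 * c m)))) \<longlonglongrightarrow> g (R \<omega>) * exp (- (lam * pi * ((R \<omega>)\<^sup>2 * c')))"
      by (intro AE_I2 tendsto_intros c)
    show "AE \<omega> in M. norm (g (R \<omega>) * exp (- (lam * pi * ((R \<omega>)\<^sup>2 * c m)))) \<le> 1" for m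
      using g c0[of m] lam by (intro AE_I2) (auto intro!: mult_le_one simp: abs_mult)
  qed auto
  ultimately have "expectation (\<lambda>\<omega>. g (R \<omega>) * rprod (beyond H (R \<omega>)) (radii (N \<omega>))) =
      expectation (\<lambda>\<omega>. g (R \<omega>) * exp (- (lam * pi * ((R \<omega>)\<^sup>2 * c'))))"
    unfolding step by (rule LIMSEQ_unique)
  also have "\<dots> = (LINT t:{0<..}|lborel. 2 * lam * pi * t * exp (- (lam * pi * t\<^sup>2)) * (g t * exp (- (lam * pi * (t\<^sup>2 * c')))))"
    unfolding R_def by (rule expectation_first[OF pp lam]) measurable
  finally show ?thesis
    by (simp add: R_def c'_def)
qed

end

section \<open>Independence and exponential variables\<close>

context prob_space
begin

text \<open>Independence of random elements of possibly different types, which \<open>indep_var\<close> does not cover.\<close>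

definition indep_pair :: "'b measure \<Rightarrow> ('a \<Rightarrow> 'b) \<Rightarrow> 'c measure \<Rightarrow> ('a \<Rightarrow> 'c) \<Rightarrow> bool" where
  "indep_pair S X T Y \<longleftrightarrow> X \<in> measurable M S \<and> Y \<in> measurable M T \<and>
     distr M S X \<Otimes>\<^sub>M distr M T Y = distr M (S \<Otimes>\<^sub>M T) (\<lambda>\<omega>. (X \<omega>, Y \<omega>))"

text \<open>Fubini on the product law: \<open>Y\<close> is frozen at \<open>\<omega>\<close> while
  \<open>X\<close> is averaged over an independent \<open>\<omega>'\<close>. The bound is required
  on the whole product space, hence the clamps in the test functions below.\<close>

lemma indep_pair_expectation:
  fixes f :: "'b \<times> 'c \<Rightarrow> real"
  assumes ind: "indep_pair S X T Y" and f[measurable]: "f \<in> borel_measurable (S \<Otimes>\<^sub>M T)"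
    and bound: "\<And>z. \<bar>f z\<bar> \<le> B"
  shows "expectation (\<lambda>\<omega>. f (X \<omega>, Y \<omega>)) = expectation (\<lambda>\<omega>. expectation (\<lambda>\<omega>'. f (X \<omega>', Y \<omega>)))"
proof -
  have [measurable]: "X \<in> measurable M S" "Y \<in> measurable M T"
    using ind by (auto simp: indep_pair_def)
  interpret X: prob_space "distr M S X" by (rule prob_space_distr) simp
  interpret Y: prob_space "distr M T Y" by (rule prob_space_distr) simp
  interpret XY: pair_prob_space "distr M S X" "distr M T Y" ..
  have "expectation (\<lambda>\<omega>. f (X \<omega>, Y \<omega>)) = (\<integral>z. f z \<partial>distr M (S \<Otimes>\<^sub>M T) (\<lambda>\<omega>. (X \<omega>, Y \<omega>)))"
    by (subst integral_distr) auto
  also have "\<dots> = (\<integral>z. f z \<partial>(distr M S X \<Otimes>\<^sub>M distr M T Y))"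
    using ind by (simp add: indep_pair_def)
  also have "\<dots> = (\<integral>y. (\<integral>x. f (x, y) \<partial>distr M S X) \<partial>distr M T Y)"
  proof (subst XY.integral_snd)
    show "integrable (distr M S X \<Otimes>\<^sub>M distr M T Y) (case_prod (\<lambda>x y. f (x, y)))"
      by (rule XY.P.integrable_const_bound[where B=B]) (use bound in auto)
  qed (auto simp: case_prod_beta')
  also have "\<dots> = expectation (\<lambda>\<omega>. (\<integral>x. f (x, Y \<omega>) \<partial>distr M S X))"
    by (subst integral_distr) auto
  also have "\<dots> = expectation (\<lambda>\<omega>. expectation (\<lambda>\<omega>'. f (X \<omega>', Y \<omega>)))"
  proof (rule Bochner_Integration.integral_cong[OF refl])
    fix \<omega> assume "\<omega> \<in> space M"
    then have "Y \<omega> \<in> space T" using measurable_space[of Y M T] by simp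
    then have "(\<lambda>x. f (x, Y \<omega>)) \<in> borel_measurable S" by measurable
    then show "(\<integral>x. f (x, Y \<omega>) \<partial>distr M S X) = expectation (\<lambda>\<omega>'. f (X \<omega>', Y \<omega>))"
      by (intro integral_distr) auto
  qed
  finally show ?thesis .
qed

lemma exponential_AE_pos:
  assumes "distributed M lborel X (exponential_density 1)"
  shows "AE \<omega> in M. 0 < X \<omega>"
proof -
  have [measurable]: "X \<in> borel_measurable M"
    using assms by (auto simp: distributed_def)
  have "\<P>(\<omega> in M. 0 < X \<omega>) = 1"
    using exponential_distributedD_gt[OF assms, of 0] by simp
  then show ?thesis
    by (subst (asm) prob_eq_1) auto
qed

text \<open>The integrand is the exponential density of rate \<open>1 + c\<close> up to the factor
  \<open>1 / (1 + c)\<close>. The maximum keeps the exponent nonpositive for every outcome.\<close>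

lemma exponential_laplace:
  assumes X: "distributed M lborel X (exponential_density 1)" and c: "0 \<le> c"
  shows "expectation (\<lambda>\<omega>. exp (- (c * max 0 (X \<omega>)))) = 1 / (1 + c)"
proof -
  have "expectation (\<lambda>\<omega>. exp (- (c * max 0 (X \<omega>)))) = (LINT x|lborel. exponential_density 1 x * exp (- (c * max 0 x)))"
    using X by (intro distributed_integral[symmetric]) (auto simp: exponential_density_nonneg)
  also have "\<dots> = (LINT x|lborel. 1 / (1 + c) * exponential_density (1 + c) x)"
  proof (rule Bochner_Integration.integral_cong[OF refl])
    fix x :: real
    have 1: "exp (- x) * exp (- (c * x)) = exp (- x * (1 + c))"
      by (simp add: exp_add[symmetric] algebra_simps)
    have 2: "1 / (1 + c) * ((1 + c) * z) = z" for z
      using c by simp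
    show "exponential_density 1 x * exp (- (c * max 0 x)) = 1 / (1 + c) * exponential_density (1 + c) x"
      using 1 2[of "exp (- x * (1 + c))"] by (cases "x < 0") (simp_all add: exponential_density_def)
  qed
  also have "\<dots> = 1 / (1 + c) * (LINT x|lborel. exponential_density (1 + c) x)"
    by (rule integral_mult_right_zero)
  also have "(LINT x|lborel. exponential_density (1 + c) x) = 1"
    using c by (intro integral_exponential_density) simp
  finally show ?thesis by simp
qed

text \<open>Given \<open>W\<close> and \<open>Z\<close>, the tail of \<open>X\<close> beyond
  \<open>Z\<close> is \<open>exp (- Z)\<close>. This is how the SINR condition on the serving fading
  becomes a Laplace transform.\<close>

lemma expectation_indep_exponential_gt:
  assumes X: "distributed M lborel X (exponential_density 1)"
    and ind: "indep_pair borel X (borel \<Otimes>\<^sub>M borel) (\<lambda>\<omega>. (W \<omega>, Z \<omega>))"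
    and W: "\<And>\<omega>. 0 \<le> W \<omega>" "\<And>\<omega>. W \<omega> \<le> 1" and Z: "\<And>\<omega>. 0 \<le> Z \<omega>"
  shows "expectation (\<lambda>\<omega>. W \<omega> * (if Z \<omega> < X \<omega> then 1 else 0)) = expectation (\<lambda>\<omega>. W \<omega> * exp (- Z \<omega>))"
proof -
  have [measurable]: "X \<in> borel_measurable M"
    using X by (auto simp: distributed_def)
  \<comment> \<open>The integrand on the product space must be bounded also outside the range of
    \<open>W\<close>; on the actual values the clamp is invisible.\<close>
  have clamp: "max 0 (min 1 (W \<omega>)) = W \<omega>" for \<omega>
    using W[of \<omega>] by simp
  have "expectation (\<lambda>\<omega>. (\<lambda>(x, (w, z)). max 0 (min 1 w) * (if z < x then 1 else 0)) (X \<omega>, (W \<omega>, Z \<omega>))) =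
    expectation (\<lambda>\<omega>. expectation (\<lambda>\<omega>'. (\<lambda>(x, (w, z)). max 0 (min 1 w) * (if z < x then 1 else 0)) (X \<omega>', (W \<omega>, Z \<omega>))))"
    by (rule indep_pair_expectation[OF ind, where B=1]) (measurable, auto)
  also have "\<dots> = expectation (\<lambda>\<omega>. W \<omega> * exp (- Z \<omega>))"
  proof (rule Bochner_Integration.integral_cong[OF refl])
    fix \<omega>
    have "expectation (\<lambda>\<omega>'. (if Z \<omega> < X \<omega>' then 1 else 0)) = expectation (\<lambda>\<omega>'. indicator {\<omega>'\<in>space M. Z \<omega> < X \<omega>'} \<omega>')"
      by (intro Bochner_Integration.integral_cong) (auto simp: indicator_def)
    also have "\<dots> = exp (- Z \<omega>)"
      using exponential_distributedD_gt[OF X Z] by simp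
    finally show "expectation (\<lambda>\<omega>'. (\<lambda>(x, (w, z)). max 0 (min 1 w) * (if z < x then 1 else 0)) (X \<omega>', (W \<omega>, Z \<omega>))) = W \<omega> * exp (- Z \<omega>)"
      by (simp add: clamp)
  qed
  finally show ?thesis by (simp add: clamp)
qed

lemma expectation_indep_exponential_laplace:
  assumes X: "distributed M lborel X (exponential_density 1)"
    and ind: "indep_pair borel X (borel \<Otimes>\<^sub>M borel) (\<lambda>\<omega>. (W \<omega>, Z \<omega>))"
    and W: "\<And>\<omega>. 0 \<le> W \<omega>" "\<And>\<omega>. W \<omega> \<le> 1" and Z: "\<And>\<omega>. 0 \<le> Z \<omega>"
  shows "expectation (\<lambda>\<omega>. W \<omega> * exp (- (Z \<omega> * max 0 (X \<omega>)))) = expectation (\<lambda>\<omega>. W \<omega> * (1 / (1 + Z \<omega>)))"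
proof -
  have clamp: "max 0 (min 1 (W \<omega>)) = W \<omega>" "max 0 (Z \<omega>) = Z \<omega>" for \<omega>
    using W[of \<omega>] Z[of \<omega>] by simp_all
  have "expectation (\<lambda>\<omega>. (\<lambda>(x, (w, z)). max 0 (min 1 w) * exp (- (max 0 z * max 0 x))) (X \<omega>, (W \<omega>, Z \<omega>))) =
    expectation (\<lambda>\<omega>. expectation (\<lambda>\<omega>'. (\<lambda>(x, (w, z)). max 0 (min 1 w) * exp (- (max 0 z * max 0 x))) (X \<omega>', (W \<omega>, Z \<omega>))))"
    by (rule indep_pair_expectation[OF ind, where B=1]) (measurable, auto intro!: mult_le_one simp: abs_mult)
  then show ?thesis
    using exponential_laplace[OF X Z] by (simp add: clamp)
qed

text \<open>The family is regrouped into two blocks, \<open>s\<close> and all other indices. The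
  generated sigma-algebras stay independent because the generators are intersection stable, and the
  product formula on rectangles identifies the joint law.\<close>

lemma indep_sets_imp_indep_pair:
  assumes ind: "indep_sets F I" and s: "s \<in> I" and stable: "\<And>i. i \<in> I \<Longrightarrow> Int_stable (F i)"
    and X: "X \<in> measurable (sigma (space M) (F s)) S"
    and Y: "Y \<in> measurable (sigma (space M) (\<Union>i\<in>I - {s}. F i)) T"
  shows "indep_pair S X T Y"
proof -
  have sub: "F i \<subseteq> sets M" if "i \<in> I" for i
    using ind that by (auto simp: indep_sets_def)
  define J where "J b = (if b then {s} else I - {s})" for b
  define G where "G b = sigma_sets (space M) (\<Union>i\<in>J b. F i)" for b
  have U: "(\<Union>b\<in>UNIV. J b) = I" using s by (auto simp: J_def UNIV_bool)
  have "indep_sets G UNIV"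
    unfolding G_def
  proof (rule indep_sets_collect_sigma)
    show "indep_sets F (\<Union>b\<in>UNIV. J b)" using ind U by simp
    show "Int_stable (F i)" if "i \<in> J b" for i b
      using that s by (intro stable) (auto simp: J_def split: if_splits)
    show "disjoint_family_on J UNIV"
      by (auto simp: disjoint_family_on_def J_def)
  qed
  then have G: "indep_set (G True) (G False)"
    unfolding indep_set_def by (rule indep_sets_mono_sets) (auto split: bool.split)
  have pw: "F s \<subseteq> Pow (space M)" "(\<Union>i\<in>I - {s}. F i) \<subseteq> Pow (space M)"
    using sub s sets.sets_into_space by blast+
  have XG: "X -` A \<inter> space M \<in> G True" if "A \<in> sets S" for A
    using measurable_sets[OF X that] pw(1) by (simp add: G_def J_def)
  have YG: "Y -` A \<inter> space M \<in> G False" if "A \<in> sets T" for A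
    using measurable_sets[OF Y that] pw(2) by (simp add: G_def J_def)
  have GM: "G b \<subseteq> sets M" for b
    unfolding G_def using sub s by (intro sets.sigma_sets_subset) (auto simp: J_def split: if_splits)
  have XY[measurable]: "X \<in> measurable M S" "Y \<in> measurable M T"
    using measurable_space[OF X] measurable_space[OF Y] XG YG GM[of True] GM[of False] pw
    by (auto intro!: measurableI simp: space_measure_of)
  interpret X: prob_space "distr M S X" by (rule prob_space_distr) simp
  interpret Y: prob_space "distr M T Y" by (rule prob_space_distr) simp
  have "distr M S X \<Otimes>\<^sub>M distr M T Y = distr M (S \<Otimes>\<^sub>M T) (\<lambda>\<omega>. (X \<omega>, Y \<omega>))"
  proof (rule pair_measure_eqI)
    show "sigma_finite_measure (distr M S X)" "sigma_finite_measure (distr M T Y)"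
      by unfold_locales
    show "sets (distr M S X \<Otimes>\<^sub>M distr M T Y) = sets (distr M (S \<Otimes>\<^sub>M T) (\<lambda>\<omega>. (X \<omega>, Y \<omega>)))"
      by (simp cong: sets_pair_measure_cong)
    fix A B assume "A \<in> sets (distr M S X)" "B \<in> sets (distr M T Y)"
    then have AB[measurable]: "A \<in> sets S" "B \<in> sets T" by auto
    have "(\<lambda>\<omega>. (X \<omega>, Y \<omega>)) -` (A \<times> B) \<inter> space M = (X -` A \<inter> space M) \<inter> (Y -` B \<inter> space M)"
      by auto
    moreover have "prob ((X -` A \<inter> space M) \<inter> (Y -` B \<inter> space M)) = prob (X -` A \<inter> space M) * prob (Y -` B \<inter> space M)"
      by (rule indep_setD[OF G XG[OF AB(1)] YG[OF AB(2)]])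
    ultimately show "emeasure (distr M S X) A * emeasure (distr M T Y) B = emeasure (distr M (S \<Otimes>\<^sub>M T) (\<lambda>\<omega>. (X \<omega>, Y \<omega>))) (A \<times> B)"
      by (simp add: emeasure_distr emeasure_eq_measure ennreal_mult)
  qed
  with XY show ?thesis
    unfolding indep_pair_def by blast
qed

end

section \<open>The network\<close>

lemma measurable_sets_mono:
  "f \<in> measurable A T \<Longrightarrow> space A = space B \<Longrightarrow> sets A \<subseteq> sets B \<Longrightarrow> f \<in> measurable B T"
  by (auto simp: measurable_def)

lemma borel_measurable_PiM_seq:
  assumes "\<And>i. (\<lambda>\<omega>. X \<omega> i) \<in> borel_measurable A"
  shows "X \<in> measurable A (PiM (UNIV :: nat set) (\<lambda>_. borel :: real measure))"
  by (rule measurable_PiM_single') (use assms in \<open>auto simp: space_PiM\<close>)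

locale cellular_network = prob_space M for M :: "'a measure" +
  fixes K :: nat
    and No :: "nat \<Rightarrow> 'a \<Rightarrow> pt set" and Psi :: "nat \<Rightarrow> 'a \<Rightarrow> nat \<Rightarrow> real"
    and lo Po eps \<beta> :: "nat \<Rightarrow> real"
    and Nc :: "'a \<Rightarrow> pt set" and Psic :: "'a \<Rightarrow> nat \<Rightarrow> real"
    and lc Pc epsc \<eta> :: real
  assumes lo: "\<And>k. k \<in> {1..K} \<Longrightarrow> lo k > 0" and Po: "\<And>k. k \<in> {1..K} \<Longrightarrow> Po k > 0"
    and eps: "\<And>k. k \<in> {1..K} \<Longrightarrow> eps k > 2" and beta: "\<And>k. k \<in> {1..K} \<Longrightarrow> \<beta> k > 0"
    and lc: "lc \<ge> 0" and Pc: "Pc > 0" and epsc: "epsc > 2" and eta: "\<eta> \<ge> 0"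
    and ppp_open: "\<And>k. k \<in> {1..K} \<Longrightarrow> poisson_pp M (lo k) (No k)"
    and ppp_closed: "poisson_pp M lc Nc"
    and fade_open: "\<And>k i. k \<in> {1..K} \<Longrightarrow> distributed M lborel (\<lambda>\<omega>. Psi k \<omega> i) (exponential_density 1)"
    and fade_closed: "\<And>i. distributed M lborel (\<lambda>\<omega>. Psic \<omega> i) (exponential_density 1)"
    and indep: "indep_sets (src_sigma M No Psi Nc Psic) (src_index K)"
begin

text \<open>From here on the closed tier is tier \<open>0\<close>. The truncation in \<open>fading_pos\<close> changes the fadings on a
  null set only and makes the received powers nonnegative everywhere.\<close>

definition point_source :: "nat \<Rightarrow> src" where "point_source l = (if l = 0 then ClosedPts else OpenPts l)"
definition fading_source :: "nat \<Rightarrow> nat \<Rightarrow> src" where "fading_source l i = (if l = 0 then ClosedFade i else OpenFade l i)"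
definition tier_points :: "nat \<Rightarrow> 'a \<Rightarrow> pt set" where "tier_points l = (if l = 0 then Nc else No l)"
definition fading :: "nat \<Rightarrow> 'a \<Rightarrow> nat \<Rightarrow> real" where "fading l = (if l = 0 then Psic else Psi l)"
definition fading_pos :: "nat \<Rightarrow> 'a \<Rightarrow> nat \<Rightarrow> real" where "fading_pos l \<omega> i = max 0 (fading l \<omega> i)"
definition tier_intensity :: "nat \<Rightarrow> real" where "tier_intensity l = (if l = 0 then lc else lo l)"
definition tier_power :: "nat \<Rightarrow> real" where "tier_power l = (if l = 0 then Pc else Po l)"
definition tier_exponent :: "nat \<Rightarrow> real" where "tier_exponent l = (if l = 0 then epsc else eps l)"
definition tier_radii :: "nat \<Rightarrow> 'a \<Rightarrow> nat \<Rightarrow> real" where "tier_radii l \<omega> = radii (tier_points l \<omega>)"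
text \<open>A missing station, of radius \<open>-1\<close>, has gain \<open>0\<close>, so its
  Laplace factor is the neutral factor of \<open>pfactor\<close>.\<close>

definition gain :: "nat \<Rightarrow> real \<Rightarrow> real" where "gain l y = (if y < 0 then 0 else tier_power l * y powr - tier_exponent l)"

text \<open>The information of all sources except \<open>s\<close>. Measurability with respect to it
  is the form in which independence of \<open>s\<close> is certified throughout.\<close>

definition others :: "src \<Rightarrow> 'a measure" where
  "others s = sigma (space M) (\<Union>i\<in>src_index K - {s}. src_sigma M No Psi Nc Psic i)"

lemma tier_cases: "l \<le> K \<Longrightarrow> l = 0 \<or> l \<in> {1..K}"
  by auto

lemma pp: "l \<le> K \<Longrightarrow> poisson_pp M (tier_intensity l) (tier_points l)"
  using tier_cases[of l] ppp_open ppp_closed by (auto simp: tier_intensity_def tier_points_def)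

lemma tier_intensity_nonneg: "l \<le> K \<Longrightarrow> 0 \<le> tier_intensity l"
  using tier_cases[of l] lo[of l] lc by (auto simp: tier_intensity_def)

lemma tier_intensity_pos: "l \<in> {1..K} \<Longrightarrow> 0 < tier_intensity l"
  using lo[of l] by (auto simp: tier_intensity_def)

lemma tier_power_pos: "l \<le> K \<Longrightarrow> 0 < tier_power l"
  using tier_cases[of l] Po[of l] Pc by (auto simp: tier_power_def)

lemma tier_exponent_gt_2: "l \<le> K \<Longrightarrow> 2 < tier_exponent l"
  using tier_cases[of l] eps[of l] epsc by (auto simp: tier_exponent_def)

lemma fading_distributed: "l \<le> K \<Longrightarrow> distributed M lborel (\<lambda>\<omega>. fading l \<omega> i) (exponential_density 1)"
  using tier_cases[of l] fade_open fade_closed by (auto simp: fading_def)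

lemma locally_finite_tier_points: "l \<le> K \<Longrightarrow> \<omega> \<in> space M \<Longrightarrow> locally_finite (tier_points l \<omega>)"
  by (rule poisson_pp_locally_finite[OF pp])

lemma fading_pos_nonneg: "0 \<le> fading_pos l \<omega> i"
  by (simp add: fading_pos_def)

lemma gain_nonneg: "l \<le> K \<Longrightarrow> 0 \<le> gain l y"
  using tier_power_pos[of l] by (simp add: gain_def)

lemma src_sigma_point_source: "src_sigma M No Psi Nc Psic (point_source l) = sets (vimage_algebra (space M) (tier_points l) pp_space)"
  by (simp add: src_sigma_def point_source_def tier_points_def)

lemma src_sigma_fading_source: "src_sigma M No Psi Nc Psic (fading_source l i) = sets (vimage_algebra (space M) (\<lambda>\<omega>. fading l \<omega> i) borel)"
  by (simp add: src_sigma_def fading_source_def fading_def)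

lemma point_source_in_index: "l \<le> K \<Longrightarrow> point_source l \<in> src_index K"
  using tier_cases[of l] by (auto simp: point_source_def src_index_def)

lemma fading_source_in_index: "l \<le> K \<Longrightarrow> fading_source l i \<in> src_index K"
  using tier_cases[of l] by (auto simp: fading_source_def src_index_def image_iff)

lemma point_source_eq_iff [simp]: "point_source l = point_source l' \<longleftrightarrow> l = l'"
  and fading_source_eq_iff [simp]: "fading_source l i = fading_source l' i' \<longleftrightarrow> l = l' \<and> i = i'"
  and point_source_neq_fad [simp]: "point_source l \<noteq> fading_source l' i'" "fading_source l' i' \<noteq> point_source l"
  by (auto simp: point_source_def fading_source_def split: if_splits)

lemma src_sigma_algebra:
  "\<exists>A. src_sigma M No Psi Nc Psic s = sets A \<and> space A = space M"
proof (cases s)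
  case (OpenPts k)
  then show ?thesis by (auto simp: src_sigma_def intro!: exI[of _ "vimage_algebra (space M) (No k) pp_space"])
next
  case ClosedPts
  then show ?thesis by (auto simp: src_sigma_def intro!: exI[of _ "vimage_algebra (space M) Nc pp_space"])
next
  case (OpenFade k i)
  then show ?thesis by (auto simp: src_sigma_def intro!: exI[of _ "vimage_algebra (space M) (\<lambda>\<omega>. Psi k \<omega> i) borel"])
next
  case (ClosedFade i)
  then show ?thesis by (auto simp: src_sigma_def intro!: exI[of _ "vimage_algebra (space M) (\<lambda>\<omega>. Psic \<omega> i) borel"])
qed

lemma src_sigma_Int_stable: "Int_stable (src_sigma M No Psi Nc Psic s)"
  using src_sigma_algebra[of s] by (auto simp: Int_stable_def)

lemma src_sigma_subset: "src_sigma M No Psi Nc Psic s \<subseteq> Pow (space M)"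
  using src_sigma_algebra[of s] sets.sets_into_space by fastforce

lemma space_others [simp]: "space (others s) = space M"
  unfolding others_def using src_sigma_subset by (intro space_measure_of) auto

lemma sets_others: "sets (others s) = sigma_sets (space M) (\<Union>i\<in>src_index K - {s}. src_sigma M No Psi Nc Psic i)"
  unfolding others_def using src_sigma_subset by (intro sets_measure_of) auto

lemma measurable_others_M: "X \<in> measurable (others s) T \<Longrightarrow> X \<in> measurable M T"
proof (erule measurable_sets_mono)
  show "sets (others s) \<subseteq> sets M"
    unfolding sets_others using indep by (intro sets.sigma_sets_subset) (auto simp: indep_sets_def)
qed simp

lemma measurable_others:
  assumes "X \<in> measurable A T" "space A = space M" "sets A = src_sigma M No Psi Nc Psic i" "i \<in> src_index K" "i \<noteq> s"
  shows "X \<in> measurable (others s) T"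
  using assms(1)
proof (rule measurable_sets_mono)
  show "sets A \<subseteq> sets (others s)"
    unfolding sets_others using assms by (auto intro!: sigma_sets.Basic)
qed (simp add: assms)

text \<open>Independence of the sources can only use measurability with respect to the configuration
  itself; measurability on \<open>M\<close> would be too weak.\<close>

lemma tier_radii_measurable_vimage: "l \<le> K \<Longrightarrow> (\<lambda>\<omega>. tier_radii l \<omega> i) \<in> borel_measurable (vimage_algebra (space M) (tier_points l) pp_space)"
  unfolding tier_radii_def by (rule measurable_radii) (auto intro!: measurable_vimage_algebra1 locally_finite_tier_points)

lemma tier_radii_measurable_others: "l \<le> K \<Longrightarrow> s \<noteq> point_source l \<Longrightarrow> (\<lambda>\<omega>. tier_radii l \<omega> i) \<in> borel_measurable (others s)"
  by (rule measurable_others[OF tier_radii_measurable_vimage]) (auto simp: src_sigma_point_source point_source_in_index)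

lemma fading_measurable_others:
  assumes "l \<le> K" "s \<noteq> fading_source l i"
  shows "(\<lambda>\<omega>. fading l \<omega> i) \<in> borel_measurable (others s)"
proof (rule measurable_others)
  show "(\<lambda>\<omega>. fading l \<omega> i) \<in> borel_measurable (vimage_algebra (space M) (\<lambda>\<omega>. fading l \<omega> i) borel)"
    by (rule measurable_vimage_algebra1) simp
qed (use assms in \<open>auto simp: src_sigma_fading_source fading_source_in_index\<close>)

lemma tier_radii_measurable [measurable]: "l \<le> K \<Longrightarrow> (\<lambda>\<omega>. tier_radii l \<omega> i) \<in> borel_measurable M"
  unfolding tier_radii_def by (rule poisson_pp_measurable_radii[OF pp])

lemma fading_measurable [measurable]: "l \<le> K \<Longrightarrow> (\<lambda>\<omega>. fading l \<omega> i) \<in> borel_measurable M"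
  using fading_distributed by (auto simp: distributed_def)

lemma fading_pos_measurable [measurable]: "l \<le> K \<Longrightarrow> (\<lambda>\<omega>. fading_pos l \<omega> i) \<in> borel_measurable M"
  unfolding fading_pos_def by measurable

lemma fading_pos_measurable_others: "l \<le> K \<Longrightarrow> s \<noteq> fading_source l i \<Longrightarrow> (\<lambda>\<omega>. fading_pos l \<omega> i) \<in> borel_measurable (others s)"
  unfolding fading_pos_def using fading_measurable_others[of l s i] by measurable

lemma gain_measurable [measurable]: "gain l \<in> borel_measurable borel"
  unfolding gain_def by measurable

lemma indep_fading:
  assumes l: "l \<le> K" and W: "W \<in> borel_measurable (others (fading_source l i))" "Z \<in> borel_measurable (others (fading_source l i))"
  shows "indep_pair borel (\<lambda>\<omega>. fading l \<omega> i) (borel \<Otimes>\<^sub>M borel) (\<lambda>\<omega>. (W \<omega> :: real, Z \<omega> :: real))"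
proof (rule indep_sets_imp_indep_pair[OF indep fading_source_in_index[OF l] src_sigma_Int_stable])
  have "(\<lambda>\<omega>. fading l \<omega> i) \<in> borel_measurable (vimage_algebra (space M) (\<lambda>\<omega>. fading l \<omega> i) borel)"
    by (rule measurable_vimage_algebra1) simp
  then show "(\<lambda>\<omega>. fading l \<omega> i) \<in> borel_measurable (sigma (space M) (src_sigma M No Psi Nc Psic (fading_source l i)))"
    by (rule measurable_sets_mono)
      (use src_sigma_subset[of "fading_source l i"] in \<open>auto simp: space_measure_of sets_measure_of src_sigma_fading_source intro: sigma_sets.Basic\<close>)
  show "(\<lambda>\<omega>. (W \<omega>, Z \<omega>)) \<in> sigma (space M) (\<Union> (src_sigma M No Psi Nc Psic ` (src_index K - {fading_source l i}))) \<rightarrow>\<^sub>M borel \<Otimes>\<^sub>M borel"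
    unfolding others_def[symmetric] using W by measurable
qed

text \<open>The whole sequence of radii is one random element, since a product over a tier depends
  on all of them at once.\<close>

lemma indep_points:
  assumes l: "l \<le> K" and W: "W \<in> borel_measurable (others (point_source l))" "Z \<in> borel_measurable (others (point_source l))"
  shows "indep_pair (PiM UNIV (\<lambda>_. borel)) (tier_radii l) (borel \<Otimes>\<^sub>M borel) (\<lambda>\<omega>. (W \<omega> :: real, Z \<omega> :: real))"
proof (rule indep_sets_imp_indep_pair[OF indep point_source_in_index[OF l] src_sigma_Int_stable])
  have "tier_radii l \<in> measurable (vimage_algebra (space M) (tier_points l) pp_space) (PiM UNIV (\<lambda>_. borel))"
    by (rule borel_measurable_PiM_seq) (rule tier_radii_measurable_vimage[OF l])
  then show "tier_radii l \<in> measurable (sigma (space M) (src_sigma M No Psi Nc Psic (point_source l))) (PiM UNIV (\<lambda>_. borel))"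
    by (rule measurable_sets_mono)
      (use src_sigma_subset[of "point_source l"] in \<open>auto simp: space_measure_of sets_measure_of src_sigma_point_source intro: sigma_sets.Basic\<close>)
  show "(\<lambda>\<omega>. (W \<omega>, Z \<omega>)) \<in> sigma (space M) (\<Union> (src_sigma M No Psi Nc Psic ` (src_index K - {point_source l}))) \<rightarrow>\<^sub>M borel \<Otimes>\<^sub>M borel"
    unfolding others_def[symmetric] using W by measurable
qed

text \<open>Induction over the stations, averaging one fading at a time. The factor obtained depends
  on positions only and moves into the weight, which is why \<open>U\<close> is general and has to
  be measurable without any given fading.\<close>

lemma expectation_fading_laplace:
  assumes J: "finite J" "J \<subseteq> {..K} \<times> UNIV"
    and U: "\<And>\<omega>. 0 \<le> U \<omega>" "\<And>\<omega>. U \<omega> \<le> 1" "\<And>l i. l \<le> K \<Longrightarrow> U \<in> borel_measurable (others (fading_source l i))"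
    and s: "\<And>\<omega>. 0 \<le> s \<omega>" "\<And>l i. l \<le> K \<Longrightarrow> s \<in> borel_measurable (others (fading_source l i))"
  shows "expectation (\<lambda>\<omega>. U \<omega> * exp (- (s \<omega> * (\<Sum>(l, i)\<in>J. gain l (tier_radii l \<omega> i) * fading_pos l \<omega> i)))) =
    expectation (\<lambda>\<omega>. U \<omega> * (\<Prod>(l, i)\<in>J. 1 / (1 + s \<omega> * gain l (tier_radii l \<omega> i))))"
  using J U
proof (induction J arbitrary: U rule: finite_induct)
  case (insert j J)
  obtain l i where j: "j = (l, i)" by (cases j)
  have l: "l \<le> K" and J: "J \<subseteq> {..K} \<times> UNIV" using insert.prems by (auto simp: j)
  define A where "A \<omega> = (\<Sum>(l, i)\<in>J. gain l (tier_radii l \<omega> i) * fading_pos l \<omega> i)" for \<omega>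
  have A0: "0 \<le> A \<omega>" for \<omega>
    unfolding A_def using J by (intro sum_nonneg) (auto intro!: mult_nonneg_nonneg gain_nonneg fading_pos_nonneg)
  \<comment> \<open>No station occurs twice, so the remaining sum does not involve the fading that
    is being averaged.\<close>
  have Am: "A \<in> borel_measurable (others (fading_source l i))"
    unfolding A_def
  proof (rule borel_measurable_sum)
    fix x assume x: "x \<in> J"
    obtain l' i' where x': "x = (l', i')" by (cases x)
    have l': "l' \<le> K" using x J by (auto simp: x')
    have "fading_source l i \<noteq> fading_source l' i'" using x insert.hyps by (auto simp: x' j)
    note [measurable] = tier_radii_measurable_others[OF l', of "fading_source l i"] fading_pos_measurable_others[OF l' this]
    show "(\<lambda>\<omega>. case x of (l, i) \<Rightarrow> gain l (tier_radii l \<omega> i) * fading_pos l \<omega> i) \<in> borel_measurable (others (fading_source l i))"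
      unfolding x' by simp
  qed
  define V where "V \<omega> = U \<omega> * (1 / (1 + s \<omega> * gain l (tier_radii l \<omega> i)))" for \<omega>
  have sg: "0 \<le> s \<omega> * gain l (tier_radii l \<omega> i)" for \<omega>
    using s(1) gain_nonneg[OF l] by simp
  have f01: "0 \<le> 1 / (1 + s \<omega> * gain l (tier_radii l \<omega> i))" "1 / (1 + s \<omega> * gain l (tier_radii l \<omega> i)) \<le> 1" for \<omega>
    using sg[of \<omega>] by auto
  have sgm: "(\<lambda>\<omega>. s \<omega> * gain l (tier_radii l \<omega> i)) \<in> borel_measurable (others (fading_source l' i'))" if l': "l' \<le> K" for l' i'
  proof -
    note [measurable] = tier_radii_measurable_others[OF l, of "fading_source l' i'"] s(2)[OF l']
    show ?thesis by simp
  qed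
  have "expectation (\<lambda>\<omega>. U \<omega> * exp (- (s \<omega> * (\<Sum>(l, i)\<in>insert j J. gain l (tier_radii l \<omega> i) * fading_pos l \<omega> i)))) =
     expectation (\<lambda>\<omega>. (U \<omega> * exp (- (s \<omega> * A \<omega>))) * exp (- ((s \<omega> * gain l (tier_radii l \<omega> i)) * max 0 (fading l \<omega> i))))"
  proof (rule Bochner_Integration.integral_cong[OF refl])
    fix \<omega>
    have "(\<Sum>(l, i)\<in>insert j J. gain l (tier_radii l \<omega> i) * fading_pos l \<omega> i) = A \<omega> + gain l (tier_radii l \<omega> i) * max 0 (fading l \<omega> i)"
      using insert.hyps by (simp add: j A_def fading_pos_def)
    then show "U \<omega> * exp (- (s \<omega> * (\<Sum>(l, i)\<in>insert j J. gain l (tier_radii l \<omega> i) * fading_pos l \<omega> i))) =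
      (U \<omega> * exp (- (s \<omega> * A \<omega>))) * exp (- ((s \<omega> * gain l (tier_radii l \<omega> i)) * max 0 (fading l \<omega> i)))"
      by (simp add: mult.assoc exp_add[symmetric] distrib_left)
  qed
  also have "\<dots> = expectation (\<lambda>\<omega>. (U \<omega> * exp (- (s \<omega> * A \<omega>))) * (1 / (1 + s \<omega> * gain l (tier_radii l \<omega> i))))"
  proof (rule expectation_indep_exponential_laplace[OF fading_distributed[OF l] indep_fading[OF l _ sgm[OF l]]])
    note [measurable] = Am insert.prems(4)[OF l, of i] s(2)[OF l, of i]
    show "(\<lambda>\<omega>. U \<omega> * exp (- (s \<omega> * A \<omega>))) \<in> borel_measurable (others (fading_source l i))"
      by measurable
    show "0 \<le> U \<omega> * exp (- (s \<omega> * A \<omega>))" "U \<omega> * exp (- (s \<omega> * A \<omega>)) \<le> 1" for \<omega>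
      using insert.prems(2,3) s(1)[of \<omega>] A0[of \<omega>] by (auto intro!: mult_le_one)
  qed (rule sg)
  also have "\<dots> = expectation (\<lambda>\<omega>. V \<omega> * exp (- (s \<omega> * (\<Sum>(l, i)\<in>J. gain l (tier_radii l \<omega> i) * fading_pos l \<omega> i))))"
    by (simp add: V_def A_def mult_ac)
  also have "\<dots> = expectation (\<lambda>\<omega>. V \<omega> * (\<Prod>(l, i)\<in>J. 1 / (1 + s \<omega> * gain l (tier_radii l \<omega> i))))"
  proof (rule insert.IH[OF J])
    show "0 \<le> V \<omega>" "V \<omega> \<le> 1" for \<omega>
      unfolding V_def using insert.prems(2,3) f01 by (auto intro!: mult_le_one mult_nonneg_nonneg simp del: times_divide_eq_right)
    show "V \<in> borel_measurable (others (fading_source l' i'))" if "l' \<le> K" for l' i'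
    proof -
      note [measurable] = insert.prems(4)[OF that, of i'] sgm[OF that, of i']
      show ?thesis unfolding V_def by measurable
    qed
  qed
  also have "\<dots> = expectation (\<lambda>\<omega>. U \<omega> * (\<Prod>(l, i)\<in>insert j J. 1 / (1 + s \<omega> * gain l (tier_radii l \<omega> i))))"
    using insert.hyps by (simp add: V_def j mult_ac)
  finally show ?case .
qed simp

end

section \<open>Almost sure finiteness of the received power\<close>

lemma one_minus_fading_factor:
  assumes u: "u \<in> {0<..}" and s: "0 < (s::real)"
  shows "1 - 1 / (1 + s * sqrt u powr - e) = s / (s + u powr (e / 2))"
proof -
  have "sqrt u powr - e = 1 / u powr (e / 2)"
  proof -
    have "sqrt u powr - e = (u powr (1 / 2)) powr - e"
      using u by (simp add: powr_half_sqrt)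
    also have "\<dots> = u powr - (e / 2)"
      by (simp add: powr_powr)
    also have "\<dots> = 1 / u powr (e / 2)"
      by (rule powr_minus_divide)
    finally show ?thesis .
  qed
  moreover have "1 - 1 / (1 + s * (1 / x)) = s / (s + x)" if "0 < x" for x
  proof -
    have "1 + s * (1 / x) = (s + x) / x"
      using that by (simp add: field_simps)
    moreover have "0 < s + x" using that s by simp
    ultimately show ?thesis by (simp add: field_simps)
  qed
  moreover have "0 < u powr (e / 2)" using u by simp
  ultimately show ?thesis by simp
qed

text \<open>In the squared distance the deficit of one station is
  \<open>s / (s + u powr (e / 2))\<close>, the rational integrand evaluated before.\<close>

lemma integral_one_minus_fading_factor:
  assumes e: "2 < e" and s: "0 < (s::real)"
  shows "set_integrable lborel {0<..} (\<lambda>u. 1 - 1 / (1 + s * sqrt u powr - e))"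
    and "(LINT u:{0<..}|lborel. 1 - 1 / (1 + s * sqrt u powr - e)) = s powr (2 / e) / sinc (2 * pi / e)"
proof -
  note eq = one_minus_fading_factor[OF _ s, of _ e]
  show "set_integrable lborel {0<..} (\<lambda>u. 1 - 1 / (1 + s * sqrt u powr - e))"
    using integral_rational_powr(1)[of "e / 2" s] assms by (simp only: set_integrable_cong[OF refl refl eq])
  have "(LINT u:{0<..}|lborel. 1 - 1 / (1 + s * sqrt u powr - e)) = (LINT u:{0<..}|lborel. s / (s + u powr (e / 2)))"
    by (intro set_lebesgue_integral_cong allI impI eq) auto
  then show "(LINT u:{0<..}|lborel. 1 - 1 / (1 + s * sqrt u powr - e)) = s powr (2 / e) / sinc (2 * pi / e)"
    using integral_rational_powr_sinc[OF assms] by simp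
qed

context cellular_network
begin

text \<open>The Laplace transform at \<open>s\<close> of the total received power bounds the probability that it
  is finite from below, and it tends to \<open>1\<close> as \<open>s\<close> tends to \<open>0\<close>.\<close>

lemma AE_summable_received_power:
  assumes l: "l \<le> K"
  shows "AE \<omega> in M. summable (\<lambda>i. gain l (tier_radii l \<omega> i) * fading_pos l \<omega> i)"
proof -
  define f where "f \<omega> i = gain l (tier_radii l \<omega> i) * fading_pos l \<omega> i" for \<omega> i
  note [measurable] = tier_radii_measurable[OF l] fading_pos_measurable[OF l]
  have [measurable]: "(\<lambda>\<omega>. f \<omega> i) \<in> borel_measurable M" for i
    unfolding f_def by measurable
  have f0: "0 \<le> f \<omega> i" for \<omega> i
    unfolding f_def by (intro mult_nonneg_nonneg gain_nonneg fading_pos_nonneg l)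
  define A where "A = {\<omega>\<in>space M. (\<Sum>i. ennreal (f \<omega> i)) \<noteq> top}"
  have A[measurable]: "A \<in> sets M" unfolding A_def by measurable
  have Asum: "\<omega> \<in> A \<longleftrightarrow> summable (f \<omega>)" if "\<omega> \<in> space M" for \<omega>
  proof -
    have "summable (f \<omega>) \<Longrightarrow> (\<Sum>i. ennreal (f \<omega> i)) \<noteq> top"
      using f0 by (intro ennreal_suminf_neq_top)
    moreover have "(\<Sum>i. ennreal (f \<omega> i)) \<noteq> top \<Longrightarrow> summable (f \<omega>)"
      by (rule summable_suminf_not_top[OF f0])
    ultimately show ?thesis using that by (auto simp: A_def)
  qed
  define S where "S n \<omega> = (\<Sum>i<n. f \<omega> i)" for n \<omega>
  have S0: "0 \<le> S n \<omega>" for n \<omega>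
    unfolding S_def by (intro sum_nonneg f0)
  have [measurable]: "S n \<in> borel_measurable M" for n
    unfolding S_def by measurable
  \<comment> \<open>\<open>c * s powr (2 / tier_exponent l)\<close> is the exponent in the Laplace
    transform of the total power of the tier at \<open>s\<close>.\<close>
  define c where "c = tier_intensity l * pi * tier_power l powr (2 / tier_exponent l) / sinc (2 * pi / tier_exponent l)"
  have e: "2 < tier_exponent l" "0 < tier_power l" using tier_exponent_gt_2[OF l] tier_power_pos[OF l] by auto
  \<comment> \<open>The bound is uniform in \<open>n\<close>, because the infinite product lies
    below each finite one.\<close>
  have low: "exp (- (c * s powr (2 / tier_exponent l))) \<le> expectation (\<lambda>\<omega>. exp (- (s * S n \<omega>)))" if s: "0 < s" for s n
  proof -
    define v where "v y = 1 / (1 + (s * tier_power l) * y powr - tier_exponent l)" for y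
    have v: "v \<in> borel_measurable borel" "0 \<le> v y" "v y \<le> 1" for y
    proof -
      show "v \<in> borel_measurable borel" unfolding v_def by measurable
      have "0 \<le> s * tier_power l * y powr - tier_exponent l" using s e by simp
      then show "0 \<le> v y" "v y \<le> 1" by (auto simp: v_def)
    qed
    have sP: "0 < s * tier_power l" using s e by simp
    note int = integral_one_minus_fading_factor[OF e(1) sP]
    have fading_factor: "pfactor v (tier_radii l \<omega> i) = 1 / (1 + s * gain l (tier_radii l \<omega> i))" for \<omega> i
      by (simp add: pfactor_def v_def gain_def)
    have "exp (- (c * s powr (2 / tier_exponent l))) = exp (- (tier_intensity l * pi * (LINT u:{0<..}|lborel. 1 - v (sqrt u))))"
      using int(2) s e by (simp add: v_def c_def powr_mult)
    also have "\<dots> = expectation (\<lambda>\<omega>. rprod v (tier_radii l \<omega>))"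
      unfolding tier_radii_def using int(1) by (intro poisson_pp_pgfl_radial(2)[symmetric] pp l tier_intensity_nonneg v) (simp add: v_def)
    also have "\<dots> \<le> expectation (\<lambda>\<omega>. \<Prod>i<n. 1 / (1 + s * gain l (tier_radii l \<omega> i)))"
    proof (rule integral_mono_AE)
      show "integrable M (\<lambda>\<omega>. rprod v (tier_radii l \<omega>))"
      proof (rule integrable_const_bound[where B=1])
        show "(\<lambda>\<omega>. rprod v (tier_radii l \<omega>)) \<in> borel_measurable M"
          unfolding tier_radii_def using int(1) by (intro poisson_pp_pgfl_radial(1)[OF pp[OF l] tier_intensity_nonneg[OF l] v]) (simp add: v_def)
      qed (use rprod_nonneg[of v] rprod_le_1[of v] v in auto)
      have g: "0 \<le> s * gain l y" for y using s gain_nonneg[OF l] by simp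
      show "integrable M (\<lambda>\<omega>. \<Prod>i<n. 1 / (1 + s * gain l (tier_radii l \<omega> i)))"
        by (rule integrable_const_bound[where B=1])
          (use g in \<open>auto intro!: prod_le_1 simp: abs_prod divide_le_eq add_nonneg_nonneg abs_of_nonneg\<close>)
      show "AE \<omega> in M. rprod v (tier_radii l \<omega>) \<le> (\<Prod>i<n. 1 / (1 + s * gain l (tier_radii l \<omega> i)))"
        unfolding fading_factor[symmetric] by (intro AE_I2 rprod_le_prod v)
    qed
    also have "\<dots> = expectation (\<lambda>\<omega>. 1 * (\<Prod>(l, i)\<in>{l} \<times> {..<n}. 1 / (1 + s * gain l (tier_radii l \<omega> i))))"
      by (simp add: prod.cartesian_product[symmetric])
    also have "\<dots> = expectation (\<lambda>\<omega>. 1 * exp (- (s * (\<Sum>(l, i)\<in>{l} \<times> {..<n}. gain l (tier_radii l \<omega> i) * fading_pos l \<omega> i))))"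
      by (rule expectation_fading_laplace[symmetric]) (use l s in auto)
    also have "\<dots> = expectation (\<lambda>\<omega>. exp (- (s * S n \<omega>)))"
      by (simp add: sum.cartesian_product[symmetric] S_def f_def)
    finally show ?thesis .
  qed
  have up: "exp (- (c * s powr (2 / tier_exponent l))) \<le> prob A" if s: "0 < s" for s
  proof -
    \<comment> \<open>The limit of the truncated transforms. It is \<open>0\<close> where the power
      diverges, so its mean cannot exceed the probability of convergence.\<close>
    define Y where "Y \<omega> = indicator A \<omega> * exp (- (s * suminf (f \<omega>)))" for \<omega>
    have lim: "(\<lambda>n. exp (- (s * S n \<omega>))) \<longlonglongrightarrow> Y \<omega>" if w: "\<omega> \<in> space M" for \<omega>
    proof (cases "\<omega> \<in> A")
      case True
      then have "(\<lambda>n. S n \<omega>) \<longlonglongrightarrow> suminf (f \<omega>)"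
        unfolding S_def using Asum[OF w] by (intro summable_LIMSEQ) simp
      then have "(\<lambda>n. exp (- (s * S n \<omega>))) \<longlonglongrightarrow> exp (- (s * suminf (f \<omega>)))"
        by (intro tendsto_intros)
      then show ?thesis using True by (simp add: Y_def)
    next
      case False
      then have ns: "\<not> summable (f \<omega>)" using Asum[OF w] by simp
      have "filterlim (\<lambda>n. S n \<omega>) at_top sequentially"
        unfolding S_def
      proof (rule filterlim_at_top[THEN iffD2, rule_format])
        fix Z
        have "\<exists>n. Z \<le> (\<Sum>i<n. f \<omega> i)"
        proof (rule ccontr)
          assume "\<nexists>n. Z \<le> (\<Sum>i<n. f \<omega> i)"
          then have "(\<Sum>i<n. f \<omega> i) \<le> Z" for n
            using linear by blast
          then have "summable (f \<omega>)"
            by (intro summableI_nonneg_bounded f0)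
          with ns show False by simp
        qed
        then obtain n where n: "Z \<le> (\<Sum>i<n. f \<omega> i)" ..
        have "(\<Sum>i<n. f \<omega> i) \<le> (\<Sum>i<m. f \<omega> i)" if "n \<le> m" for m
          using that f0 by (intro sum_mono2) auto
        then show "\<forall>\<^sub>F m in sequentially. Z \<le> (\<Sum>i<m. f \<omega> i)"
          unfolding eventually_sequentially using n by (intro exI[of _ n]) (blast intro: order_trans)
      qed
      then have "filterlim (\<lambda>n. s * S n \<omega>) at_top sequentially"
        by (intro filterlim_tendsto_pos_mult_at_top[OF tendsto_const s])
      then have "((\<lambda>n. exp (- (s * S n \<omega>))) \<longlongrightarrow> 0) sequentially"
        by (intro filterlim_compose[OF exp_at_bot] filterlim_compose[OF filterlim_uminus_at_bot_at_top])
      then show ?thesis using False by (simp add: Y_def)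
    qed
    have [measurable]: "Y \<in> borel_measurable M"
      unfolding Y_def by measurable
    have Y1: "Y \<omega> \<le> indicator A \<omega>" "\<bar>Y \<omega>\<bar> \<le> 1" if w: "\<omega> \<in> space M" for \<omega>
    proof -
      have "0 \<le> suminf (f \<omega>)" if "\<omega> \<in> A"
        using Asum[OF w] that f0 by (intro suminf_nonneg) auto
      then show "Y \<omega> \<le> indicator A \<omega>" "\<bar>Y \<omega>\<bar> \<le> 1"
        using s by (auto simp: Y_def indicator_def)
    qed
    have "(\<lambda>n. expectation (\<lambda>\<omega>. exp (- (s * S n \<omega>)))) \<longlonglongrightarrow> expectation Y"
      by (rule integral_dominated_convergence[where w="\<lambda>_. 1"]) (use lim s S0 in auto)
    then have "exp (- (c * s powr (2 / tier_exponent l))) \<le> expectation Y"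
      using low[OF s] by (intro LIMSEQ_le_const) auto
    also have "expectation Y \<le> expectation (indicator A)"
      by (rule integral_mono_AE) (use Y1 in \<open>auto intro!: integrable_const_bound[where B=1] AE_I2\<close>)
    also have "\<dots> = prob A" by simp
    finally show ?thesis .
  qed
  have "exp (- (c * (1 / real (Suc n)))) \<le> prob A" for n
  proof -
    \<comment> \<open>This value of \<open>s\<close> makes
      \<open>s powr (2 / tier_exponent l)\<close> equal to \<open>1 / (n + 1)\<close>, which tends
      to \<open>0\<close>.\<close>
    have "((1 / real (Suc n)) powr (tier_exponent l / 2)) powr (2 / tier_exponent l) = 1 / real (Suc n)"
      using e by (simp add: powr_powr)
    then show ?thesis
      using up[of "(1 / real (Suc n)) powr (tier_exponent l / 2)"] by simp
  qed
  moreover have "(\<lambda>n. exp (- (c * (1 / real (Suc n))))) \<longlonglongrightarrow> exp (- (c * 0))"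
    by (intro tendsto_intros LIMSEQ_Suc[OF lim_1_over_n])
  ultimately have "exp (- (c * 0)) \<le> prob A"
    by (intro LIMSEQ_le_const2) auto
  then have "prob A = 1"
    using prob_le_1[of A] by simp
  then have "AE \<omega> in M. \<omega> \<in> A"
    by (simp add: prob_eq_1)
  with AE_space show ?thesis
    by eventually_elim (use Asum in \<open>auto simp: f_def[abs_def]\<close>)
qed

section \<open>Coverage by a fixed tier as an expected product over positions\<close>

definition laplace_arg :: "nat \<Rightarrow> real \<Rightarrow> real" where "laplace_arg k t = \<beta> k * t powr tier_exponent k / tier_power k"
text \<open>The distance \<open>r\<close> at which tier \<open>l\<close> is received on average as
  strongly as tier \<open>k\<close> at distance \<open>t\<close>: the solution of \<open>tier_power
  l * r powr - tier_exponent l = tier_power k * t powr - tier_exponent k\<close>.\<close>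

definition exclusion_radius :: "nat \<Rightarrow> nat \<Rightarrow> real \<Rightarrow> real" where "exclusion_radius k l t = (tier_power l * t powr tier_exponent k / tier_power k) powr (1 / tier_exponent l)"
text \<open>Testing every station of the other tiers, not only the nearest one, makes the condition
  a product over stations that can be merged with the fading factors.\<close>

definition serving :: "nat \<Rightarrow> 'a \<Rightarrow> bool" where
  "serving k \<omega> \<longleftrightarrow> (\<forall>l\<in>{1..K} - {k}. \<forall>i. 0 \<le> tier_radii l \<omega> i \<longrightarrow> exclusion_radius k l (tier_radii k \<omega> 0) < tier_radii l \<omega> i)"
definition interferer :: "nat \<Rightarrow> nat \<Rightarrow> 'a \<Rightarrow> nat \<Rightarrow> real" where
  "interferer k l \<omega> i = (if (l, i) = (k, 0) then 0 else gain l (tier_radii l \<omega> i) * fading_pos l \<omega> i)"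
definition interference :: "nat \<Rightarrow> 'a \<Rightarrow> real" where
  "interference k \<omega> = (\<Sum>l\<le>K. suminf (interferer k l \<omega>))"
definition fading_factor :: "nat \<Rightarrow> nat \<Rightarrow> 'a \<Rightarrow> nat \<Rightarrow> real" where
  "fading_factor k l \<omega> i = (if (l, i) = (k, 0) then 1 else 1 / (1 + laplace_arg k (tier_radii k \<omega> 0) * gain l (tier_radii l \<omega> i)))"

lemma laplace_arg_nonneg: "k \<in> {1..K} \<Longrightarrow> 0 \<le> laplace_arg k t"
  using beta[of k] tier_power_pos[of k] by (auto simp: laplace_arg_def)

lemma fading_factor_01:
  assumes "k \<in> {1..K}" "l \<le> K"
  shows "0 \<le> fading_factor k l \<omega> i" "fading_factor k l \<omega> i \<le> 1"
proof -
  have "0 \<le> laplace_arg k (tier_radii k \<omega> 0) * gain l (tier_radii l \<omega> i)"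
    using laplace_arg_nonneg[OF assms(1)] gain_nonneg[OF assms(2)] by simp
  then show "0 \<le> fading_factor k l \<omega> i" "fading_factor k l \<omega> i \<le> 1" by (auto simp: fading_factor_def)
qed

text \<open>\<open>A\<close> stays general because the fact is needed both for \<open>M\<close> and
  for the sigma-algebras that leave out one fading.\<close>

lemma serving_measurable:
  assumes k: "k \<in> {1..K}" and A: "\<And>l i. l \<in> {1..K} \<Longrightarrow> (\<lambda>\<omega>. tier_radii l \<omega> i) \<in> borel_measurable A"
  shows "(\<lambda>\<omega>. if serving k \<omega> then 1 else 0 :: real) \<in> borel_measurable A"
proof -
  note [measurable] = A[OF k]
  have [measurable]: "Measurable.pred A (\<lambda>\<omega>. \<forall>l\<in>{1..K} - {k}. \<forall>i. 0 \<le> tier_radii l \<omega> i \<longrightarrow> exclusion_radius k l (tier_radii k \<omega> 0) < tier_radii l \<omega> i)"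
  proof (intro pred_intros_finite pred_intros_countable)
    fix l i assume l: "l \<in> {1..K} - {k}"
    note [measurable] = A[of l i]
    have "l \<in> {1..K}" using l by simp
    then show "Measurable.pred A (\<lambda>\<omega>. 0 \<le> tier_radii l \<omega> i \<longrightarrow> exclusion_radius k l (tier_radii k \<omega> 0) < tier_radii l \<omega> i)"
      unfolding exclusion_radius_def by measurable
  qed simp
  show ?thesis
    unfolding serving_def by measurable
qed

lemma AE_interferer_summable:
  assumes k: "k \<in> {1..K}"
  shows "AE \<omega> in M. \<forall>l\<le>K. summable (interferer k l \<omega>)"
proof -
  have "AE \<omega> in M. \<forall>l\<in>{..K}. summable (\<lambda>i. gain l (tier_radii l \<omega> i) * fading_pos l \<omega> i)"
    by (intro AE_finite_allI AE_summable_received_power) auto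
  then show ?thesis
  proof eventually_elim
    fix \<omega> assume *: "\<forall>l\<in>{..K}. summable (\<lambda>i. gain l (tier_radii l \<omega> i) * fading_pos l \<omega> i)"
    show "\<forall>l\<le>K. summable (interferer k l \<omega>)"
    proof (intro allI impI)
      fix l assume l: "l \<le> K"
      have "\<forall>\<^sub>F i in sequentially. interferer k l \<omega> i = gain l (tier_radii l \<omega> i) * fading_pos l \<omega> i"
        unfolding eventually_sequentially by (intro exI[of _ 1]) (auto simp: interferer_def)
      from summable_cong[OF this] show "summable (interferer k l \<omega>)"
        using * l by simp
    qed
  qed
qed

lemma interferer_nonneg: "l \<le> K \<Longrightarrow> 0 \<le> interferer k l \<omega> i"
  using gain_nonneg fading_pos_nonneg by (simp add: interferer_def)

lemma interference_nonneg:
  assumes "\<forall>l\<le>K. summable (interferer k l \<omega>)"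
  shows "0 \<le> interference k \<omega>"
  unfolding interference_def using assms by (intro sum_nonneg suminf_nonneg) (auto intro: interferer_nonneg)

text \<open>The tail of the serving fading gives \<open>exp (- Z)\<close>. The other fadings are
  averaged for the first \<open>n\<close> stations of every tier; then \<open>n\<close> tends to
  infinity on both sides, where the sums increase to the interference and the products decrease to
  their limits.\<close>

lemma coverage_as_product:
  assumes k: "k \<in> {1..K}"
  shows "expectation (\<lambda>\<omega>. if serving k \<omega> \<and> laplace_arg k (tier_radii k \<omega> 0) * (interference k \<omega> + \<eta>) < fading k \<omega> 0 then 1 else 0) =
    expectation (\<lambda>\<omega>. (if serving k \<omega> then 1 else 0) * exp (- (laplace_arg k (tier_radii k \<omega> 0) * \<eta>)) *
       (\<Prod>l\<le>K. lim (\<lambda>n. \<Prod>i<n. fading_factor k l \<omega> i)))"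
proof -
  have kK: "k \<le> K" using k by simp
  note [measurable] = tier_radii_measurable fading_pos_measurable fading_measurable[OF kK]
  define W where "W \<omega> = (if serving k \<omega> then 1 else 0 :: real)" for \<omega>
  \<comment> \<open>Solving the SINR inequality for the serving fading gives the threshold
    \<open>s \<omega> * (interference k \<omega> + \<eta>)\<close>.\<close>
  define s where "s \<omega> = laplace_arg k (tier_radii k \<omega> 0)" for \<omega>
  define U where "U \<omega> = W \<omega> * exp (- (s \<omega> * \<eta>))" for \<omega>
  \<comment> \<open>Where a series diverges \<open>interference\<close> is unspecified and might be
    negative. The maximum keeps \<open>Z\<close> nonnegative for all outcomes and changes it on a
    null set only.\<close>
  define Z where "Z \<omega> = max 0 (s \<omega> * (interference k \<omega> + \<eta>))" for \<omega>
  have s0: "0 \<le> s \<omega>" for \<omega>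
    using laplace_arg_nonneg[OF k] by (simp add: s_def)
  have W01: "0 \<le> W \<omega>" "W \<omega> \<le> 1" for \<omega> by (auto simp: W_def)
  have U01: "0 \<le> U \<omega>" "U \<omega> \<le> 1" for \<omega>
    using W01 s0 eta by (auto simp: U_def intro!: mult_le_one)
  have sm: "s \<in> borel_measurable (others (fading_source l i))" for l i
  proof -
    note [measurable] = tier_radii_measurable_others[OF kK, of "fading_source l i"]
    show ?thesis unfolding s_def laplace_arg_def by simp
  qed
  have Wm: "W \<in> borel_measurable (others (fading_source l i))" for l i
    unfolding W_def by (rule serving_measurable[OF k]) (auto intro!: tier_radii_measurable_others)
  have Um: "U \<in> borel_measurable (others (fading_source l i))" for l i
  proof -
    note [measurable] = sm[of l i] Wm[of l i]
    show ?thesis unfolding U_def by measurable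
  qed
  note [measurable] = measurable_others_M[OF sm] measurable_others_M[OF Wm] measurable_others_M[OF Um]
  have Im: "interference k \<in> borel_measurable (others (fading_source k 0))"
    unfolding interference_def
  proof (intro borel_measurable_sum borel_measurable_suminf)
    fix l i assume "l \<in> {..K}"
    then have l: "l \<le> K" by simp
    show "(\<lambda>\<omega>. interferer k l \<omega> i) \<in> borel_measurable (others (fading_source k 0))"
    proof (cases "(l, i) = (k, 0)")
      case True
      then show ?thesis by (simp add: interferer_def)
    next
      case False
      then have "fading_source k 0 \<noteq> fading_source l i" by auto
      note [measurable] = tier_radii_measurable_others[OF l, of "fading_source k 0"] fading_pos_measurable_others[OF l this]
      show ?thesis using False by (simp add: interferer_def)
    qed
  qed
  have Zm: "Z \<in> borel_measurable (others (fading_source k 0))"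
  proof -
    note [measurable] = sm[of k 0] Im
    show ?thesis unfolding Z_def by measurable
  qed
  have Zeq: "AE \<omega> in M. Z \<omega> = s \<omega> * (interference k \<omega> + \<eta>)"
    using AE_interferer_summable[OF k]
  proof eventually_elim
    fix \<omega> assume "\<forall>l\<le>K. summable (interferer k l \<omega>)"
    then show "Z \<omega> = s \<omega> * (interference k \<omega> + \<eta>)"
      using interference_nonneg[of k \<omega>] s0[of \<omega>] eta by (simp add: Z_def)
  qed
  note [measurable] = measurable_others_M[OF Zm] measurable_others_M[OF Im]
  \<comment> \<open>The serving station is left out, as its fading is integrated separately through
    the exponential tail.\<close>
  define J where "J n = {..K} \<times> {..<n} - {(k, 0::nat)}" for n
  have J: "finite (J n)" "J n \<subseteq> {..K} \<times> UNIV" for n by (auto simp: J_def)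
  have facm: "(\<lambda>\<omega>. fading_factor k l \<omega> i) \<in> borel_measurable M" if "l \<le> K" for l i
  proof (cases "(l, i) = (k, 0)")
    case True
    then show ?thesis by (simp add: fading_factor_def)
  next
    case False
    note [measurable] = tier_radii_measurable[OF that, of i] tier_radii_measurable[OF kK, of 0]
    show ?thesis unfolding fading_factor_def laplace_arg_def if_not_P[OF False] by measurable
  qed
  have sumJ: "(\<Sum>(l, i)\<in>J n. gain l (tier_radii l \<omega> i) * fading_pos l \<omega> i) = (\<Sum>l\<le>K. \<Sum>i<n. interferer k l \<omega> i)" for n \<omega>
  proof -
    have "(\<Sum>(l, i)\<in>J n. gain l (tier_radii l \<omega> i) * fading_pos l \<omega> i) = (\<Sum>(l, i)\<in>{..K} \<times> {..<n}. interferer k l \<omega> i)"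
      by (rule sum.mono_neutral_cong_left) (auto simp: J_def interferer_def split: if_splits)
    then show ?thesis by (simp add: sum.cartesian_product)
  qed
  have prodJ: "(\<Prod>(l, i)\<in>J n. 1 / (1 + s \<omega> * gain l (tier_radii l \<omega> i))) = (\<Prod>l\<le>K. \<Prod>i<n. fading_factor k l \<omega> i)" for n \<omega>
  proof -
    have "(\<Prod>(l, i)\<in>J n. 1 / (1 + s \<omega> * gain l (tier_radii l \<omega> i))) = (\<Prod>(l, i)\<in>{..K} \<times> {..<n}. fading_factor k l \<omega> i)"
      by (rule prod.mono_neutral_cong_left) (auto simp: J_def fading_factor_def s_def split: if_splits)
    then show ?thesis by (simp add: prod.cartesian_product)
  qed
  have "expectation (\<lambda>\<omega>. if serving k \<omega> \<and> laplace_arg k (tier_radii k \<omega> 0) * (interference k \<omega> + \<eta>) < fading k \<omega> 0 then 1 else 0) =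
      expectation (\<lambda>\<omega>. W \<omega> * (if s \<omega> * (interference k \<omega> + \<eta>) < fading k \<omega> 0 then 1 else 0))"
    by (intro Bochner_Integration.integral_cong) (auto simp: W_def s_def)
  also have "\<dots> = expectation (\<lambda>\<omega>. W \<omega> * (if Z \<omega> < fading k \<omega> 0 then 1 else 0))"
    using Zeq by (intro integral_cong_AE) (measurable, auto elim!: eventually_mono)
  also have "\<dots> = expectation (\<lambda>\<omega>. W \<omega> * exp (- Z \<omega>))"
    by (rule expectation_indep_exponential_gt[OF fading_distributed[OF kK] indep_fading[OF kK Wm Zm] W01])
      (simp add: Z_def)
  finally have 1: "expectation (\<lambda>\<omega>. if serving k \<omega> \<and> laplace_arg k (tier_radii k \<omega> 0) * (interference k \<omega> + \<eta>) < fading k \<omega> 0 then 1 else 0) =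
    expectation (\<lambda>\<omega>. W \<omega> * exp (- Z \<omega>))" .
  have "(\<lambda>n. expectation (\<lambda>\<omega>. U \<omega> * exp (- (s \<omega> * (\<Sum>l\<le>K. \<Sum>i<n. interferer k l \<omega> i))))) \<longlonglongrightarrow> expectation (\<lambda>\<omega>. W \<omega> * exp (- Z \<omega>))"
  proof (rule integral_dominated_convergence[where w="\<lambda>_. 1"])
    have im: "(\<lambda>\<omega>. interferer k l \<omega> i) \<in> borel_measurable M" if "l \<le> K" for l i
      unfolding interferer_def using that by measurable
    show "(\<lambda>\<omega>. U \<omega> * exp (- (s \<omega> * (\<Sum>l\<le>K. \<Sum>i<n. interferer k l \<omega> i)))) \<in> borel_measurable M" for n
    proof -
      have [measurable]: "(\<lambda>\<omega>. \<Sum>l\<le>K. \<Sum>i<n. interferer k l \<omega> i) \<in> borel_measurable M"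
        by (intro borel_measurable_sum im) simp
      show ?thesis by measurable
    qed
    show "AE \<omega> in M. norm (U \<omega> * exp (- (s \<omega> * (\<Sum>l\<le>K. \<Sum>i<n. interferer k l \<omega> i)))) \<le> 1" for n
      using U01 s0 by (intro AE_I2) (auto intro!: mult_le_one mult_nonneg_nonneg sum_nonneg interferer_nonneg simp: abs_mult)
    show "AE \<omega> in M. (\<lambda>n. U \<omega> * exp (- (s \<omega> * (\<Sum>l\<le>K. \<Sum>i<n. interferer k l \<omega> i)))) \<longlonglongrightarrow> W \<omega> * exp (- Z \<omega>)"
      using AE_interferer_summable[OF k] Zeq
    proof eventually_elim
      fix \<omega> assume sm: "\<forall>l\<le>K. summable (interferer k l \<omega>)" and Z: "Z \<omega> = s \<omega> * (interference k \<omega> + \<eta>)"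
      have "(\<lambda>n. U \<omega> * exp (- (s \<omega> * (\<Sum>l\<le>K. \<Sum>i<n. interferer k l \<omega> i)))) \<longlonglongrightarrow> U \<omega> * exp (- (s \<omega> * interference k \<omega>))"
        unfolding interference_def using sm by (intro tendsto_intros summable_LIMSEQ) simp
      also have "U \<omega> * exp (- (s \<omega> * interference k \<omega>)) = W \<omega> * exp (- Z \<omega>)"
        by (simp add: U_def Z mult.assoc exp_add[symmetric] distrib_left)
      finally show "(\<lambda>n. U \<omega> * exp (- (s \<omega> * (\<Sum>l\<le>K. \<Sum>i<n. interferer k l \<omega> i)))) \<longlonglongrightarrow> W \<omega> * exp (- Z \<omega>)" .
    qed
  qed auto
  moreover have "expectation (\<lambda>\<omega>. U \<omega> * exp (- (s \<omega> * (\<Sum>l\<le>K. \<Sum>i<n. interferer k l \<omega> i)))) = expectation (\<lambda>\<omega>. U \<omega> * (\<Prod>l\<le>K. \<Prod>i<n. fading_factor k l \<omega> i))" for n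
    using expectation_fading_laplace[OF J U01 Um s0 sm, of n] by (simp add: sumJ prodJ)
  moreover have "(\<lambda>n. expectation (\<lambda>\<omega>. U \<omega> * (\<Prod>l\<le>K. \<Prod>i<n. fading_factor k l \<omega> i))) \<longlonglongrightarrow>
     expectation (\<lambda>\<omega>. U \<omega> * (\<Prod>l\<le>K. lim (\<lambda>n. \<Prod>i<n. fading_factor k l \<omega> i)))"
  proof (rule integral_dominated_convergence[where w="\<lambda>_. 1"])
    show "(\<lambda>\<omega>. U \<omega> * (\<Prod>l\<le>K. \<Prod>i<n. fading_factor k l \<omega> i)) \<in> borel_measurable M" for n
    proof -
      have [measurable]: "(\<lambda>\<omega>. \<Prod>l\<le>K. \<Prod>i<n. fading_factor k l \<omega> i) \<in> borel_measurable M"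
        by (intro borel_measurable_prod facm) simp
      show ?thesis by measurable
    qed
    have [measurable]: "(\<lambda>\<omega>. \<Prod>l\<le>K. lim (\<lambda>n. \<Prod>i<n. fading_factor k l \<omega> i)) \<in> borel_measurable M"
      by (intro borel_measurable_prod borel_measurable_lim_metric facm) simp
    show "(\<lambda>\<omega>. U \<omega> * (\<Prod>l\<le>K. lim (\<lambda>n. \<Prod>i<n. fading_factor k l \<omega> i))) \<in> borel_measurable M"
      by measurable
    show "AE \<omega> in M. norm (U \<omega> * (\<Prod>l\<le>K. \<Prod>i<n. fading_factor k l \<omega> i)) \<le> 1" for n
    proof (rule AE_I2)
      fix \<omega>
      have "0 \<le> (\<Prod>l\<le>K. \<Prod>i<n. fading_factor k l \<omega> i)" "(\<Prod>l\<le>K. \<Prod>i<n. fading_factor k l \<omega> i) \<le> 1"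
        using fading_factor_01[OF k] by (auto intro!: prod_nonneg prod_le_1)
      then show "norm (U \<omega> * (\<Prod>l\<le>K. \<Prod>i<n. fading_factor k l \<omega> i)) \<le> 1"
        using U01[of \<omega>] by (auto simp: abs_mult intro!: mult_le_one)
    qed
    show "AE \<omega> in M. (\<lambda>n. U \<omega> * (\<Prod>l\<le>K. \<Prod>i<n. fading_factor k l \<omega> i)) \<longlonglongrightarrow> U \<omega> * (\<Prod>l\<le>K. lim (\<lambda>n. \<Prod>i<n. fading_factor k l \<omega> i))"
      using fading_factor_01[OF k] by (intro AE_I2 tendsto_intros LIMSEQ_prod_01(1)) auto
  qed auto
  ultimately have "expectation (\<lambda>\<omega>. W \<omega> * exp (- Z \<omega>)) = expectation (\<lambda>\<omega>. U \<omega> * (\<Prod>l\<le>K. lim (\<lambda>n. \<Prod>i<n. fading_factor k l \<omega> i)))"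
    by (simp add: LIMSEQ_unique)
  then show ?thesis
    unfolding 1 by (simp add: U_def W_def s_def)
qed

end

section \<open>The contribution of each tier\<close>

lemma divide_powr_minus:
  fixes y a e :: real
  assumes "0 < y" "0 < a"
  shows "(y / a) powr - e = a powr e * y powr - e"
  using assms by (subst powr_divide) (auto simp: powr_minus divide_inverse)

lemma integral_one_minus_fading_factor_beyond:
  assumes e: "2 < e" and s: "0 < (s::real)"
  shows "set_integrable lborel {1<..} (\<lambda>u. 1 - 1 / (1 + s * sqrt u powr - e))"
    and "1 + (LINT u:{1<..}|lborel. 1 - 1 / (1 + s * sqrt u powr - e)) = s powr (2 / e) * Ffun s e"
proof -
  show "set_integrable lborel {1<..} (\<lambda>u. 1 - 1 / (1 + s * sqrt u powr - e))"
    by (rule set_integrable_subset[OF integral_one_minus_fading_factor(1)[OF assms]]) auto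
  have "(LINT u:{1<..}|lborel. 1 - 1 / (1 + s * sqrt u powr - e)) = (LINT u:{1<..}|lborel. s / (s + u powr (e / 2)))"
    by (intro set_lebesgue_integral_cong allI impI one_minus_fading_factor) (use s in auto)
  then show "1 + (LINT u:{1<..}|lborel. 1 - 1 / (1 + s * sqrt u powr - e)) = s powr (2 / e) * Ffun s e"
    using Ffun_eq_integral[OF assms] by simp
qed

text \<open>Read off from the representation as \<open>1\<close> plus a nonnegative tail. Positivity
  keeps \<open>tier_laplace\<close> below \<open>1\<close> and the denominator of the closed form
  positive.\<close>

lemma Ffun_pos:
  assumes e: "2 < e" and s: "0 < (s::real)"
  shows "0 < Ffun s e"
proof -
  have "0 \<le> (LINT w:{1<..}|lborel. s / (s + w powr (e / 2)))"
    unfolding set_lebesgue_integral_def by (rule integral_nonneg_AE) (use s in auto)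
  then have "0 < s powr (2 / e) * Ffun s e"
    using Ffun_eq_integral[OF assms] by simp
  then show ?thesis using s by (simp add: zero_less_mult_iff)
qed

context cellular_network
begin

text \<open>The factor \<open>0\<close> inside the exclusion disc encodes that tier \<open>k\<close>
  serves. The closed tier \<open>0\<close> does not compete for serving and has no such
  disc.\<close>

definition tier_factor :: "nat \<Rightarrow> nat \<Rightarrow> real \<Rightarrow> real \<Rightarrow> real" where
  "tier_factor k l t y = (if l \<noteq> 0 \<and> y \<le> exclusion_radius k l t then 0 else 1 / (1 + laplace_arg k t * tier_power l * y powr - tier_exponent l))"
text \<open>Own-tier interference in terms of the ratio \<open>u = y / t\<close> of distances:
  \<open>laplace_arg k t * tier_power k * y powr - tier_exponent k\<close> equals
  \<open>\<beta> k * u powr - tier_exponent k\<close>, free of \<open>t\<close> and of the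
  power.\<close>

definition own_factor :: "nat \<Rightarrow> real \<Rightarrow> real" where
  "own_factor k u = 1 / (1 + \<beta> k * u powr - tier_exponent k)"
text \<open>The closed tier is integrated over the whole plane, open tiers beyond their exclusion
  disc, whose void probability is included in \<open>Ffun\<close>. For \<open>l = k\<close> that
  void probability stems from the density of the nearest distance.\<close>

definition laplace_coeff :: "nat \<Rightarrow> nat \<Rightarrow> real" where
  "laplace_coeff k l = (if l = 0 then 1 / sinc (2 * pi / tier_exponent 0) else Ffun (\<beta> k) (tier_exponent l))"
definition tier_laplace :: "nat \<Rightarrow> nat \<Rightarrow> real \<Rightarrow> real" where
  "tier_laplace k l t = exp (- (tier_intensity l * pi * (laplace_arg k t * tier_power l) powr (2 / tier_exponent l) * laplace_coeff k l))"

lemma tier_factor_01: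
  assumes "k \<in> {1..K}" "l \<le> K"
  shows "0 \<le> tier_factor k l t y" "tier_factor k l t y \<le> 1"
proof -
  have "0 \<le> laplace_arg k t * tier_power l * y powr - tier_exponent l"
    using laplace_arg_nonneg[OF assms(1)] tier_power_pos[OF assms(2)] by simp
  then show "0 \<le> tier_factor k l t y" "tier_factor k l t y \<le> 1" by (auto simp: tier_factor_def)
qed

lemma own_factor_01:
  assumes "k \<in> {1..K}"
  shows "0 \<le> own_factor k u" "own_factor k u \<le> 1"
proof -
  have "0 \<le> \<beta> k * u powr - tier_exponent k"
    using beta[OF assms] by simp
  then show "0 \<le> own_factor k u" "own_factor k u \<le> 1" by (auto simp: own_factor_def)
qed

lemma tier_laplace_01:
  assumes k: "k \<in> {1..K}" and l: "l \<le> K"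
  shows "0 \<le> tier_laplace k l t" "tier_laplace k l t \<le> 1"
proof -
  have "0 < 2 * pi / tier_exponent 0" "2 * pi / tier_exponent 0 < pi"
    using tier_exponent_gt_2[of 0] by (auto simp: field_simps)
  then have "0 \<le> laplace_coeff k l"
    using Ffun_pos[OF tier_exponent_gt_2[OF l] beta[OF k]] sinc_pos[of "2 * pi / tier_exponent 0"] by (auto simp: laplace_coeff_def)
  then show "0 \<le> tier_laplace k l t" "tier_laplace k l t \<le> 1"
    using tier_intensity_nonneg[OF l] by (auto simp: tier_laplace_def)
qed

lemma AE_good:
  assumes k: "k \<in> {1..K}"
  shows "AE \<omega> in M. \<omega> \<in> space M \<and> 0 < tier_radii k \<omega> 0 \<and> (\<forall>i. 0 \<le> tier_radii k \<omega> i) \<and> (\<forall>i>0. tier_radii k \<omega> 0 < tier_radii k \<omega> i)"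
proof -
  have kK: "k \<le> K" using k by simp
  note p = pp[OF kK] tier_intensity_pos[OF k]
  show ?thesis
    using AE_space AE_poisson_pp_present[OF p] AE_poisson_pp_nonzero[OF p(1)] AE_poisson_pp_distinct[OF p(1) less_imp_le[OF p(2)]]
  proof eventually_elim
    fix \<omega> assume w: "\<omega> \<in> space M" and a: "\<forall>i. 0 \<le> radii (tier_points k \<omega>) i" "\<forall>i. radii (tier_points k \<omega>) i \<noteq> 0"
      "\<forall>i. 0 < radii (tier_points k \<omega>) i \<longrightarrow> radii (tier_points k \<omega>) i \<noteq> radii (tier_points k \<omega>) (Suc i)"
    have pos: "0 < radii (tier_points k \<omega>) i" for i using a(1,2) by (simp add: order_less_le)
    have mono: "radii (tier_points k \<omega>) i \<le> radii (tier_points k \<omega>) j" if "i \<le> j" for i j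
      using radii_mono(2)[OF locally_finite_tier_points[OF kK w]] a(1) that by blast
    have "radii (tier_points k \<omega>) 0 < radii (tier_points k \<omega>) i" if "i > 0" for i
      using mono[of 0 1] mono[of 1 i] that a(3) pos by (metis One_nat_def Suc_leI le_less_trans less_le_trans order_less_le zero_le_one)
    then show "\<omega> \<in> space M \<and> 0 < tier_radii k \<omega> 0 \<and> (\<forall>i. 0 \<le> tier_radii k \<omega> i) \<and> (\<forall>i>0. tier_radii k \<omega> 0 < tier_radii k \<omega> i)"
      using w a pos by (simp add: tier_radii_def)
  qed
qed

text \<open>If tier \<open>k\<close> does not serve, some station inside an exclusion disc brings a
  factor \<open>0\<close>, and the right side vanishes too. At the serving station both sides have
  factor \<open>1\<close>, since \<open>beyond\<close> is \<open>1\<close> up to and including the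
  nearest distance.\<close>

lemma fading_factor_product_eq:
  assumes k: "k \<in> {1..K}" and g: "0 < tier_radii k \<omega> 0" "\<And>i. 0 \<le> tier_radii k \<omega> i" "\<And>i. i > 0 \<Longrightarrow> tier_radii k \<omega> 0 < tier_radii k \<omega> i"
  shows "(if serving k \<omega> then 1 else 0) * (\<Prod>l\<le>K. lim (\<lambda>n. \<Prod>i<n. fading_factor k l \<omega> i)) =
    rprod (beyond (own_factor k) (tier_radii k \<omega> 0)) (tier_radii k \<omega>) * (\<Prod>l\<in>{..K} - {k}. rprod (tier_factor k l (tier_radii k \<omega> 0)) (tier_radii l \<omega>))"
proof -
  have kK: "k \<le> K" using k by simp
  define t where "t = tier_radii k \<omega> 0"
  have t: "0 < t" using g by (simp add: t_def)
  have own: "fading_factor k k \<omega> i = pfactor (beyond (own_factor k) t) (tier_radii k \<omega> i)" for i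
  proof (cases "i = 0")
    case True
    then show ?thesis using g by (simp add: fading_factor_def pfactor_def beyond_def t_def)
  next
    case False
    then have r: "t < tier_radii k \<omega> i" using g(3)[of i] by (simp add: t_def)
    have "(tier_radii k \<omega> i / t) powr - tier_exponent k = t powr tier_exponent k * tier_radii k \<omega> i powr - tier_exponent k"
      using t r by (intro divide_powr_minus) auto
    then have "laplace_arg k t * gain k (tier_radii k \<omega> i) = \<beta> k * (tier_radii k \<omega> i / t) powr - tier_exponent k"
      using t r tier_power_pos[OF kK] by (simp add: laplace_arg_def gain_def)
    then show ?thesis
      using False r t by (simp add: fading_factor_def pfactor_def beyond_def own_factor_def t_def)
  qed
  have other: "fading_factor k l \<omega> i = pfactor (tier_factor k l t) (tier_radii l \<omega> i)"
    if "l \<noteq> k" "l \<noteq> 0 \<Longrightarrow> 0 \<le> tier_radii l \<omega> i \<Longrightarrow> exclusion_radius k l t < tier_radii l \<omega> i" for l i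
    using that by (auto simp: fading_factor_def pfactor_def tier_factor_def gain_def t_def mult.assoc)
  have split: "(\<Prod>l\<le>K. lim (\<lambda>n. \<Prod>i<n. fading_factor k l \<omega> i)) = rprod (beyond (own_factor k) t) (tier_radii k \<omega>) * (\<Prod>l\<in>{..K} - {k}. lim (\<lambda>n. \<Prod>i<n. fading_factor k l \<omega> i))"
    using kK by (subst prod.remove[of _ k]) (auto simp: own rprod_def)
  show ?thesis
  proof (cases "serving k \<omega>")
    case True
    have "lim (\<lambda>n. \<Prod>i<n. fading_factor k l \<omega> i) = rprod (tier_factor k l t) (tier_radii l \<omega>)" if "l \<in> {..K} - {k}" for l
    proof -
      have "fading_factor k l \<omega> i = pfactor (tier_factor k l t) (tier_radii l \<omega> i)" for i
        using that True by (intro other) (auto simp: serving_def t_def)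
      then show ?thesis by (simp add: rprod_def)
    qed
    then show ?thesis
      using True split by (simp add: t_def)
  next
    case False
    then obtain l i where l: "l \<in> {1..K} - {k}" "0 \<le> tier_radii l \<omega> i" "tier_radii l \<omega> i \<le> exclusion_radius k l t"
      unfolding serving_def t_def not_less[symmetric] by blast
    then have lK: "l \<le> K" by simp
    have "rprod (tier_factor k l t) (tier_radii l \<omega>) \<le> (\<Prod>j<Suc i. pfactor (tier_factor k l t) (tier_radii l \<omega> j))"
      by (rule rprod_le_prod) (rule tier_factor_01[OF k lK])+
    also have "\<dots> = 0"
      using l by (simp add: pfactor_def tier_factor_def)
    finally have "rprod (tier_factor k l t) (tier_radii l \<omega>) = 0"
      using rprod_nonneg[of "tier_factor k l t" "tier_radii l \<omega>", OF tier_factor_01[OF k lK]] by simp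
    then have "(\<Prod>l\<in>{..K} - {k}. rprod (tier_factor k l t) (tier_radii l \<omega>)) = 0"
      using l by (intro prod_zero) auto
    then show ?thesis
      using False by (simp add: t_def)
  qed
qed

text \<open>The distance \<open>t\<close> is fixed here, so the tier is an unconditioned Poisson
  process. After scaling by the exclusion radius the factor of an open tier depends on
  \<open>\<beta> k\<close> and the exponent only: a station on the boundary of the disc is received
  as strongly as the serving one.\<close>

lemma expectation_rprod_tier:
  assumes k: "k \<in> {1..K}" and l: "l \<le> K" and t: "0 < t"
  shows "expectation (\<lambda>\<omega>. rprod (tier_factor k l t) (tier_radii l \<omega>)) = tier_laplace k l t"
proof -
  have kK: "k \<le> K" using k by simp
  have e: "2 < tier_exponent l" "0 < tier_power l" using tier_exponent_gt_2[OF l] tier_power_pos[OF l] by auto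
  have s: "0 < laplace_arg k t" using beta[OF k] tier_power_pos[OF kK] t by (simp add: laplace_arg_def)
  have vm: "tier_factor k l t \<in> borel_measurable borel" unfolding tier_factor_def by measurable
  have "set_integrable lborel {0<..} (\<lambda>u. 1 - tier_factor k l t (sqrt u)) \<and>
     (LINT u:{0<..}|lborel. 1 - tier_factor k l t (sqrt u)) = (laplace_arg k t * tier_power l) powr (2 / tier_exponent l) * laplace_coeff k l"
  proof (cases "l = 0")
    case True
    have "tier_factor k l t (sqrt u) = 1 / (1 + (laplace_arg k t * tier_power l) * sqrt u powr - tier_exponent l)" for u
      using True by (simp add: tier_factor_def)
    then show ?thesis
      using integral_one_minus_fading_factor[of "tier_exponent l" "laplace_arg k t * tier_power l"] e s True by (simp add: laplace_coeff_def)
  next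
    case False
    define a where "a = exclusion_radius k l t"
    define H where "H u = 1 / (1 + \<beta> k * u powr - tier_exponent l)" for u
    have a: "0 < a" "a powr tier_exponent l = tier_power l * t powr tier_exponent k / tier_power k"
      using e tier_power_pos[OF kK] t by (auto simp: a_def exclusion_radius_def powr_powr)
    have eq: "tier_factor k l t = (\<lambda>y. if y \<le> a then 0 else beyond H a y)"
    proof
      fix y
      show "tier_factor k l t y = (if y \<le> a then 0 else beyond H a y)"
      proof (cases "y \<le> a")
        case True
        then show ?thesis using False by (simp add: tier_factor_def a_def)
      next
        case ya: False
        have "(y / a) powr - tier_exponent l = a powr tier_exponent l * y powr - tier_exponent l"
          using ya a by (intro divide_powr_minus) auto
        then have "\<beta> k * (y / a) powr - tier_exponent l = laplace_arg k t * tier_power l * y powr - tier_exponent l"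
          by (simp add: a(2) laplace_arg_def)
        then show ?thesis
          using ya by (simp add: tier_factor_def beyond_def H_def a_def)
      qed
    qed
    have Hm: "H \<in> borel_measurable borel" unfolding H_def by measurable
    note F = integral_one_minus_fading_factor_beyond[OF e(1) beta[OF k], folded H_def]
    \<comment> \<open>Both radii are \<open>a\<close>: the disc of weight \<open>0\<close> reaches
      exactly to where the interference begins.\<close>
    note I = integral_beyond[OF Hm F(1), of a a]
    have asq: "a\<^sup>2 = (a powr tier_exponent l) powr (2 / tier_exponent l)"
      unfolding powr_powr using e a(1) by (simp add: powr_numeral)
    have "a\<^sup>2 + a\<^sup>2 * (LINT u:{1<..}|lborel. 1 - H (sqrt u)) = a\<^sup>2 * (\<beta> k powr (2 / tier_exponent l) * Ffun (\<beta> k) (tier_exponent l))"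
      unfolding F(2)[symmetric] by (simp add: distrib_left)
    also note asq
    also have "(a powr tier_exponent l) powr (2 / tier_exponent l) * (\<beta> k powr (2 / tier_exponent l) * Ffun (\<beta> k) (tier_exponent l)) = (laplace_arg k t * tier_power l) powr (2 / tier_exponent l) * Ffun (\<beta> k) (tier_exponent l)"
    proof -
      have "laplace_arg k t * tier_power l = a powr tier_exponent l * \<beta> k" by (simp add: a(2) laplace_arg_def)
      then show ?thesis using beta[OF k] by (simp add: powr_mult)
    qed
    finally show ?thesis
      unfolding eq using I a(1) False asq by (simp add: laplace_coeff_def)
  qed
  then show ?thesis
    using poisson_pp_pgfl_radial(2)[OF pp[OF l] tier_intensity_nonneg[OF l] vm tier_factor_01[OF k l]]
    by (simp add: tier_radii_def tier_laplace_def mult.assoc)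
qed

text \<open>Joint measurability in the radii and in the distance parameter, which is random when the
  tiers are combined.\<close>

lemma rprod_tier_factor_measurable:
  assumes [measurable]: "\<And>i. (\<lambda>\<omega>. X \<omega> i) \<in> borel_measurable A" "T \<in> borel_measurable A"
  shows "(\<lambda>\<omega>. rprod (tier_factor k l (T \<omega>)) (X \<omega>)) \<in> borel_measurable A"
  unfolding rprod_def pfactor_def tier_factor_def laplace_arg_def exclusion_radius_def by measurable

lemma rprod_measurable_others:
  assumes l: "l \<le> K" and k: "k \<le> K" and s: "s \<noteq> point_source l" "s \<noteq> point_source k"
  shows "(\<lambda>\<omega>. rprod (tier_factor k l (tier_radii k \<omega> 0)) (tier_radii l \<omega>)) \<in> borel_measurable (others s)"
  by (intro rprod_tier_factor_measurable tier_radii_measurable_others assms)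

text \<open>The tiers are integrated out one after another with the nearest distance of tier
  \<open>k\<close> frozen. \<open>W\<close> collects what is already evaluated, so it must be
  measurable without the points of each tier still to come.\<close>

lemma peel_tiers:
  assumes k: "k \<in> {1..K}" and L: "finite L" "L \<subseteq> {..K} - {k}"
    and W: "\<And>\<omega>. 0 \<le> W \<omega>" "\<And>\<omega>. W \<omega> \<le> 1" "\<And>l. l \<in> L \<Longrightarrow> W \<in> borel_measurable (others (point_source l))" "W \<in> borel_measurable M"
  shows "expectation (\<lambda>\<omega>. W \<omega> * (\<Prod>l\<in>L. rprod (tier_factor k l (tier_radii k \<omega> 0)) (tier_radii l \<omega>))) =
    expectation (\<lambda>\<omega>. W \<omega> * (\<Prod>l\<in>L. tier_laplace k l (tier_radii k \<omega> 0)))"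
  using L W
proof (induction L arbitrary: W rule: finite_induct)
  case (insert l L)
  have kK: "k \<le> K" using k by simp
  have l: "l \<le> K" "l \<noteq> k" and L: "L \<subseteq> {..K} - {k}" using insert.prems by auto
  have LamA: "(\<lambda>\<omega>. W \<omega> * tier_laplace k l (tier_radii k \<omega> 0)) \<in> borel_measurable A"
    if [measurable]: "W \<in> borel_measurable A" "(\<lambda>\<omega>. tier_radii k \<omega> 0) \<in> borel_measurable A" for A
    unfolding tier_laplace_def laplace_arg_def by measurable
  have LamM: "(\<lambda>\<omega>. W \<omega> * tier_laplace k l (tier_radii k \<omega> 0)) \<in> borel_measurable M"
    by (rule LamA[OF insert.prems(5) tier_radii_measurable[OF kK]])
  define V where "V \<omega> = W \<omega> * (\<Prod>l\<in>L. rprod (tier_factor k l (tier_radii k \<omega> 0)) (tier_radii l \<omega>))" for \<omega>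
  have pr: "0 \<le> rprod (tier_factor k l' t) S" "rprod (tier_factor k l' t) S \<le> 1" if "l' \<le> K" for l' t S
    using rprod_nonneg[of "tier_factor k l' t" S] rprod_le_1[of "tier_factor k l' t" S] tier_factor_01[OF k that] by auto
  have V01: "0 \<le> V \<omega>" "V \<omega> \<le> 1" for \<omega>
    unfolding V_def using insert.prems(2,3) L by (auto intro!: mult_le_one mult_nonneg_nonneg prod_nonneg prod_le_1 pr)
  have Vm: "V \<in> borel_measurable (others (point_source l))"
    unfolding V_def using insert.hyps insert.prems L l k
    by (intro borel_measurable_times borel_measurable_prod rprod_measurable_others) auto
  have Tm: "(\<lambda>\<omega>. tier_radii k \<omega> 0) \<in> borel_measurable (others (point_source l))"
    using l by (intro tier_radii_measurable_others kK) auto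
  define f where "f z = max 0 (min 1 (fst (snd z))) * rprod (tier_factor k l (snd (snd z))) (fst z)" for z
  have clamp: "max 0 (min 1 (V \<omega>)) = V \<omega>" for \<omega> using V01[of \<omega>] by simp
  have fV: "f (S, (V \<omega>, t)) = V \<omega> * rprod (tier_factor k l t) S" for S \<omega> t
    by (simp only: f_def fst_conv snd_conv clamp)
  have fm: "f \<in> borel_measurable (PiM UNIV (\<lambda>_. borel) \<Otimes>\<^sub>M (borel \<Otimes>\<^sub>M borel))"
    unfolding f_def
  proof (rule borel_measurable_times)
    have "(\<lambda>z. fst z i) \<in> borel_measurable (PiM UNIV (\<lambda>_. borel) \<Otimes>\<^sub>M (borel \<Otimes>\<^sub>M borel))" for i :: nat
      by (rule measurable_compose[OF measurable_fst measurable_component_singleton]) simp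
    then show "(\<lambda>z. rprod (tier_factor k l (snd (snd z))) (fst z)) \<in> borel_measurable (PiM UNIV (\<lambda>_. borel) \<Otimes>\<^sub>M (borel \<Otimes>\<^sub>M borel))"
      by (rule rprod_tier_factor_measurable) measurable
  qed measurable
  have fb: "\<bar>f z\<bar> \<le> 1" for z
    using pr[OF l(1)] by (auto simp: f_def abs_mult intro!: mult_le_one)
  have "expectation (\<lambda>\<omega>. W \<omega> * (\<Prod>l\<in>insert l L. rprod (tier_factor k l (tier_radii k \<omega> 0)) (tier_radii l \<omega>))) =
      expectation (\<lambda>\<omega>. f (tier_radii l \<omega>, (V \<omega>, tier_radii k \<omega> 0)))"
    unfolding fV using insert.hyps by (simp add: V_def mult_ac)
  also have "\<dots> = expectation (\<lambda>\<omega>. expectation (\<lambda>\<omega>'. f (tier_radii l \<omega>', (V \<omega>, tier_radii k \<omega> 0))))"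
    by (rule indep_pair_expectation[OF indep_points[OF l(1) Vm Tm] fm fb])
  also have "\<dots> = expectation (\<lambda>\<omega>. (W \<omega> * tier_laplace k l (tier_radii k \<omega> 0)) * (\<Prod>l\<in>L. rprod (tier_factor k l (tier_radii k \<omega> 0)) (tier_radii l \<omega>)))"
  proof (rule integral_cong_AE)
    have Vm': "V \<in> borel_measurable M" by (rule measurable_others_M[OF Vm])
    have pM: "(\<lambda>\<omega>. rprod (tier_factor k l' (tier_radii k \<omega> 0)) (tier_radii l' \<omega>)) \<in> borel_measurable M" if "l' \<in> L" for l'
      using that insert.hyps L l by (intro measurable_others_M[OF rprod_measurable_others[of _ _ "point_source l"]] kK) auto
    show "(\<lambda>\<omega>. (W \<omega> * tier_laplace k l (tier_radii k \<omega> 0)) * (\<Prod>l\<in>L. rprod (tier_factor k l (tier_radii k \<omega> 0)) (tier_radii l \<omega>))) \<in> borel_measurable M"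
      by (intro borel_measurable_times[OF LamM] borel_measurable_prod pM)
    have Rl: "tier_radii l \<in> measurable M (PiM UNIV (\<lambda>_. borel))"
      by (intro borel_measurable_PiM_seq tier_radii_measurable l)
    show "(\<lambda>\<omega>. expectation (\<lambda>\<omega>'. f (tier_radii l \<omega>', (V \<omega>, tier_radii k \<omega> 0)))) \<in> borel_measurable M"
    proof (rule borel_measurable_lebesgue_integral)
      note [measurable] = Vm' Rl fm tier_radii_measurable[OF kK, of 0]
      show "(\<lambda>(\<omega>, \<omega>'). f (tier_radii l \<omega>', (V \<omega>, tier_radii k \<omega> 0))) \<in> borel_measurable (M \<Otimes>\<^sub>M M)"
        by measurable
    qed
    \<comment> \<open>The mean over tier \<open>l\<close> is known for positive distances, so the
      identity is claimed almost everywhere only.\<close>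
    show "AE \<omega> in M. expectation (\<lambda>\<omega>'. f (tier_radii l \<omega>', (V \<omega>, tier_radii k \<omega> 0))) =
       (W \<omega> * tier_laplace k l (tier_radii k \<omega> 0)) * (\<Prod>l\<in>L. rprod (tier_factor k l (tier_radii k \<omega> 0)) (tier_radii l \<omega>))"
      using AE_good[OF k]
    proof eventually_elim
      fix \<omega> assume "\<omega> \<in> space M \<and> 0 < tier_radii k \<omega> 0 \<and> (\<forall>i. 0 \<le> tier_radii k \<omega> i) \<and> (\<forall>i>0. tier_radii k \<omega> 0 < tier_radii k \<omega> i)"
      then show "expectation (\<lambda>\<omega>'. f (tier_radii l \<omega>', (V \<omega>, tier_radii k \<omega> 0))) =
         (W \<omega> * tier_laplace k l (tier_radii k \<omega> 0)) * (\<Prod>l\<in>L. rprod (tier_factor k l (tier_radii k \<omega> 0)) (tier_radii l \<omega>))"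
        using expectation_rprod_tier[OF k l(1), of "tier_radii k \<omega> 0"] unfolding fV by (simp add: V_def)
    qed
  qed
  also have "\<dots> = expectation (\<lambda>\<omega>. (W \<omega> * tier_laplace k l (tier_radii k \<omega> 0)) * (\<Prod>l\<in>L. tier_laplace k l (tier_radii k \<omega> 0)))"
  proof (rule insert.IH[OF L])
    show "0 \<le> W \<omega> * tier_laplace k l (tier_radii k \<omega> 0)" "W \<omega> * tier_laplace k l (tier_radii k \<omega> 0) \<le> 1" for \<omega>
      using insert.prems(2,3) tier_laplace_01[OF k l(1)] by (auto intro!: mult_le_one)
    show "(\<lambda>\<omega>. W \<omega> * tier_laplace k l (tier_radii k \<omega> 0)) \<in> borel_measurable M"
      by (rule LamM)
    show "(\<lambda>\<omega>. W \<omega> * tier_laplace k l (tier_radii k \<omega> 0)) \<in> borel_measurable (others (point_source l'))" if l': "l' \<in> L" for l'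
      using l' L insert.prems(4) by (intro LamA tier_radii_measurable_others kK) auto
  qed
  finally show ?case
    using insert.hyps by (simp add: mult.assoc)
qed simp

text \<open>Once the other tiers are averaged, a function \<open>g\<close> of the nearest distance
  remains, times the product over the own tier beyond that distance: the situation of
  \<open>first_point\<close>.\<close>

lemma coverage_integral:
  assumes k: "k \<in> {1..K}"
  shows "expectation (\<lambda>\<omega>. if serving k \<omega> \<and> laplace_arg k (tier_radii k \<omega> 0) * (interference k \<omega> + \<eta>) < fading k \<omega> 0 then 1 else 0) =
    (LINT t:{0<..}|lborel. 2 * tier_intensity k * pi * t * (exp (- (laplace_arg k t * \<eta>)) * (\<Prod>l\<le>K. tier_laplace k l t)))"
proof -
  have kK: "k \<le> K" using k by simp
  have Pk: "0 < tier_power k" and bk: "0 < \<beta> k" and ek: "2 < tier_exponent k"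
    using tier_power_pos[OF kK] beta[OF k] tier_exponent_gt_2[OF kK] by auto
  note [measurable] = tier_radii_measurable[OF kK]
  define X where "X \<omega> = rprod (beyond (own_factor k) (tier_radii k \<omega> 0)) (tier_radii k \<omega>)" for \<omega>
  define W where "W \<omega> = exp (- (laplace_arg k (tier_radii k \<omega> 0) * \<eta>)) * X \<omega>" for \<omega>
  have B: "0 \<le> beyond (own_factor k) t y" "beyond (own_factor k) t y \<le> 1" for t y
    using own_factor_01[OF k] by (auto simp: beyond_def)
  have X01: "0 \<le> X \<omega>" "X \<omega> \<le> 1" for \<omega>
    unfolding X_def using rprod_nonneg[of "beyond (own_factor k) (tier_radii k \<omega> 0)"] rprod_le_1[of "beyond (own_factor k) (tier_radii k \<omega> 0)"] B by auto
  have W01: "0 \<le> W \<omega>" "W \<omega> \<le> 1" for \<omega>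
    unfolding W_def using X01 laplace_arg_nonneg[OF k] eta by (auto intro!: mult_le_one)
  have WA: "W \<in> borel_measurable A" if [measurable]: "\<And>i. (\<lambda>\<omega>. tier_radii k \<omega> i) \<in> borel_measurable A" for A
    unfolding W_def X_def rprod_def pfactor_def beyond_def own_factor_def laplace_arg_def by measurable
  have WM: "W \<in> borel_measurable M"
    by (rule WA) measurable
  have Wo: "W \<in> borel_measurable (others (point_source l))" if "l \<in> {..K} - {k}" for l
    using that by (intro WA tier_radii_measurable_others kK) auto
  define g where "g t = exp (- (laplace_arg k t * \<eta>)) * (\<Prod>l\<in>{..K} - {k}. tier_laplace k l t)" for t
  have gm: "g \<in> borel_measurable borel"
    unfolding g_def tier_laplace_def laplace_arg_def by measurable
  have g01: "0 \<le> g t" "g t \<le> 1" for t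
    unfolding g_def using tier_laplace_01[OF k] laplace_arg_nonneg[OF k] eta by (auto intro!: mult_nonneg_nonneg mult_le_one prod_nonneg prod_le_1)
  have gc: "isCont g t" if t: "0 < t" for t
  proof -
    have s: "laplace_arg k t * tier_power l \<noteq> 0" if "l \<le> K" for l
      using t Pk bk tier_power_pos[OF that] by (simp add: laplace_arg_def)
    have "isCont (laplace_arg k) t"
      unfolding laplace_arg_def using t Pk by (intro continuous_intros) auto
    then show ?thesis
      unfolding g_def tier_laplace_def using s by (intro continuous_intros) auto
  qed
  have Hm: "own_factor k \<in> borel_measurable borel" unfolding own_factor_def by measurable
  have Hc: "isCont (own_factor k) u" if "1 < u" for u
  proof -
    have "0 < 1 + \<beta> k * u powr - tier_exponent k" using bk by (simp add: add_pos_nonneg)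
    then show ?thesis
      unfolding own_factor_def using that by (intro continuous_intros) auto
  qed
  note F = integral_one_minus_fading_factor_beyond[OF ek bk, folded own_factor_def]
  define c where "c = (LINT u:{1<..}|lborel. 1 - own_factor k (sqrt u))"
  have lims: "(\<lambda>\<omega>. lim (\<lambda>n. \<Prod>i<n. fading_factor k l \<omega> i)) \<in> borel_measurable M" if l: "l \<le> K" for l
  proof (intro borel_measurable_lim_metric borel_measurable_prod)
    fix i
    note [measurable] = tier_radii_measurable[OF l]
    show "(\<lambda>\<omega>. fading_factor k l \<omega> i) \<in> borel_measurable M"
      unfolding fading_factor_def laplace_arg_def by measurable
  qed
  have "expectation (\<lambda>\<omega>. if serving k \<omega> \<and> laplace_arg k (tier_radii k \<omega> 0) * (interference k \<omega> + \<eta>) < fading k \<omega> 0 then 1 else 0) =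
    expectation (\<lambda>\<omega>. (if serving k \<omega> then 1 else 0) * exp (- (laplace_arg k (tier_radii k \<omega> 0) * \<eta>)) * (\<Prod>l\<le>K. lim (\<lambda>n. \<Prod>i<n. fading_factor k l \<omega> i)))"
    by (rule coverage_as_product[OF k])
  also have "\<dots> = expectation (\<lambda>\<omega>. W \<omega> * (\<Prod>l\<in>{..K} - {k}. rprod (tier_factor k l (tier_radii k \<omega> 0)) (tier_radii l \<omega>)))"
  proof (rule integral_cong_AE)
    have [measurable]: "(\<lambda>\<omega>. if serving k \<omega> then 1 else 0 :: real) \<in> borel_measurable M"
      by (rule serving_measurable[OF k]) (auto intro: tier_radii_measurable)
    have [measurable]: "(\<lambda>\<omega>. \<Prod>l\<le>K. lim (\<lambda>n. \<Prod>i<n. fading_factor k l \<omega> i)) \<in> borel_measurable M"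
      by (intro borel_measurable_prod lims) simp
    show "(\<lambda>\<omega>. (if serving k \<omega> then 1 else 0) * exp (- (laplace_arg k (tier_radii k \<omega> 0) * \<eta>)) * (\<Prod>l\<le>K. lim (\<lambda>n. \<Prod>i<n. fading_factor k l \<omega> i))) \<in> borel_measurable M"
      unfolding laplace_arg_def by measurable
    have "(\<lambda>\<omega>. rprod (tier_factor k l (tier_radii k \<omega> 0)) (tier_radii l \<omega>)) \<in> borel_measurable M" if "l \<le> K" for l
      by (rule measurable_others_M[OF rprod_measurable_others[OF that kK, of "fading_source 0 0"]]) auto
    then show "(\<lambda>\<omega>. W \<omega> * (\<Prod>l\<in>{..K} - {k}. rprod (tier_factor k l (tier_radii k \<omega> 0)) (tier_radii l \<omega>))) \<in> borel_measurable M"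
      using WM by (intro borel_measurable_times borel_measurable_prod) auto
    show "AE \<omega> in M. (if serving k \<omega> then 1 else 0) * exp (- (laplace_arg k (tier_radii k \<omega> 0) * \<eta>)) * (\<Prod>l\<le>K. lim (\<lambda>n. \<Prod>i<n. fading_factor k l \<omega> i)) =
       W \<omega> * (\<Prod>l\<in>{..K} - {k}. rprod (tier_factor k l (tier_radii k \<omega> 0)) (tier_radii l \<omega>))"
      using AE_good[OF k]
    proof eventually_elim
      fix \<omega> assume "\<omega> \<in> space M \<and> 0 < tier_radii k \<omega> 0 \<and> (\<forall>i. 0 \<le> tier_radii k \<omega> i) \<and> (\<forall>i>0. tier_radii k \<omega> 0 < tier_radii k \<omega> i)"
      then have "(if serving k \<omega> then 1 else 0) * (\<Prod>l\<le>K. lim (\<lambda>n. \<Prod>i<n. fading_factor k l \<omega> i)) =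
        X \<omega> * (\<Prod>l\<in>{..K} - {k}. rprod (tier_factor k l (tier_radii k \<omega> 0)) (tier_radii l \<omega>))"
        unfolding X_def by (intro fading_factor_product_eq[OF k]) auto
      then have "exp (- (laplace_arg k (tier_radii k \<omega> 0) * \<eta>)) * ((if serving k \<omega> then 1 else 0) * (\<Prod>l\<le>K. lim (\<lambda>n. \<Prod>i<n. fading_factor k l \<omega> i))) =
        exp (- (laplace_arg k (tier_radii k \<omega> 0) * \<eta>)) * (X \<omega> * (\<Prod>l\<in>{..K} - {k}. rprod (tier_factor k l (tier_radii k \<omega> 0)) (tier_radii l \<omega>)))"
        by (rule arg_cong)
      then show "(if serving k \<omega> then 1 else 0) * exp (- (laplace_arg k (tier_radii k \<omega> 0) * \<eta>)) * (\<Prod>l\<le>K. lim (\<lambda>n. \<Prod>i<n. fading_factor k l \<omega> i)) =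
        W \<omega> * (\<Prod>l\<in>{..K} - {k}. rprod (tier_factor k l (tier_radii k \<omega> 0)) (tier_radii l \<omega>))"
        unfolding W_def by (simp only: mult_ac)
    qed
  qed
  also have "\<dots> = expectation (\<lambda>\<omega>. W \<omega> * (\<Prod>l\<in>{..K} - {k}. tier_laplace k l (tier_radii k \<omega> 0)))"
    by (rule peel_tiers[OF k _ _ W01 Wo WM]) auto
  also have "\<dots> = expectation (\<lambda>\<omega>. g (radii (tier_points k \<omega>) 0) * rprod (beyond (own_factor k) (radii (tier_points k \<omega>) 0)) (radii (tier_points k \<omega>)))"
    by (simp add: W_def X_def g_def tier_radii_def mult_ac)
  also have "\<dots> = (LINT t:{0<..}|lborel. 2 * tier_intensity k * pi * t * exp (- (tier_intensity k * pi * t\<^sup>2)) * (g t * exp (- (tier_intensity k * pi * (t\<^sup>2 * c)))))"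
    unfolding c_def using F(1) by (intro first_point pp kK tier_intensity_pos k Hm own_factor_01 Hc gm g01 gc) (auto simp: own_factor_def)
  also have "\<dots> = (LINT t:{0<..}|lborel. 2 * tier_intensity k * pi * t * (exp (- (laplace_arg k t * \<eta>)) * (\<Prod>l\<le>K. tier_laplace k l t)))"
  proof (intro set_lebesgue_integral_cong allI impI)
    fix t :: real assume "t \<in> {0<..}"
    then have t: "0 < t" by simp
    \<comment> \<open>Writing \<open>\<beta> powr (2 / \<epsilon>) * Ffun \<beta> \<epsilon>\<close>
      as \<open>1 + c\<close> shows that the exponential in the density of the nearest distance and
      the own-tier interference together form this factor, so tier \<open>k\<close> enters the
      product like every other tier.\<close>
    have "tier_laplace k k t = exp (- (tier_intensity k * pi * (t\<^sup>2 * (\<beta> k powr (2 / tier_exponent k) * Ffun (\<beta> k) (tier_exponent k)))))"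
    proof -
      have "(laplace_arg k t * tier_power k) powr (2 / tier_exponent k) = \<beta> k powr (2 / tier_exponent k) * t\<^sup>2"
        using t Pk bk ek by (simp add: laplace_arg_def powr_mult powr_powr powr_numeral)
      then show ?thesis using k by (simp add: tier_laplace_def laplace_coeff_def mult_ac)
    qed
    also have "\<dots> = exp (- (tier_intensity k * pi * t\<^sup>2)) * exp (- (tier_intensity k * pi * (t\<^sup>2 * c)))"
      unfolding F(2)[symmetric] c_def by (simp add: exp_add[symmetric] algebra_simps)
    finally have own: "tier_laplace k k t = exp (- (tier_intensity k * pi * t\<^sup>2)) * exp (- (tier_intensity k * pi * (t\<^sup>2 * c)))" .
    have "(\<Prod>l\<le>K. tier_laplace k l t) = tier_laplace k k t * (\<Prod>l\<in>{..K} - {k}. tier_laplace k l t)"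
      using kK by (intro prod.remove) auto
    then show "2 * tier_intensity k * pi * t * exp (- (tier_intensity k * pi * t\<^sup>2)) * (g t * exp (- (tier_intensity k * pi * (t\<^sup>2 * c)))) =
        2 * tier_intensity k * pi * t * (exp (- (laplace_arg k t * \<eta>)) * (\<Prod>l\<le>K. tier_laplace k l t))"
      unfolding own g_def by (simp only: mult_ac)
  qed simp
  finally show ?thesis .
qed

end

section \<open>From the event on point sets to the event on radii\<close>

lemma infsum_nat_real:
  fixes f :: "nat \<Rightarrow> real"
  shows "infsum f UNIV = (if (\<Sum>n. ennreal \<bar>f n\<bar>) \<noteq> top then suminf f else 0)"
proof -
  \<comment> \<open>For reals \<open>summable_on\<close> means absolute summability. Expressed by an
    \<open>ennreal\<close> series it is visibly a measurable condition, and failure gives the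
    default \<open>0\<close>.\<close>
  have "f summable_on UNIV \<longleftrightarrow> summable (\<lambda>n. \<bar>f n\<bar>)"
    using summable_on_UNIV_nonneg_real_iff[of "\<lambda>n. \<bar>f n\<bar>"]
    by (subst summable_on_iff_abs_summable_on_real) simp
  moreover have "summable (\<lambda>n. \<bar>f n\<bar>) \<longleftrightarrow> (\<Sum>n. ennreal \<bar>f n\<bar>) \<noteq> top"
  proof
    assume "summable (\<lambda>n. \<bar>f n\<bar>)"
    then show "(\<Sum>n. ennreal \<bar>f n\<bar>) \<noteq> top"
      by (rule ennreal_suminf_neq_top) (rule abs_ge_zero)
  next
    assume "(\<Sum>n. ennreal \<bar>f n\<bar>) \<noteq> top"
    then show "summable (\<lambda>n. \<bar>f n\<bar>)"
      by (rule summable_suminf_not_top[rotated]) (rule abs_ge_zero)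
  qed
  moreover have "infsum f UNIV = suminf f" if "summable (\<lambda>n. \<bar>f n\<bar>)"
    using that by (intro infsumI norm_summable_imp_has_sum summable_sums) (auto intro: summable_rabs_cancel)
  ultimately show ?thesis
    by (auto intro: infsum_not_exists)
qed

context cellular_network
begin

text \<open>\<open>rank\<close>, \<open>recv\<close>, \<open>signal\<close> and \<open>total\<close>
  keep the ties and the possibly negative fadings of the model, so that \<open>covered\<close>
  describes the coverage event for every outcome; the form with \<open>serving\<close> and
  \<open>interference\<close> agrees with it almost surely.\<close>

definition rank :: "nat \<Rightarrow> 'a \<Rightarrow> nat \<Rightarrow> nat" where
  "rank l \<omega> i = card {j\<in>{..<i}. tier_radii l \<omega> j < tier_radii l \<omega> i}"
definition recv :: "nat \<Rightarrow> 'a \<Rightarrow> nat \<Rightarrow> real" where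
  "recv l \<omega> i = (if 0 \<le> tier_radii l \<omega> i then tier_power l * fading l \<omega> (rank l \<omega> i) * tier_radii l \<omega> i powr - tier_exponent l else 0)"
definition total :: "'a \<Rightarrow> real" where
  "total \<omega> = (\<Sum>l\<le>K. infsum (recv l \<omega>) UNIV)"
definition signal :: "nat \<Rightarrow> 'a \<Rightarrow> real" where
  "signal k \<omega> = tier_power k * fading k \<omega> 0 * tier_radii k \<omega> 0 powr - tier_exponent k"
definition strongest :: "nat \<Rightarrow> 'a \<Rightarrow> bool" where
  "strongest k \<omega> \<longleftrightarrow> 0 \<le> tier_radii k \<omega> 0 \<and> (\<forall>l\<in>{1..K}. \<forall>i. (l, i) \<noteq> (k, 0) \<and> 0 \<le> tier_radii l \<omega> i \<longrightarrow>
     tier_power l * tier_radii l \<omega> i powr - tier_exponent l < tier_power k * tier_radii k \<omega> 0 powr - tier_exponent k)"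
definition covered :: "nat \<Rightarrow> 'a \<Rightarrow> bool" where
  "covered k \<omega> \<longleftrightarrow> strongest k \<omega> \<and> \<beta> k < signal k \<omega> / (total \<omega> - signal k \<omega> + \<eta>)"

lemma mean_fading:
  assumes k: "k \<in> {1..K}"
  shows "expectation (\<lambda>\<omega>. Psi k \<omega> 0) = 1"
  using exponential_distributed_expectation[OF _ fade_open[OF k, of 0]] by simp

lemma tier_infsum:
  assumes l: "l \<le> K" and w: "\<omega> \<in> space M"
  shows "infsum (\<lambda>x. rx_power (tier_power l) (tier_exponent l) (fade (fading l) (tier_points l) \<omega> x) x) (tier_points l \<omega>) = infsum (recv l \<omega>) UNIV"
proof -
  have "infsum (\<lambda>x. rx_power (tier_power l) (tier_exponent l) (fade (fading l) (tier_points l) \<omega> x) x) (tier_points l \<omega>) =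
    infsum (\<lambda>i. tier_power l * fading l \<omega> (rank l \<omega> i) * tier_radii l \<omega> i powr - tier_exponent l) {i. 0 \<le> tier_radii l \<omega> i}"
    unfolding rx_power_def fade_def rank_def tier_radii_def
    by (rule infsum_radii[OF locally_finite_tier_points[OF l w], where f="\<lambda>n y. tier_power l * fading l \<omega> n * y powr - tier_exponent l"])
  also have "\<dots> = infsum (recv l \<omega>) UNIV"
    by (rule infsum_cong_neutral) (auto simp: recv_def)
  finally show ?thesis .
qed

lemma total_eq:
  assumes w: "\<omega> \<in> space M"
  shows "total \<omega> = I_open K No Psi Po eps \<omega> + I_closed Nc Psic Pc epsc \<omega>"
proof -
  have "{..K} = insert 0 {1..K}" by auto
  then have "total \<omega> = infsum (recv 0 \<omega>) UNIV + (\<Sum>l\<in>{1..K}. infsum (recv l \<omega>) UNIV)"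
    by (simp add: total_def)
  also have "infsum (recv 0 \<omega>) UNIV = I_closed Nc Psic Pc epsc \<omega>"
    using tier_infsum[OF _ w, of 0] by (simp add: I_closed_def tier_power_def tier_exponent_def fading_def tier_points_def)
  also have "(\<Sum>l\<in>{1..K}. infsum (recv l \<omega>) UNIV) = I_open K No Psi Po eps \<omega>"
    unfolding I_open_def
  proof (rule sum.cong[OF refl])
    fix l assume "l \<in> {1..K}"
    then show "infsum (recv l \<omega>) UNIV = infsum (\<lambda>x. rx_power (Po l) (eps l) (fade (Psi l) (No l) \<omega> x) x) (No l \<omega>)"
      using tier_infsum[OF _ w, of l] by (simp add: tier_power_def tier_exponent_def fading_def tier_points_def)
  qed
  finally show ?thesis by simp
qed

text \<open>Valid for every outcome, ties included, because the event itself has to be shown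
  measurable. Strictness within tier \<open>k\<close> makes its nearest station unique, hence the
  one numbered \<open>0\<close>.\<close>

lemma coverage_event_iff:
  assumes k: "k \<in> {1..K}" and w: "\<omega> \<in> space M"
  shows "(\<exists>x\<in>No k \<omega>. (\<forall>y\<in>No k \<omega>. norm x \<le> norm y) \<and>
        (\<forall>l\<in>{1..K}. \<forall>y\<in>No l \<omega>. (l, y) \<noteq> (k, x) \<longrightarrow>
            Po l * expectation (\<lambda>\<omega>. Psi l \<omega> 0) * norm y powr (- eps l) < Po k * expectation (\<lambda>\<omega>. Psi k \<omega> 0) * norm x powr (- eps k)) \<and>
        (let S = rx_power (Po k) (eps k) (fade (Psi k) (No k) \<omega> x) x in
           S / (I_open K No Psi Po eps \<omega> - S + I_closed Nc Psic Pc epsc \<omega> + \<eta>) > \<beta> k)) \<longleftrightarrow> covered k \<omega>"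
    (is "(\<exists>x\<in>_. ?near x \<and> ?strict x \<and> ?sinr x) \<longleftrightarrow> _")
proof -
  have open_tier: "No l = tier_points l" "Psi l = fading l" "Po l = tier_power l" "eps l = tier_exponent l" "l \<le> K" if "l \<in> {1..K}" for l
    using that by (auto simp: tier_points_def fading_def tier_power_def tier_exponent_def)
  have lfl: "locally_finite (tier_points l \<omega>)" if "l \<in> {1..K}" for l
    using that w by (intro locally_finite_tier_points) auto
  have ex_i: "\<exists>i. 0 \<le> tier_radii l \<omega> i \<and> tier_radii l \<omega> i = norm y \<and> (l = k \<longrightarrow> i = 0 \<longrightarrow> y = x)"
    if l: "l \<in> {1..K}" "y \<in> tier_points l \<omega>" and x: "x \<in> tier_points k \<omega>" "p x = 0" and
      p: "inj_on p (tier_points k \<omega>)" "\<And>x. x \<in> tier_points k \<omega> \<Longrightarrow> radii (tier_points k \<omega>) (p x) = norm x" for l x y and p :: "pt \<Rightarrow> nat"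
  proof (cases "l = k")
    case True
    then have "p y = 0 \<Longrightarrow> y = x" using that by (metis inj_onD)
    then show ?thesis
      using p(2)[of y] l True by (intro exI[of _ "p y"]) (auto simp: tier_radii_def)
  next
    case False
    obtain q where "\<And>x. x \<in> tier_points l \<omega> \<Longrightarrow> radii (tier_points l \<omega>) (q x) = norm x"
      using radii_enum[OF lfl[OF l(1)]] by metis
    then show ?thesis
      using l False by (intro exI[of _ "q y"]) (auto simp: tier_radii_def)
  qed
  obtain p where p: "inj_on p (tier_points k \<omega>)" "p ` tier_points k \<omega> = {i. 0 \<le> radii (tier_points k \<omega>) i}"
    "\<And>x. x \<in> tier_points k \<omega> \<Longrightarrow> radii (tier_points k \<omega>) (p x) = norm x"
    using radii_enum[OF lfl[OF k]] by metis
  have first: "\<exists>x\<in>tier_points k \<omega>. p x = 0 \<and> norm x = tier_radii k \<omega> 0 \<and> (\<forall>y\<in>tier_points k \<omega>. norm x \<le> norm y)" if "0 \<le> tier_radii k \<omega> 0"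
  proof -
    have "0 \<in> p ` tier_points k \<omega>" using that unfolding p(2) by (simp add: tier_radii_def)
    then obtain x where x: "x \<in> tier_points k \<omega>" "p x = 0" by (metis imageE)
    have "norm x \<le> norm y" if "y \<in> tier_points k \<omega>" for y
      using radii_mono(2)[OF lfl[OF k], of "p y" 0] p(3)[OF that] p(3)[OF x(1)] x(2) by simp
    then show ?thesis
      using x p(3)[OF x(1)] by (auto simp: tier_radii_def)
  qed
  have sinr: "?sinr x \<longleftrightarrow> \<beta> k < signal k \<omega> / (total \<omega> - signal k \<omega> + \<eta>)"
    if x: "x \<in> tier_points k \<omega>" "norm x = tier_radii k \<omega> 0" "\<forall>y\<in>tier_points k \<omega>. norm x \<le> norm y" for x
  proof -
    have none: "{y \<in> tier_points k \<omega>. norm y < norm x} = {}" using x(3) by (auto simp: not_less)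
    have "rx_power (Po k) (eps k) (fade (Psi k) (No k) \<omega> x) x = signal k \<omega>"
      unfolding rx_power_def fade_def signal_def open_tier[OF k] none by (simp add: x(2))
    then show ?thesis
      by (simp add: Let_def total_eq[OF w] algebra_simps)
  qed
  show ?thesis
  proof
    assume "\<exists>x\<in>No k \<omega>. ?near x \<and> ?strict x \<and> ?sinr x"
    then obtain x where x: "x \<in> tier_points k \<omega>" "\<forall>y\<in>tier_points k \<omega>. norm x \<le> norm y" and strict: "?strict x" and s: "?sinr x"
      unfolding open_tier(1)[OF k] by blast
    have "0 \<le> radii (tier_points k \<omega>) (p x)" using p(3)[OF x(1)] by simp
    then have R0: "0 \<le> tier_radii k \<omega> 0"
      using radii_mono(1)[OF lfl[OF k], of "p x" 0] by (simp add: tier_radii_def)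
    obtain x0 where x0: "x0 \<in> tier_points k \<omega>" "p x0 = 0" "norm x0 = tier_radii k \<omega> 0" "\<forall>y\<in>tier_points k \<omega>. norm x0 \<le> norm y"
      using first[OF R0] by blast
    have nx: "norm x = norm x0" using x x0 by (meson order_antisym)
    \<comment> \<open>Another station of tier \<open>k\<close> at the same distance would have equal
      mean power and violate the strict comparison.\<close>
    have "x0 = x"
    proof (rule ccontr)
      assume "x0 \<noteq> x"
      then show False
        using strict[rule_format, OF k, of x0] x0(1) nx by (simp add: open_tier(1)[OF k])
    qed
    then have px: "p x = 0" using x0 by simp
    have "strongest k \<omega>"
      unfolding strongest_def
    proof (intro conjI ballI allI impI R0)
      fix l i assume l: "l \<in> {1..K}" and i: "(l, i) \<noteq> (k, 0) \<and> 0 \<le> tier_radii l \<omega> i"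
      \<comment> \<open>For \<open>l = k\<close> the enumeration is the same \<open>p\<close>, so a
        nonzero index belongs to a station other than \<open>x\<close>.\<close>
      obtain q where q: "q ` tier_points l \<omega> = {i. 0 \<le> radii (tier_points l \<omega>) i}" "\<And>x. x \<in> tier_points l \<omega> \<Longrightarrow> radii (tier_points l \<omega>) (q x) = norm x"
        and qp: "l = k \<Longrightarrow> q = p"
        using radii_enum[OF lfl[OF l]] p by metis
      have "i \<in> q ` tier_points l \<omega>" using i unfolding q(1) by (simp add: tier_radii_def)
      then obtain y where y: "y \<in> tier_points l \<omega>" "q y = i" by (metis imageE)
      have "(l, y) \<noteq> (k, x)" using i y qp px by auto
      then have "Po l * expectation (\<lambda>\<omega>. Psi l \<omega> 0) * norm y powr (- eps l) < Po k * expectation (\<lambda>\<omega>. Psi k \<omega> 0) * norm x powr (- eps k)"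
        using strict[rule_format, OF l, of y] y(1) by (simp add: open_tier(1)[OF l])
      then show "tier_power l * tier_radii l \<omega> i powr - tier_exponent l < tier_power k * tier_radii k \<omega> 0 powr - tier_exponent k"
        using q(2)[OF y(1)] y(2) x0(3) nx by (simp add: mean_fading[OF k] mean_fading[OF l] open_tier(3,4)[OF l] open_tier(3,4)[OF k] tier_radii_def)
    qed
    then show "covered k \<omega>"
      using sinr[OF x(1) _ x(2)] s nx x0 by (simp add: covered_def)
  next
    assume cov: "covered k \<omega>"
    then have st: "strongest k \<omega>" by (simp add: covered_def)
    then have R0: "0 \<le> tier_radii k \<omega> 0" by (simp add: strongest_def)
    obtain x where x: "x \<in> tier_points k \<omega>" "p x = 0" "norm x = tier_radii k \<omega> 0" "\<forall>y\<in>tier_points k \<omega>. norm x \<le> norm y"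
      using first[OF R0] by blast
    have "?strict x"
    proof (intro ballI impI)
      fix l y assume l: "l \<in> {1..K}" and y: "y \<in> No l \<omega>" "(l, y) \<noteq> (k, x)"
      obtain i where i: "0 \<le> tier_radii l \<omega> i" "tier_radii l \<omega> i = norm y" "l = k \<longrightarrow> i = 0 \<longrightarrow> y = x"
        using ex_i[OF l _ x(1,2) p(1,3), of y] y(1) by (auto simp: open_tier(1)[OF l])
      have "(l, i) \<noteq> (k, 0)" using i(3) y(2) by auto
      then have "tier_power l * tier_radii l \<omega> i powr - tier_exponent l < tier_power k * tier_radii k \<omega> 0 powr - tier_exponent k"
        using st l i(1) by (simp add: strongest_def)
      then show "Po l * expectation (\<lambda>\<omega>. Psi l \<omega> 0) * norm y powr (- eps l) < Po k * expectation (\<lambda>\<omega>. Psi k \<omega> 0) * norm x powr (- eps k)"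
        using i(2) x(3) by (simp add: mean_fading[OF k] mean_fading[OF l] open_tier(3,4)[OF l] open_tier(3,4)[OF k])
    qed
    then show "\<exists>x\<in>No k \<omega>. ?near x \<and> ?strict x \<and> ?sinr x"
      using x sinr[OF x(1,3,4)] cov by (intro bexI[of _ x]) (auto simp: covered_def open_tier(1)[OF k])
  qed
qed

text \<open>The cardinality is rewritten as a finite sum of indicators, whose measurability is
  evident.\<close>

lemma rank_measurable:
  assumes l: "l \<le> K"
  shows "(\<lambda>\<omega>. rank l \<omega> i) \<in> measurable M (count_space UNIV)"
proof -
  note [measurable] = tier_radii_measurable[OF l]
  have "real (rank l \<omega> i) = (\<Sum>j<i. if tier_radii l \<omega> j < tier_radii l \<omega> i then 1 else 0)" for \<omega>
    unfolding rank_def real_of_card by (rule sum.inter_filter) simp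
  then have "rank l \<omega> i = nat \<lfloor>\<Sum>j<i. if tier_radii l \<omega> j < tier_radii l \<omega> i then 1 else (0::real)\<rfloor>" for \<omega>
    by (metis floor_of_nat nat_int)
  moreover have "(\<lambda>\<omega>. nat \<lfloor>\<Sum>j<i. if tier_radii l \<omega> j < tier_radii l \<omega> i then 1 else (0::real)\<rfloor>) \<in> measurable M (count_space UNIV)"
    by measurable
  ultimately show ?thesis by simp
qed

lemma total_measurable: "total \<in> borel_measurable M"
proof -
  have [measurable]: "(\<lambda>\<omega>. recv l \<omega> i) \<in> borel_measurable M" if l: "l \<le> K" for l i
  proof -
    note [measurable] = tier_radii_measurable[OF l]
    \<comment> \<open>A fading at a random index; the rank has countably many values.\<close>
    have [measurable]: "(\<lambda>\<omega>. fading l \<omega> (rank l \<omega> i)) \<in> borel_measurable M"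
      by (rule measurable_compose_countable[OF fading_measurable[OF l] rank_measurable[OF l]])
    show ?thesis unfolding recv_def by measurable
  qed
  show ?thesis
    unfolding total_def infsum_nat_real
  proof (rule borel_measurable_sum)
    fix l assume "l \<in> {..K}"
    then have [measurable]: "(\<lambda>\<omega>. recv l \<omega> i) \<in> borel_measurable M" for i by simp
    show "(\<lambda>\<omega>. if (\<Sum>n. ennreal \<bar>recv l \<omega> n\<bar>) \<noteq> top then suminf (recv l \<omega>) else 0) \<in> borel_measurable M"
      by measurable
  qed
qed

lemma covered_measurable:
  assumes k: "k \<in> {1..K}"
  shows "Measurable.pred M (covered k)"
proof -
  have kK: "k \<le> K" using k by simp
  note [measurable] = tier_radii_measurable[OF kK] fading_measurable[OF kK] total_measurable
  have [measurable]: "Measurable.pred M (\<lambda>\<omega>. \<forall>l\<in>{1..K}. \<forall>i. (l, i) \<noteq> (k, 0) \<and> 0 \<le> tier_radii l \<omega> i \<longrightarrow>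
     tier_power l * tier_radii l \<omega> i powr - tier_exponent l < tier_power k * tier_radii k \<omega> 0 powr - tier_exponent k)"
  proof (intro pred_intros_finite pred_intros_countable)
    fix l i assume "l \<in> {1..K}"
    then have "l \<le> K" by simp
    note [measurable] = tier_radii_measurable[OF this, of i]
    show "Measurable.pred M (\<lambda>\<omega>. (l, i) \<noteq> (k, 0) \<and> 0 \<le> tier_radii l \<omega> i \<longrightarrow> tier_power l * tier_radii l \<omega> i powr - tier_exponent l < tier_power k * tier_radii k \<omega> 0 powr - tier_exponent k)"
      by measurable
  qed simp
  show ?thesis
    unfolding covered_def strongest_def signal_def by measurable
qed

text \<open>Off a null set there are no ties, the fadings are positive and the series converge, so
  the total minus the signal is the interference. The SINR inequality can then be multiplied out and
  solved for the serving fading.\<close>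

lemma AE_covered_iff:
  assumes k: "k \<in> {1..K}"
  shows "AE \<omega> in M. covered k \<omega> \<longleftrightarrow> serving k \<omega> \<and> laplace_arg k (tier_radii k \<omega> 0) * (interference k \<omega> + \<eta>) < fading k \<omega> 0"
proof -
  have kK: "k \<le> K" using k by simp
  have Pk: "0 < tier_power k" and bk: "0 < \<beta> k" and ek: "2 < tier_exponent k"
    using tier_power_pos[OF kK] beta[OF k] tier_exponent_gt_2[OF kK] by auto
  have "AE \<omega> in M. \<forall>l\<in>{..K}. \<forall>i. radii (tier_points l \<omega>) i \<noteq> 0"
    by (intro AE_finite_allI AE_poisson_pp_nonzero[OF pp]) auto
  moreover have "AE \<omega> in M. \<forall>l\<in>{..K}. \<forall>i. 0 < radii (tier_points l \<omega>) i \<longrightarrow> radii (tier_points l \<omega>) i \<noteq> radii (tier_points l \<omega>) (Suc i)"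
    by (intro AE_finite_allI AE_poisson_pp_distinct[OF pp] tier_intensity_nonneg) auto
  moreover have "AE \<omega> in M. \<forall>l\<in>{..K}. \<forall>i. 0 < fading l \<omega> i"
    by (intro AE_finite_allI AE_all_countable[THEN iffD2] allI exponential_AE_pos fading_distributed) auto
  ultimately show ?thesis
    using AE_good[OF k] AE_interferer_summable[OF k]
  proof eventually_elim
    fix \<omega>
    assume nz: "\<forall>l\<in>{..K}. \<forall>i. radii (tier_points l \<omega>) i \<noteq> 0"
      and dist: "\<forall>l\<in>{..K}. \<forall>i. 0 < radii (tier_points l \<omega>) i \<longrightarrow> radii (tier_points l \<omega>) i \<noteq> radii (tier_points l \<omega>) (Suc i)"
      and fp: "\<forall>l\<in>{..K}. \<forall>i. 0 < fading l \<omega> i"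
      and good: "\<omega> \<in> space M \<and> 0 < tier_radii k \<omega> 0 \<and> (\<forall>i. 0 \<le> tier_radii k \<omega> i) \<and> (\<forall>i>0. tier_radii k \<omega> 0 < tier_radii k \<omega> i)"
      and summ: "\<forall>l\<le>K. summable (interferer k l \<omega>)"
    define t where "t = tier_radii k \<omega> 0"
    have t: "0 < t" using good by (simp add: t_def)
    have pos: "0 < tier_radii l \<omega> i" if "l \<le> K" "0 \<le> tier_radii l \<omega> i" for l i
      using nz that by (auto simp: tier_radii_def order_less_le)
    have lf: "locally_finite (tier_points l \<omega>)" if "l \<le> K" for l
      using that good by (intro locally_finite_tier_points) auto
    \<comment> \<open>Without ties all earlier radii are strictly smaller, so the number of strictly
      nearer stations is the index itself.\<close>
    have rk: "rank l \<omega> i = i" if l: "l \<le> K" and i: "0 \<le> tier_radii l \<omega> i" for l i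
    proof -
      have "tier_radii l \<omega> j < tier_radii l \<omega> i" if j: "j < i" for j
      proof -
        have "0 \<le> tier_radii l \<omega> j" "0 \<le> tier_radii l \<omega> (Suc j)" "tier_radii l \<omega> j \<le> tier_radii l \<omega> (Suc j)" "tier_radii l \<omega> (Suc j) \<le> tier_radii l \<omega> i"
          using radii_mono[OF lf[OF l], of i j] radii_mono[OF lf[OF l], of i "Suc j"] radii_mono[OF lf[OF l], of "Suc j" j] i j
          by (auto simp: tier_radii_def)
        moreover have "tier_radii l \<omega> j \<noteq> tier_radii l \<omega> (Suc j)"
          using dist l pos[OF l calculation(1)] by (simp add: tier_radii_def)
        ultimately show ?thesis by simp
      qed
      then have "{j\<in>{..<i}. tier_radii l \<omega> j < tier_radii l \<omega> i} = {..<i}" by auto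
      then show ?thesis by (simp add: rank_def)
    qed
    have Qf: "fading_pos l \<omega> i = fading l \<omega> i" if "l \<le> K" for l i
      using fp that by (simp add: fading_pos_def max_absorb2 less_imp_le)
    have rv: "recv l \<omega> i = gain l (tier_radii l \<omega> i) * fading_pos l \<omega> i" if "l \<le> K" for l i
      using rk[OF that, of i] Qf[OF that] by (simp add: recv_def gain_def)
    have S: "signal k \<omega> = gain k t * fading_pos k \<omega> 0"
      using t Qf[OF kK] by (simp add: signal_def gain_def t_def)
    have tier: "infsum (recv l \<omega>) UNIV = suminf (interferer k l \<omega>) + (if l = k then signal k \<omega> else 0)"
      if l: "l \<le> K" for l
    proof -
      have eq: "recv l \<omega> i = interferer k l \<omega> i + (if i = 0 then (if l = k then signal k \<omega> else 0) else 0)" for i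
        using S rv[OF l] by (auto simp: interferer_def t_def)
      have "recv l \<omega> sums (suminf (interferer k l \<omega>) + (if l = k then signal k \<omega> else 0))"
        unfolding eq using summ l
        by (intro sums_add summable_sums sums_single[of 0 "\<lambda>i. if l = k then signal k \<omega> else 0"]) auto
      moreover have "0 \<le> recv l \<omega> i" for i
        unfolding rv[OF l] by (intro mult_nonneg_nonneg gain_nonneg fading_pos_nonneg l)
      ultimately show ?thesis
        by (intro infsumI norm_summable_imp_has_sum) (auto simp: sums_iff)
    qed
    have tot: "total \<omega> = interference k \<omega> + signal k \<omega>"
      unfolding total_def interference_def using kK by (simp add: tier sum.distrib)
    define D where "D = interference k \<omega> + \<eta>"
    \<comment> \<open>A quotient by \<open>0\<close> would be \<open>0\<close>, so the denominator
      has to be positive even without noise. The second nearest station of tier \<open>k\<close>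
      ensures this.\<close>
    have D: "0 < D"
    proof -
      have "0 < interferer k k \<omega> 1"
      proof -
        have "0 < tier_radii k \<omega> 1" using good t by (metis less_trans t_def zero_less_one)
        then show ?thesis
          using Pk fp kK by (simp add: interferer_def gain_def Qf)
      qed
      then have "0 < suminf (interferer k k \<omega>)"
        using summ kK by (intro suminf_pos2[of _ 1] interferer_nonneg) auto
      also have "\<dots> \<le> interference k \<omega>"
        unfolding interference_def using summ kK
        by (intro member_le_sum) (auto intro!: suminf_nonneg interferer_nonneg)
      finally show ?thesis using eta by (simp add: D_def)
    qed
    have tp: "t powr tier_exponent k * t powr - tier_exponent k = 1" "0 < t powr tier_exponent k"
      using t by (simp_all add: powr_add[symmetric])
    have "\<beta> k < signal k \<omega> / (total \<omega> - signal k \<omega> + \<eta>) \<longleftrightarrow> \<beta> k * D < tier_power k * t powr - tier_exponent k * fading k \<omega> 0"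
    proof -
      have "total \<omega> - signal k \<omega> + \<eta> = D" by (simp add: tot D_def)
      moreover have "signal k \<omega> = tier_power k * t powr - tier_exponent k * fading k \<omega> 0"
        by (simp add: signal_def t_def)
      ultimately show ?thesis using D by (simp add: pos_less_divide_eq)
    qed
    also have "\<dots> \<longleftrightarrow> t powr tier_exponent k / tier_power k * (\<beta> k * D) < t powr tier_exponent k / tier_power k * (tier_power k * t powr - tier_exponent k * fading k \<omega> 0)"
      using tp(2) Pk by (intro mult_less_cancel_left_pos[symmetric]) simp
    also have "t powr tier_exponent k / tier_power k * (tier_power k * t powr - tier_exponent k * fading k \<omega> 0) = (t powr tier_exponent k * t powr - tier_exponent k) * fading k \<omega> 0"
      using Pk by simp
    also have "t powr tier_exponent k / tier_power k * (\<beta> k * D) = laplace_arg k t * D"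
      by (simp add: laplace_arg_def)
    finally have sinr: "\<beta> k < signal k \<omega> / (total \<omega> - signal k \<omega> + \<eta>) \<longleftrightarrow> laplace_arg k t * D < fading k \<omega> 0"
      using tp(1) by simp
    \<comment> \<open>Path loss decreases with distance, so the comparison of mean powers turns into
      a lower bound on the distance.\<close>
    have cmp: "tier_power l * tier_radii l \<omega> i powr - tier_exponent l < tier_power k * t powr - tier_exponent k \<longleftrightarrow> exclusion_radius k l t < tier_radii l \<omega> i"
      if l: "l \<in> {1..K}" "0 \<le> tier_radii l \<omega> i" for l i
    proof -
      have lK: "l \<le> K" and el: "2 < tier_exponent l" and Pl: "0 < tier_power l"
        using l tier_exponent_gt_2[of l] tier_power_pos[of l] by auto
      define r where "r = tier_radii l \<omega> i"
      have r: "0 < r" using pos[OF lK l(2)] by (simp add: r_def)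
      have "tier_power l * r powr - tier_exponent l < tier_power k * t powr - tier_exponent k \<longleftrightarrow> tier_power l * t powr tier_exponent k / tier_power k < r powr tier_exponent l"
        using r t Pk by (simp add: powr_minus_divide divide_less_eq less_divide_eq mult_ac)
      also have "\<dots> \<longleftrightarrow> exclusion_radius k l t powr tier_exponent l < r powr tier_exponent l"
        using el Pl Pk t by (simp add: exclusion_radius_def powr_powr)
      also have "\<dots> \<longleftrightarrow> exclusion_radius k l t < r"
        using powr_less_mono2[of "tier_exponent l" "exclusion_radius k l t" r] powr_mono2[of "tier_exponent l" r "exclusion_radius k l t"] el r
        by (auto simp: exclusion_radius_def not_le[symmetric])
      finally show ?thesis by (simp add: r_def)
    qed
    have own: "tier_power k * tier_radii k \<omega> i powr - tier_exponent k < tier_power k * t powr - tier_exponent k" if "i \<noteq> 0" for i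
    proof -
      have "t < tier_radii k \<omega> i" using good that by (simp add: t_def)
      then have "tier_radii k \<omega> i powr - tier_exponent k < t powr - tier_exponent k"
        using t ek by (intro powr_less_mono2_neg) auto
      then show ?thesis using Pk by simp
    qed
    have "strongest k \<omega> \<longleftrightarrow> serving k \<omega>"
    proof
      assume "strongest k \<omega>"
      then show "serving k \<omega>"
        using cmp unfolding strongest_def serving_def t_def by blast
    next
      assume w: "serving k \<omega>"
      show "strongest k \<omega>"
        unfolding strongest_def
      proof (intro conjI ballI allI impI)
        show "0 \<le> tier_radii k \<omega> 0" using good by simp
        fix l i assume l: "l \<in> {1..K}" "(l, i) \<noteq> (k, 0) \<and> 0 \<le> tier_radii l \<omega> i"
        show "tier_power l * tier_radii l \<omega> i powr - tier_exponent l < tier_power k * tier_radii k \<omega> 0 powr - tier_exponent k"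
        proof (cases "l = k")
          case True
          then show ?thesis using own[of i] l by (simp add: t_def)
        next
          case False
          then show ?thesis using cmp[of l i] w l by (simp add: serving_def t_def)
        qed
      qed
    qed
    then show "covered k \<omega> \<longleftrightarrow> serving k \<omega> \<and> laplace_arg k (tier_radii k \<omega> 0) * (interference k \<omega> + \<eta>) < fading k \<omega> 0"
      using sinr by (simp add: covered_def D_def t_def)
  qed
qed

lemma serving_sinr_measurable:
  assumes k: "k \<in> {1..K}"
  shows "(\<lambda>\<omega>. if serving k \<omega> \<and> laplace_arg k (tier_radii k \<omega> 0) * (interference k \<omega> + \<eta>) < fading k \<omega> 0 then 1 else 0 :: real) \<in> borel_measurable M"
proof -
  have kK: "k \<le> K" using k by simp
  note [measurable] = tier_radii_measurable[OF kK] fading_measurable[OF kK] tier_radii_measurable fading_pos_measurable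
  have [measurable]: "(\<lambda>\<omega>. if serving k \<omega> then 1 else 0 :: real) \<in> borel_measurable M"
    by (rule serving_measurable[OF k]) (auto intro: tier_radii_measurable)
  have [measurable]: "interference k \<in> borel_measurable M"
    unfolding interference_def interferer_def by (intro borel_measurable_sum borel_measurable_suminf) simp
  have "(\<lambda>\<omega>. (if serving k \<omega> then 1 else 0) * (if laplace_arg k (tier_radii k \<omega> 0) * (interference k \<omega> + \<eta>) < fading k \<omega> 0 then 1 else 0) :: real) \<in> borel_measurable M"
    unfolding laplace_arg_def by measurable
  also have "(\<lambda>\<omega>. (if serving k \<omega> then 1 else 0) * (if laplace_arg k (tier_radii k \<omega> 0) * (interference k \<omega> + \<eta>) < fading k \<omega> 0 then 1 else 0) :: real) =
    (\<lambda>\<omega>. if serving k \<omega> \<and> laplace_arg k (tier_radii k \<omega> 0) * (interference k \<omega> + \<eta>) < fading k \<omega> 0 then 1 else 0)"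
    by auto
  finally show ?thesis .
qed

text \<open>Strict maximality cannot hold for two tiers at once, so the coverage events are disjoint
  for every outcome and their probabilities add up.\<close>

lemma marp_coverage_eq_sum:
  "marp_coverage M K No Psi Po eps (\<lambda>k. expectation (\<lambda>\<omega>. Psi k \<omega> 0)) Nc Psic Pc epsc \<eta> \<beta> =
    (\<Sum>k\<in>{1..K}. LINT t:{0<..}|lborel. 2 * tier_intensity k * pi * t * (exp (- (laplace_arg k t * \<eta>)) * (\<Prod>l\<le>K. tier_laplace k l t)))"
proof -
  define E where "E k = {\<omega>\<in>space M. covered k \<omega>}" for k
  have E: "E k \<in> sets M" if "k \<in> {1..K}" for k
    using covered_measurable[OF that] by (simp add: E_def pred_def)
  have "marp_coverage M K No Psi Po eps (\<lambda>k. expectation (\<lambda>\<omega>. Psi k \<omega> 0)) Nc Psic Pc epsc \<eta> \<beta> = prob (\<Union>k\<in>{1..K}. E k)"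
    unfolding marp_coverage_def E_def using coverage_event_iff by (intro arg_cong[where f=prob]) blast
  also have "\<dots> = (\<Sum>k\<in>{1..K}. prob (E k))"
  proof (rule finite_measure_finite_Union)
    show "disjoint_family_on E {1..K}"
      unfolding disjoint_family_on_def
    proof (intro ballI impI)
      fix k k' assume k: "k \<in> {1..K}" "k' \<in> {1..K}" "k \<noteq> k'"
      show "E k \<inter> E k' = {}"
      proof (rule ccontr)
        assume "E k \<inter> E k' \<noteq> {}"
        then obtain \<omega> where "strongest k \<omega>" "strongest k' \<omega>"
          by (auto simp: E_def covered_def)
        then have "tier_power k' * tier_radii k' \<omega> 0 powr - tier_exponent k' < tier_power k * tier_radii k \<omega> 0 powr - tier_exponent k" "tier_power k * tier_radii k \<omega> 0 powr - tier_exponent k < tier_power k' * tier_radii k' \<omega> 0 powr - tier_exponent k'"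
          using k unfolding strongest_def by auto
        then show False by simp
      qed
    qed
  qed (use E in auto)
  also have "\<dots> = (\<Sum>k\<in>{1..K}. LINT t:{0<..}|lborel. 2 * tier_intensity k * pi * t * (exp (- (laplace_arg k t * \<eta>)) * (\<Prod>l\<le>K. tier_laplace k l t)))"
  proof (rule sum.cong[OF refl])
    fix k assume k: "k \<in> {1..K}"
    have "prob (E k) = expectation (\<lambda>\<omega>. if covered k \<omega> then 1 else 0)"
    proof -
      have "expectation (\<lambda>\<omega>. if covered k \<omega> then 1 else 0) = expectation (indicator (E k) :: 'a \<Rightarrow> real)"
        by (intro Bochner_Integration.integral_cong) (auto simp: E_def indicator_def)
      then show ?thesis using E[OF k] by simp
    qed
    also have "\<dots> = expectation (\<lambda>\<omega>. if serving k \<omega> \<and> laplace_arg k (tier_radii k \<omega> 0) * (interference k \<omega> + \<eta>) < fading k \<omega> 0 then 1 else 0)"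
    proof (rule integral_cong_AE)
      show "AE \<omega> in M. (if covered k \<omega> then 1 else 0 :: real) = (if serving k \<omega> \<and> laplace_arg k (tier_radii k \<omega> 0) * (interference k \<omega> + \<eta>) < fading k \<omega> 0 then 1 else 0)"
        using AE_covered_iff[OF k] by eventually_elim simp
      note [measurable] = covered_measurable[OF k]
      show "(\<lambda>\<omega>. if covered k \<omega> then 1 else 0 :: real) \<in> borel_measurable M"
        by measurable
      show "(\<lambda>\<omega>. if serving k \<omega> \<and> laplace_arg k (tier_radii k \<omega> 0) * (interference k \<omega> + \<eta>) < fading k \<omega> 0 then 1 else 0 :: real) \<in> borel_measurable M"
        by (rule serving_sinr_measurable[OF k])
    qed
    also have "\<dots> = (LINT t:{0<..}|lborel. 2 * tier_intensity k * pi * t * (exp (- (laplace_arg k t * \<eta>)) * (\<Prod>l\<le>K. tier_laplace k l t)))"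
      by (rule coverage_integral[OF k])
    finally show "prob (E k) = (LINT t:{0<..}|lborel. 2 * tier_intensity k * pi * t * (exp (- (laplace_arg k t * \<eta>)) * (\<Prod>l\<le>K. tier_laplace k l t)))" .
  qed
  finally show ?thesis .
qed

end

section \<open>The coverage probability\<close>

lemma integral_exponential_halfline:
  assumes A: "0 < (A::real)"
  shows "(LINT u:{0<..}|lborel. exp (- (A * u))) = 1 / A"
proof -
  have "1 = (LINT u|lborel. exponential_density A u)"
    by (rule integral_exponential_density[OF A, symmetric])
  also have "(LINT u|lborel. exponential_density A u) = (LINT u|lborel. A * (indicator {0<..} u * exp (- (A * u))))"
  proof (rule integral_cong_AE)
    show "AE u in lborel. exponential_density A u = A * (indicator {0<..} u * exp (- (A * u)))"
      using AE_lborel_singleton[of 0] by eventually_elim (auto simp: exponential_density_def indicator_def mult_ac)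
  qed measurable
  also have "\<dots> = A * (LINT u:{0<..}|lborel. exp (- (A * u)))"
    unfolding set_lebesgue_integral_def real_scaleR_def by (rule integral_mult_right_zero)
  finally show ?thesis using A by (simp add: field_simps)
qed

lemma integral_gaussian_radial:
  assumes A: "0 < (A::real)"
  shows "(LINT r:{0<..}|lborel. 2 * pi * r * exp (- (A * r\<^sup>2))) = pi / A"
proof -
  have "(LINT r:{0<..}|lborel. 2 * pi * r * exp (- (A * r\<^sup>2))) = (LINT r:{0<..}|lborel. \<bar>2 * r\<bar> * (pi * exp (- (A * r\<^sup>2))))"
    by (rule set_lebesgue_integral_cong) auto
  also have "\<dots> = (LINT u:{0<..}|lborel. pi * exp (- (A * u)))"
    by (rule lborel_integral_square_substitution) measurable
  also have "\<dots> = pi / A"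
    by (simp add: integral_exponential_halfline[OF A])
  finally show ?thesis .
qed

context cellular_network
begin

text \<open>Substitution \<open>t = q * r\<close> with
  \<open>q powr eps k = Po k / \<beta> k\<close>. It makes \<open>laplace_arg k t\<close> equal to
  \<open>r powr eps k\<close>, and \<open>t\<close> together with the Jacobian supplies
  \<open>q^2\<close>, the powers of \<open>Po k\<close> and \<open>\<beta> k\<close> in front of the
  integral.\<close>

lemma tier_integral:
  assumes k: "k \<in> {1..K}"
  shows "(LINT t:{0<..}|lborel. 2 * tier_intensity k * pi * t * (exp (- (laplace_arg k t * \<eta>)) * (\<Prod>l\<le>K. tier_laplace k l t))) =
    lo k * Po k powr (2 / eps k) * \<beta> k powr (- 2 / eps k) *
      (LINT r:{0<..}|lborel. 2 * pi * r * exp (- \<eta> * r powr eps k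
               - lc * pi * Pc powr (2 / epsc) * r powr (2 * eps k / epsc) / sinc (2 * pi / epsc)
               - (\<Sum>l\<in>{1..K}. lo l * pi * Po l powr (2 / eps l) * Ffun (\<beta> k) (eps l)
                                 * r powr (2 * eps k / eps l))))"
    (is "_ = ?c * (LINT r:{0<..}|lborel. ?f r)")
proof -
  have kK: "k \<le> K" using k by simp
  have k': "tier_power k = Po k" "tier_exponent k = eps k" "tier_intensity k = lo k"
    using k by (auto simp: tier_power_def tier_exponent_def tier_intensity_def)
  have Pk: "0 < Po k" and bk: "0 < \<beta> k" and ek: "2 < eps k"
    using Po[OF k] beta[OF k] eps[OF k] by auto
  define q where "q = (Po k / \<beta> k) powr (1 / eps k)"
  have q: "0 < q" using Pk bk by (simp add: q_def)
  have qe: "q powr eps k = Po k / \<beta> k"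
    using Pk bk ek by (simp add: q_def powr_powr)
  have q2: "q\<^sup>2 = Po k powr (2 / eps k) * \<beta> k powr (- 2 / eps k)"
  proof -
    have "q\<^sup>2 = q powr 2" using q by (simp add: powr_numeral)
    also have "\<dots> = (Po k / \<beta> k) powr (2 / eps k)"
      by (simp add: q_def powr_powr)
    also have "\<dots> = Po k powr (2 / eps k) * \<beta> k powr (- 2 / eps k)"
      using Pk bk by (simp add: powr_divide powr_minus_divide)
    finally show ?thesis .
  qed
  define F where "F t = 2 * tier_intensity k * pi * t * (exp (- (laplace_arg k t * \<eta>)) * (\<Prod>l\<le>K. tier_laplace k l t))" for t
  have [measurable]: "F \<in> borel_measurable borel"
    unfolding F_def tier_laplace_def laplace_arg_def by measurable
  have img: "(\<lambda>r. q * r) ` {0<..} = {0<..}"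
    using q by (auto intro!: image_eqI[of _ _ "_ / q"])
  have "((\<lambda>r. q * r) has_real_derivative q) (at r)" for r
    by (auto intro!: derivative_eq_intros)
  moreover have "inj_on (\<lambda>r. q * r) {0<..}"
    using q by (auto simp: inj_on_def)
  ultimately have "(LINT t:{0<..}|lborel. F t) = (LINT r:{0<..}|lborel. \<bar>q\<bar> * F (q * r))"
    using lborel_substitution(2)[of "{0<..}" "\<lambda>r. q * r" F "\<lambda>_. q"] unfolding img by simp
  also have "\<dots> = (LINT r:{0<..}|lborel. ?c * ?f r)"
  proof (intro set_lebesgue_integral_cong allI impI)
    fix r :: real assume "r \<in> {0<..}"
    then have r: "0 < r" by simp
    have s: "laplace_arg k (q * r) = r powr eps k"
      using q r Pk bk by (simp add: laplace_arg_def k' powr_mult qe)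
    have L: "tier_laplace k l (q * r) = exp (- (tier_intensity l * pi * tier_power l powr (2 / tier_exponent l) * laplace_coeff k l * r powr (2 * eps k / tier_exponent l)))" if "l \<le> K" for l
      using r tier_power_pos[OF that] by (simp add: tier_laplace_def s powr_mult powr_powr mult_ac)
    have "{..K} = insert 0 {1..K}" by auto
    then have "(\<Prod>l\<le>K. tier_laplace k l (q * r)) = tier_laplace k 0 (q * r) * (\<Prod>l\<in>{1..K}. tier_laplace k l (q * r))"
      by simp
    also have "tier_laplace k 0 (q * r) = exp (- (lc * pi * Pc powr (2 / epsc) * r powr (2 * eps k / epsc) / sinc (2 * pi / epsc)))"
      by (simp add: L) (simp add: tier_intensity_def tier_power_def tier_exponent_def laplace_coeff_def)
    also have "(\<Prod>l\<in>{1..K}. tier_laplace k l (q * r)) = (\<Prod>l\<in>{1..K}. exp (- (lo l * pi * Po l powr (2 / eps l) * Ffun (\<beta> k) (eps l) * r powr (2 * eps k / eps l))))"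
      by (rule prod.cong) (auto simp: L tier_intensity_def tier_power_def tier_exponent_def laplace_coeff_def)
    also have "\<dots> = exp (- (\<Sum>l\<in>{1..K}. lo l * pi * Po l powr (2 / eps l) * Ffun (\<beta> k) (eps l) * r powr (2 * eps k / eps l)))"
      by (simp add: exp_sum sum_negf[symmetric])
    finally have prod: "(\<Prod>l\<le>K. tier_laplace k l (q * r)) = exp (- (lc * pi * Pc powr (2 / epsc) * r powr (2 * eps k / epsc) / sinc (2 * pi / epsc))) *
        exp (- (\<Sum>l\<in>{1..K}. lo l * pi * Po l powr (2 / eps l) * Ffun (\<beta> k) (eps l) * r powr (2 * eps k / eps l)))" .
    have e3: "exp (- x) * (exp (- y) * exp (- z)) = exp (- x - y - z)" for x y z :: real
      by (simp add: exp_add[symmetric])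
    have "\<bar>q\<bar> * F (q * r) = lo k * q\<^sup>2 * (2 * pi * r * (exp (- (r powr eps k * \<eta>)) * (\<Prod>l\<le>K. tier_laplace k l (q * r))))"
      using q by (simp add: F_def s k' power2_eq_square)
    also have "\<dots> = ?c * ?f r"
      unfolding prod e3 q2 by (simp add: mult_ac)
    finally show "\<bar>q\<bar> * F (q * r) = ?c * ?f r" .
  qed simp
  also have "\<dots> = ?c * (LINT r:{0<..}|lborel. ?f r)"
    by (rule set_integral_mult_right)
  finally show ?thesis by (simp add: F_def)
qed

text \<open>With equal exponents every power of \<open>r\<close> in the exponent is
  \<open>r^2\<close>, which leaves a Gaussian integral. The term \<open>- 0 * r powr eps k\<close>
  has the shape that the noise term takes for \<open>\<eta> = 0\<close>.\<close>

lemma equal_exponent_integral: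
  assumes k: "k \<in> {1..K}" and eq: "\<forall>k\<in>{1..K}. eps k = epsc"
  shows "(LINT r:{0<..}|lborel. 2 * pi * r * exp (- 0 * r powr eps k
               - lc * pi * Pc powr (2 / epsc) * r powr (2 * eps k / epsc) / sinc (2 * pi / epsc)
               - (\<Sum>l\<in>{1..K}. lo l * pi * Po l powr (2 / eps l) * Ffun (\<beta> k) (eps l)
                                 * r powr (2 * eps k / eps l)))) =
    sinc (2 * pi / epsc) / (lc * Pc powr (2 / epsc) + sinc (2 * pi / epsc) *
                  (\<Sum>l\<in>{1..K}. lo l * Po l powr (2 / epsc) * Ffun (\<beta> k) epsc))"
proof -
  define s where "s = sinc (2 * pi / epsc)"
  define G where "G = (\<Sum>l\<in>{1..K}. lo l * Po l powr (2 / epsc) * Ffun (\<beta> k) epsc)"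
  \<comment> \<open>\<open>A / pi\<close> is the denominator of the closed form divided by the sinc
    value.\<close>
  define A where "A = pi * (lc * Pc powr (2 / epsc) / s + G)"
  have s: "0 < s"
    unfolding s_def using epsc by (intro sinc_pos) (auto simp: field_simps)
  have "0 < G"
    unfolding G_def
  proof (rule sum_pos)
    fix l assume "l \<in> {1..K}"
    then show "0 < lo l * Po l powr (2 / epsc) * Ffun (\<beta> k) epsc"
      using lo[of l] Po[of l] Ffun_pos[OF epsc beta[OF k]] by (auto intro!: mult_pos_pos)
  qed (use k in auto)
  then have A: "0 < A"
    unfolding A_def using s lc by (intro mult_pos_pos add_nonneg_pos) auto
  have "(LINT r:{0<..}|lborel. 2 * pi * r * exp (- 0 * r powr eps k
               - lc * pi * Pc powr (2 / epsc) * r powr (2 * eps k / epsc) / sinc (2 * pi / epsc)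
               - (\<Sum>l\<in>{1..K}. lo l * pi * Po l powr (2 / eps l) * Ffun (\<beta> k) (eps l)
                                 * r powr (2 * eps k / eps l)))) = (LINT r:{0<..}|lborel. 2 * pi * r * exp (- (A * r\<^sup>2)))"
  proof (intro set_lebesgue_integral_cong allI impI)
    fix r :: real assume "r \<in> {0<..}"
    then have r: "r powr 2 = r\<^sup>2" by (simp add: powr_numeral)
    have "(\<Sum>l\<in>{1..K}. lo l * pi * Po l powr (2 / eps l) * Ffun (\<beta> k) (eps l) * r powr (2 * eps k / eps l)) = pi * G * r\<^sup>2"
      unfolding G_def sum_distrib_left sum_distrib_right
      by (rule sum.cong) (use eq k epsc r in auto)
    moreover have "r powr (2 * eps k / epsc) = r\<^sup>2"
      using eq k epsc r by simp
    ultimately show "2 * pi * r * exp (- 0 * r powr eps k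
               - lc * pi * Pc powr (2 / epsc) * r powr (2 * eps k / epsc) / sinc (2 * pi / epsc)
               - (\<Sum>l\<in>{1..K}. lo l * pi * Po l powr (2 / eps l) * Ffun (\<beta> k) (eps l)
                                 * r powr (2 * eps k / eps l))) = 2 * pi * r * exp (- (A * r\<^sup>2))"
      unfolding s_def[symmetric] by (simp add: A_def algebra_simps)
  qed simp
  also have "\<dots> = pi / A"
    by (rule integral_gaussian_radial[OF A])
  also have "\<dots> = s / (lc * Pc powr (2 / epsc) + s * G)"
  proof -
    have "A = pi * ((lc * Pc powr (2 / epsc) + s * G) / s)"
      using s by (simp add: A_def field_simps)
    then show ?thesis by simp
  qed
  finally show ?thesis
    by (simp add: s_def G_def)
qed

end

theorem theorem4:
  fixes M :: "'a measure" and K :: nat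
    and No :: "nat \<Rightarrow> 'a \<Rightarrow> pt set" and Psi :: "nat \<Rightarrow> 'a \<Rightarrow> nat \<Rightarrow> real"
    and lo Po eps \<beta> :: "nat \<Rightarrow> real"
    and Nc :: "'a \<Rightarrow> pt set" and Psic :: "'a \<Rightarrow> nat \<Rightarrow> real"
    and lc Pc epsc \<eta> :: real
  assumes M: "prob_space M"
    and K: "K \<ge> 1"
    and lo: "\<forall>k\<in>{1..K}. lo k > 0" and Po: "\<forall>k\<in>{1..K}. Po k > 0"
    and eps: "\<forall>k\<in>{1..K}. eps k > 2" and beta: "\<forall>k\<in>{1..K}. \<beta> k > 0"
    and lc: "lc \<ge> 0" and Pc: "Pc > 0" and epsc: "epsc > 2" and eta: "\<eta> \<ge> 0"
    and ppp_open: "\<forall>k\<in>{1..K}. poisson_pp M (lo k) (No k)"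
    and ppp_closed: "poisson_pp M lc Nc"
    and fade_open: "\<forall>k\<in>{1..K}. \<forall>i. distributed M lborel (\<lambda>\<omega>. Psi k \<omega> i) (exponential_density 1)"
    and fade_closed: "\<forall>i. distributed M lborel (\<lambda>\<omega>. Psic \<omega> i) (exponential_density 1)"
    and indep: "prob_space.indep_sets M (src_sigma M No Psi Nc Psic) (src_index K)"
  shows "marp_coverage M K No Psi Po eps (\<lambda>k. prob_space.expectation M (\<lambda>\<omega>. Psi k \<omega> 0))
            Nc Psic Pc epsc \<eta> \<beta> =
         (\<Sum>k\<in>{1..K}. lo k * Po k powr (2 / eps k) * \<beta> k powr (- 2 / eps k) *
            (LINT r:{0<..}|lborel. 2 * pi * r * exp (- \<eta> * r powr eps k
               - lc * pi * Pc powr (2 / epsc) * r powr (2 * eps k / epsc) / sinc (2 * pi / epsc)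
               - (\<Sum>l\<in>{1..K}. lo l * pi * Po l powr (2 / eps l) * Ffun (\<beta> k) (eps l)
                                 * r powr (2 * eps k / eps l)))))
         \<and> (\<eta> = 0 \<and> (\<forall>k\<in>{1..K}. eps k = epsc) \<longrightarrow>
            marp_coverage M K No Psi Po eps (\<lambda>k. prob_space.expectation M (\<lambda>\<omega>. Psi k \<omega> 0))
              Nc Psic Pc epsc \<eta> \<beta> =
            (\<Sum>k\<in>{1..K}. lo k * Po k powr (2 / epsc) * \<beta> k powr (- 2 / epsc) * sinc (2 * pi / epsc) /
               (lc * Pc powr (2 / epsc) + sinc (2 * pi / epsc) *
                  (\<Sum>l\<in>{1..K}. lo l * Po l powr (2 / epsc) * Ffun (\<beta> k) epsc))))"
proof -
  interpret prob_space M by (rule M)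
  interpret cellular_network M K No Psi lo Po eps \<beta> Nc Psic lc Pc epsc \<eta>
    using assms by unfold_locales auto
  have main: "marp_coverage M K No Psi Po eps (\<lambda>k. expectation (\<lambda>\<omega>. Psi k \<omega> 0)) Nc Psic Pc epsc \<eta> \<beta> =
     (\<Sum>k\<in>{1..K}. lo k * Po k powr (2 / eps k) * \<beta> k powr (- 2 / eps k) *
            (LINT r:{0<..}|lborel. 2 * pi * r * exp (- \<eta> * r powr eps k
               - lc * pi * Pc powr (2 / epsc) * r powr (2 * eps k / epsc) / sinc (2 * pi / epsc)
               - (\<Sum>l\<in>{1..K}. lo l * pi * Po l powr (2 / eps l) * Ffun (\<beta> k) (eps l)
                                 * r powr (2 * eps k / eps l)))))"
    unfolding marp_coverage_eq_sum by (intro sum.cong refl tier_integral)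
  show ?thesis
  proof (intro conjI impI)
    assume eq: "\<eta> = 0 \<and> (\<forall>k\<in>{1..K}. eps k = epsc)"
    show "marp_coverage M K No Psi Po eps (\<lambda>k. expectation (\<lambda>\<omega>. Psi k \<omega> 0)) Nc Psic Pc epsc \<eta> \<beta> =
      (\<Sum>k\<in>{1..K}. lo k * Po k powr (2 / epsc) * \<beta> k powr (- 2 / epsc) * sinc (2 * pi / epsc) /
               (lc * Pc powr (2 / epsc) + sinc (2 * pi / epsc) *
                  (\<Sum>l\<in>{1..K}. lo l * Po l powr (2 / epsc) * Ffun (\<beta> k) epsc)))"
      unfolding main
    proof (rule sum.cong[OF refl])
      fix k assume k: "k \<in> {1..K}"
      have e: "\<eta> = 0" "eps k = epsc" using eq k by auto
      show "lo k * Po k powr (2 / eps k) * \<beta> k powr (- 2 / eps k) *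
            (LINT r:{0<..}|lborel. 2 * pi * r * exp (- \<eta> * r powr eps k
               - lc * pi * Pc powr (2 / epsc) * r powr (2 * eps k / epsc) / sinc (2 * pi / epsc)
               - (\<Sum>l\<in>{1..K}. lo l * pi * Po l powr (2 / eps l) * Ffun (\<beta> k) (eps l)
                                 * r powr (2 * eps k / eps l)))) =
        lo k * Po k powr (2 / epsc) * \<beta> k powr (- 2 / epsc) * sinc (2 * pi / epsc) /
               (lc * Pc powr (2 / epsc) + sinc (2 * pi / epsc) *
                  (\<Sum>l\<in>{1..K}. lo l * Po l powr (2 / epsc) * Ffun (\<beta> k) epsc))"
        using equal_exponent_integral[OF k conjunct2[OF eq]] unfolding e by simp
    qed
  qed (rule main)
qed

end
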